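(* Let $L_t$, $t\ge 0$, be a Lévy process whose Lévy measure $\Pi$ satisfies $\Pi(0,\infty)>0$, and assume $E\log(1+|L_1|)<\infty$. Let $\beta>0$, $x\in\mathbb{R}$, and let $X_t$ be the Ornstein--Uhlenbeck process solving $$X_t = x-\beta\int_0^t X_s\,ds + L_t,\quad t\ge 0.$$ For $b>x$ let $\tau_b=\inf\{t>0: X_t\ge b\}$. Let $K=\sup\{u\ge 0: Ee^{uL_1}<\infty\}$ and assume $0<K\le\infty$. Define $$\varphi(u)=\frac{1}{\beta}\int_0^u \frac{\log\left(Ee^{vL_1}\right)}{v}\,dv,\quad 0\le u<K,\qquad \varphi(K)=\lim_{u\uparrow K}\varphi(u),$$ and assume $\varphi(K)=\infty$. For $z\in\mathbb{R}$ and $\mu>0$ set $$G(z,\mu)=\int_0^K e^{uz-\varphi(u)}u^{\mu-1}\,du.$$ Then for every $\mu>0$, $$E\left(e^{-\mu\beta\tau_b}\,G(X_{\tau_b},\mu)\right)=G(x,\mu).$$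
   Context: The initial value $X_0=x$ is non-random. When $K=\infty$, $\varphi(K)$ is understood as $\lim_{u\to\infty}\varphi(u)$ and the integral defining $G$ is over $(0,\infty)$. *)

theory Defs
  imports "HOL-Probability.Probability"
begin

definition levy_process :: "'a measure \<Rightarrow> (real \<Rightarrow> 'a \<Rightarrow> real) \<Rightarrow> bool" where
  "levy_process M L \<longleftrightarrow>
     prob_space M \<and>
     (\<forall>t\<ge>0. L t \<in> borel_measurable M) \<and>
     (AE \<omega> in M. L 0 \<omega> = 0) \<and>
     (\<forall>(s::nat \<Rightarrow> real) n. 0 \<le> s 0 \<and> (\<forall>i<n. s i < s (Suc i)) \<longrightarrow>
        prob_space.indep_vars M (\<lambda>_. borel) (\<lambda>i \<omega>. L (s (Suc i)) \<omega> - L (s i) \<omega>) {..<n}) \<and>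
     (\<forall>s t. 0 \<le> s \<and> s \<le> t \<longrightarrow>
        distr M borel (\<lambda>\<omega>. L t \<omega> - L s \<omega>) = distr M borel (L (t - s))) \<and>
     (AE \<omega> in M. (\<forall>t\<ge>0. continuous (at_right t) (\<lambda>s. L s \<omega>)) \<and>
                  (\<forall>t>0. \<exists>l. ((\<lambda>s. L s \<omega>) \<longlongrightarrow> l) (at_left t)))"

text \<open>nu is the Levy measure of L: the measure in the Levy-Khintchine representation
  of the characteristic function of L 1.\<close>
definition levy_measure :: "'a measure \<Rightarrow> (real \<Rightarrow> 'a \<Rightarrow> real) \<Rightarrow> real measure \<Rightarrow> bool" where
  "levy_measure M L nu \<longleftrightarrow>
     sets nu = sets borel \<and> emeasure nu {0} = 0 \<and>
     (\<integral>\<^sup>+ y. ennreal (min 1 (y\<^sup>2)) \<partial>nu) < \<infinity> \<and>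
     (\<exists>\<gamma> \<sigma>. \<sigma> \<ge> 0 \<and> (\<forall>\<theta>::real.
        char (distr M borel (L 1)) \<theta> =
          exp (\<i> * complex_of_real (\<gamma> * \<theta>) - complex_of_real (\<sigma>\<^sup>2 * \<theta>\<^sup>2 / 2)
               + (CLINT y|nu. iexp (\<theta> * y) - 1
                      - \<i> * complex_of_real (\<theta> * y * indicator {-1<..<1} y)))))"

definition mgf_bound :: "'a measure \<Rightarrow> (real \<Rightarrow> 'a \<Rightarrow> real) \<Rightarrow> ereal" where
  "mgf_bound M L = Sup {ereal u | u. 0 \<le> u \<and> (\<integral>\<^sup>+ \<omega>. ennreal (exp (u * L 1 \<omega>)) \<partial>M) < \<infinity>}"

definition ou_phi :: "'a measure \<Rightarrow> (real \<Rightarrow> 'a \<Rightarrow> real) \<Rightarrow> real \<Rightarrow> real \<Rightarrow> real" where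
  "ou_phi M L \<beta> u =
     (1 / \<beta>) * (LINT v:{0<..<u}|lborel. ln (\<integral>\<omega>. exp (v * L 1 \<omega>) \<partial>M) / v)"

definition ou_G :: "'a measure \<Rightarrow> (real \<Rightarrow> 'a \<Rightarrow> real) \<Rightarrow> real \<Rightarrow> real \<Rightarrow> real \<Rightarrow> ennreal" where
  "ou_G M L \<beta> z \<mu> =
     (\<integral>\<^sup>+ u \<in> {u. 0 < u \<and> ereal u < mgf_bound M L}.
        ennreal (exp (u * z - ou_phi M L \<beta> u) * u powr (\<mu> - 1)) \<partial>lborel)"

text \<open>First passage time tau_b = inf {t > 0 : X_t \<ge> b} (= \<infinity> if the set is empty).\<close>
definition hitting_time :: "(real \<Rightarrow> 'a \<Rightarrow> real) \<Rightarrow> real \<Rightarrow> 'a \<Rightarrow> ereal" where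
  "hitting_time X b \<omega> = Inf {ereal t | t. t > 0 \<and> X t \<omega> \<ge> b}"

end

theory Submission
  imports Defs
begin

text \<open>
  Write \<open>\<kappa> v = ln E (exp (v L\<^sub>1))\<close> and let \<open>G\<^sub>a\<close> be the integral defining \<open>G\<close>, cut off at \<open>a < K\<close>. Since
  \<open>E exp (u X\<^sub>h - \<phi> u) = exp (w x - \<phi> w)\<close> with \<open>w = u exp (-\<beta> h)\<close>, the substitution \<open>u \<mapsto> w\<close> shows that
  \<open>exp (-\<mu> \<beta> t) G\<^sub>a (X\<^sub>t)\<close> loses over a time step \<open>h\<close> only the mass of the interval \<open>[a exp (-\<beta> h), a)\<close>.
  Below the level \<open>b\<close> this loss is at most \<open>\<epsilon> h\<close> for \<open>a\<close> near \<open>K\<close>, because \<open>\<phi>\<close> tends to infinity there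
  (for \<open>K = \<infinity>\<close> one needs that \<open>\<phi>\<close> grows superlinearly, which holds since a positive jump makes \<open>L\<^sub>1\<close>
  unbounded above). So \<open>E exp (-\<mu> \<beta> T) G\<^sub>a (X\<^sub>T)\<close> differs from \<open>G\<^sub>a(x)\<close> by at most \<open>\<epsilon> / \<mu>\<close> when \<open>T\<close> is the first
  passage over \<open>c < b\<close> along a dyadic grid. Refining the grid, letting \<open>c\<close> increase to \<open>b\<close> (where
  quasi-left-continuity of \<open>L\<close> excludes a jump at the limit of the passage times) and finally \<open>a\<close> to \<open>K\<close> gives
  the identity. The first two limits commute with the expectation because \<open>G\<^sub>a = o(G\<^sub>a')\<close> at infinity
  for \<open>a < a'\<close>, so that the stopped values are uniformly integrable.
\<close>

subsection \<open>Positive jumps make \<open>L 1\<close> unbounded above\<close>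

text \<open>The measure \<open>nu\<close> is given through the characteristic function of
  \<open>L 1\<close>, so positive jumps have to be extracted from it analytically.
  \<open>exp (psi / n)\<close> is the characteristic function of \<open>L (1 / n)\<close>, and n
  times the law of \<open>L (1 / n)\<close>, with a weight that damps small jumps, converges to the
  weighted \<open>nu\<close>. An upper bound \<open>C\<close> for \<open>L 1\<close> would keep
  \<open>L (1 / n)\<close> below \<open>C / n\<close> and so confine \<open>nu\<close> to the
  negative half-line. The transition of \<open>X\<close> over a time step is likewise built from
  finite objects: it is a limit of weighted sums of dyadic increments of \<open>L\<close>, whose
  exponents are Riemann sums for \<open>phi\<close>. All stopping then takes place on countable
  grids, in sigma-algebras generated by increments without null sets. The detour over levels below
  \<open>b\<close> has a concrete cause: a path may satisfy \<open>X t \<ge> b\<close> at a single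
  non-dyadic time, for instance after a jump exactly to \<open>b\<close> followed by a decrease, and
  no grid sees this. Exceeding a level \<open>c < b\<close> persists to the right of such a time, so
  a fine grid does see it.\<close>

text \<open>The fourth difference of the Levy-Khintchine exponent annihilates the drift and the Gaussian part,
  and it is the Fourier transform of a finite measure that is equivalent to \<open>nu\<close> off the zeros of the weight.\<close>

definition fourth_diff :: "real \<Rightarrow> (real \<Rightarrow> complex) \<Rightarrow> real \<Rightarrow> complex" where
  "fourth_diff h f \<theta> = f (\<theta> + 2 * h) - 4 * f (\<theta> + h) + 6 * f \<theta> - 4 * f (\<theta> - h) + f (\<theta> - 2 * h)"

text \<open>A second difference multiplies \<open>iexp (\<theta> * y)\<close> by
  \<open>2 * cos (h * y) - 2\<close>, and the fourth difference is the second difference applied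
  twice.\<close>

lemma fourth_diff_iexp:
  "fourth_diff h (\<lambda>\<theta>. iexp (\<theta> * y)) \<theta> = complex_of_real ((2 - 2 * cos (h * y))^2) * iexp (\<theta> * y)"
proof -
  define Z where "Z = iexp (h * y)"
  define W where "W = iexp (- (h * y))"
  define E where "E = iexp (\<theta> * y)"
  have ZW: "Z * W = 1" unfolding Z_def W_def by (simp flip: exp_add)
  have c: "complex_of_real (2 - 2 * cos (h * y)) = 2 - (Z + W)"
    unfolding Z_def W_def by (simp add: complex_eq_iff Re_exp Im_exp)
  have e: "iexp ((\<theta> + 2 * h) * y) = E * Z * Z" "iexp ((\<theta> + h) * y) = E * Z"
    "iexp ((\<theta> - 2 * h) * y) = E * W * W" "iexp ((\<theta> - h) * y) = E * W"
    unfolding E_def Z_def W_def by (simp_all add: algebra_simps flip: exp_add)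
  have "fourth_diff h (\<lambda>\<theta>. iexp (\<theta> * y)) \<theta> = E * (Z * Z - 4 * Z + 6 - 4 * W + W * W)"
    unfolding fourth_diff_def e by (simp add: E_def algebra_simps)
  also have "Z * Z - 4 * Z + 6 - 4 * W + W * W = (2 - (Z + W))^2"
    using ZW by (simp add: power2_eq_square algebra_simps)
  finally show ?thesis
    unfolding of_real_power c E_def by (simp add: mult.commute)
qed

definition levy_kernel :: "real \<Rightarrow> real \<Rightarrow> complex" where
  "levy_kernel \<theta> y = iexp (\<theta> * y) - 1 - \<i> * complex_of_real (\<theta> * y * indicator {-1<..<1} y)"

lemma levy_kernel_measurable [measurable]: "levy_kernel \<theta> \<in> borel_measurable borel"
  unfolding levy_kernel_def by measurable

text \<open>For \<open>\<bar>y\<bar> < 1\<close> the compensator is the linear Taylor term and the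
  second-order remainder gives \<open>y^2\<close>; elsewhere the compensator vanishes and the kernel
  is at most 2.\<close>

lemma levy_kernel_bound: "cmod (levy_kernel \<theta> y) \<le> (2 + \<theta>^2) * min 1 (y^2)"
proof (cases "\<bar>y\<bar> < 1")
  case True
  then have y2: "y^2 \<le> 1" by (simp add: abs_square_le_1)
  have "levy_kernel \<theta> y = iexp (\<theta> * y) - (\<Sum>k\<le>1. (\<i> * (\<theta> * y))^k / fact k)"
    using True by (simp add: levy_kernel_def abs_less_iff)
  also have "cmod \<dots> \<le> \<bar>\<theta> * y\<bar>^2 / 2"
    using iexp_approx1[of "\<theta> * y" 1] by (simp add: numeral_2_eq_2)
  also have "\<dots> \<le> (2 + \<theta>^2) * y^2"
    by (simp add: power_mult_distrib algebra_simps)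
  finally show ?thesis using y2 by simp
next
  case False
  then have "y^2 \<ge> 1" using abs_square_less_1 not_less by blast
  moreover have "cmod (levy_kernel \<theta> y) \<le> 2"
  proof -
    have "indicator {-1<..<1} y = (0::real)" using False by (auto simp: abs_less_iff)
    then show ?thesis using norm_triangle_ineq4[of "iexp (\<theta> * y)" 1] by (simp add: levy_kernel_def del: of_real_mult)
  qed
  ultimately show ?thesis by (auto simp: min_absorb1 intro: order_trans)
qed

text \<open>The terms that distinguish the kernel from \<open>iexp (\<theta> * y)\<close> are affine
  in \<open>\<theta>\<close>, and a fourth difference annihilates them.\<close>

lemma fourth_diff_levy_kernel:
  "fourth_diff h (\<lambda>\<theta>. levy_kernel \<theta> y) \<theta> = complex_of_real ((2 - 2 * cos (h * y))^2) * iexp (\<theta> * y)"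
proof -
  have "fourth_diff h (\<lambda>\<theta>. levy_kernel \<theta> y) \<theta> = fourth_diff h (\<lambda>\<theta>. iexp (\<theta> * y)) \<theta>"
    unfolding fourth_diff_def levy_kernel_def by (simp add: algebra_simps del: of_real_mult)
  then show ?thesis by (simp only: fourth_diff_iexp)
qed

text \<open>\<open>N\<close> may be infinite, but the weight makes it finite and normalising makes
  it a probability, to which Levy's continuity theorem applies. It is used both for the laws of
  short increments and for \<open>nu\<close>.\<close>

lemma weighted_distribution:
  fixes N :: "real measure"
  assumes [measurable_cong, simp]: "sets N = sets borel"
    and int: "integrable N w" and nonneg: "\<And>y. 0 \<le> w y" and pos: "0 < (\<integral>y. w y \<partial>N)"
  defines "P \<equiv> density N (\<lambda>y. ennreal (w y / (\<integral>y. w y \<partial>N)))"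
  shows "real_distribution P"
    and "char P \<theta> = (CLINT y|N. complex_of_real (w y) * iexp (\<theta> * y)) / complex_of_real (\<integral>y. w y \<partial>N)"
proof -
  let ?c = "\<integral>y. w y \<partial>N"
  have [measurable]: "w \<in> borel_measurable N" "w \<in> borel_measurable borel"
    using borel_measurable_integrable[OF int] measurable_cong_sets[of N borel borel borel] by auto
  have sp: "space N = UNIV" using sets_eq_imp_space_eq[of N borel] by simp
  have "emeasure P (space P) = (\<integral>\<^sup>+y. ennreal (w y / ?c) \<partial>N)"
    unfolding P_def by (simp add: emeasure_density sp)
  also have "\<dots> = ennreal (\<integral>y. w y / ?c \<partial>N)"
    using int nonneg pos by (intro nn_integral_eq_integral) auto
  also have "\<dots> = 1" using pos by simp
  finally have "prob_space P" by (intro prob_spaceI) (simp add: P_def sp)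
  then show "real_distribution P"
    unfolding real_distribution_def real_distribution_axioms_def by (simp add: P_def sp)
  have "char P \<theta> = (CLINT y|N. (w y / ?c) *\<^sub>R iexp (\<theta> * y))"
    unfolding char_def P_def using nonneg pos by (subst integral_density) auto
  also have "\<dots> = (CLINT y|N. (complex_of_real (w y) * iexp (\<theta> * y)) / complex_of_real ?c)"
    by (simp add: scaleR_conv_of_real)
  also have "\<dots> = (CLINT y|N. complex_of_real (w y) * iexp (\<theta> * y)) / complex_of_real ?c"
    by (rule integral_divide_zero)
  finally show "char P \<theta> = (CLINT y|N. complex_of_real (w y) * iexp (\<theta> * y)) / complex_of_real ?c" .
qed

section \<open>Independent stationary increments on a uniform grid\<close>

locale levy = prob_space M for M :: "'a measure" +
  fixes L :: "real \<Rightarrow> 'a \<Rightarrow> real"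
  assumes levy: "levy_process M L"
begin

lemma L_measurable [measurable]: "t \<ge> 0 \<Longrightarrow> L t \<in> borel_measurable M"
  using levy by (auto simp: levy_process_def)

lemma L_zero: "AE \<omega> in M. L 0 \<omega> = 0"
  using levy by (auto simp: levy_process_def)

lemma L_cadlag: "AE \<omega> in M. (\<forall>t\<ge>0. continuous (at_right t) (\<lambda>s. L s \<omega>)) \<and>
    (\<forall>t>0. \<exists>l. ((\<lambda>s. L s \<omega>) \<longlongrightarrow> l) (at_left t))"
  using levy by (auto simp: levy_process_def)

lemma L_stationary: "0 \<le> s \<Longrightarrow> s \<le> t \<Longrightarrow> distr M borel (\<lambda>\<omega>. L t \<omega> - L s \<omega>) = distr M borel (L (t - s))"
  using levy by (auto simp: levy_process_def)

definition inc :: "real \<Rightarrow> nat \<Rightarrow> 'a \<Rightarrow> real" where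
  "inc d i \<omega> = L (real (Suc i) * d) \<omega> - L (real i * d) \<omega>"

lemma inc_measurable [measurable]: "0 < d \<Longrightarrow> inc d i \<in> borel_measurable M"
  unfolding inc_def by measurable

lemma distr_inc: "0 < d \<Longrightarrow> distr M borel (inc d i) = distr M borel (L d)"
  using L_stationary[of "real i * d" "real (Suc i) * d"]
  by (simp add: inc_def[abs_def] algebra_simps)

text \<open>Independence of an infinite family concerns only finite subfamilies, and every finite
  index set lies in some \<open>{..<n}\<close>.\<close>

lemma indep_inc:
  assumes "0 < d" shows "indep_vars (\<lambda>_. borel) (inc d) UNIV"
proof -
  have fin: "indep_vars (\<lambda>_. borel) (inc d) {..<n}" for n
  proof -
    have "(\<forall>(s::nat \<Rightarrow> real) n. 0 \<le> s 0 \<and> (\<forall>i<n. s i < s (Suc i)) \<longrightarrow>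
        indep_vars (\<lambda>_. borel) (\<lambda>i \<omega>. L (s (Suc i)) \<omega> - L (s i) \<omega>) {..<n})"
      using levy by (simp add: levy_process_def)
    from this[rule_format, of "\<lambda>i. real i * d" n] show ?thesis
      using assms unfolding inc_def[abs_def] by (simp add: algebra_simps)
  qed
  show ?thesis unfolding indep_vars_def
  proof (intro conjI ballI)
    show "random_variable borel (inc d i)" for i using assms by measurable
    show "indep_sets (\<lambda>i. sigma_sets (space M) {inc d i -` A \<inter> space M |A. A \<in> sets borel}) UNIV"
    proof (subst indep_sets_finite_index_sets, intro allI impI)
      fix J :: "nat set" assume "finite J"
      then obtain n where "J \<subseteq> {..<n}" using finite_nat_bounded by blast
      then show "indep_sets (\<lambda>i. sigma_sets (space M) {inc d i -` A \<inter> space M |A. A \<in> sets borel}) J"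
        using fin[of n] unfolding indep_vars_def by (blast intro: indep_sets_mono_index)
    qed
  qed
qed

lemma L_sum_inc: "AE \<omega> in M. L (real n * d) \<omega> = (\<Sum>i<n. inc d i \<omega>)"
  using L_zero
proof eventually_elim
  case (elim \<omega>)
  show ?case unfolding inc_def
    using sum_lessThan_telescope[of "\<lambda>i. L (real i * d) \<omega>" n] elim by simp
qed

lemma char_L_power:
  assumes "n > 0" "d > 0"
  shows "char (distr M borel (L (real n * d))) \<theta> = char (distr M borel (L d)) \<theta> ^ n"
proof -
  have "distr M borel (L (real n * d)) = distr M borel (\<lambda>\<omega>. \<Sum>i<n. inc d i \<omega>)"
    using assms L_sum_inc[of n d] by (intro distr_cong_AE) auto
  also have "char \<dots> \<theta> = (\<Prod>i<n. char (distr M borel (inc d i)) \<theta>)"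
    using indep_vars_subset[OF indep_inc[OF \<open>d > 0\<close>], of "{..<n}"] by (intro char_distr_sum) auto
  also have "\<dots> = char (distr M borel (L d)) \<theta> ^ n"
    using assms by (simp add: distr_inc)
  finally show ?thesis .
qed

text \<open>If each of the \<open>n\<close> increments is at least \<open>c / n\<close>, their sum
  is at least \<open>c\<close>, and by independence this has the product of \<open>n\<close> equal
  positive probabilities. Read contrapositively, an upper bound for \<open>L 1\<close> passes,
  divided by \<open>n\<close>, to \<open>L (1 / n)\<close>.\<close>

lemma prob_inc_ge_pos:
  assumes "n > 0" "d > 0" "prob {\<omega>\<in>space M. c / real n \<le> L d \<omega>} > 0"
  shows "prob {\<omega>\<in>space M. c \<le> L (real n * d) \<omega>} > 0"
proof -
  have [measurable]: "L d \<in> borel_measurable M" "L (real n * d) \<in> borel_measurable M" using assms by auto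
  have inc': "prob (inc d i -` {c / real n..} \<inter> space M) = prob {\<omega>\<in>space M. c / real n \<le> L d \<omega>}" for i
  proof -
    have "measure (distr M borel (inc d i)) {c / real n..} = measure (distr M borel (L d)) {c / real n..}"
      using distr_inc[OF \<open>d > 0\<close>] by simp
    then show ?thesis using assms
      by (simp add: measure_distr vimage_def Int_def conj_commute)
  qed
  have "prob (\<Inter>i\<in>{..<n}. inc d i -` {c / real n..} \<inter> space M) =
      (\<Prod>i<n. prob (inc d i -` {c / real n..} \<inter> space M))"
    using assms indep_vars_subset[OF indep_inc[OF \<open>d > 0\<close>], of "{..<n}"]
    by (intro indep_varsD) auto
  also have "\<dots> > 0" using assms unfolding inc' by (intro prod_pos) auto
  finally have pos: "prob (\<Inter>i\<in>{..<n}. inc d i -` {c / real n..} \<inter> space M) > 0" .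
  also have "prob (\<Inter>i\<in>{..<n}. inc d i -` {c / real n..} \<inter> space M) \<le> prob {\<omega>\<in>space M. c \<le> L (real n * d) \<omega>}"
  proof (rule finite_measure_mono_AE)
    show "AE \<omega> in M. \<omega> \<in> (\<Inter>i\<in>{..<n}. inc d i -` {c / real n..} \<inter> space M) \<longrightarrow> \<omega> \<in> {\<omega>\<in>space M. c \<le> L (real n * d) \<omega>}"
      using L_sum_inc[of n d]
    proof eventually_elim
      case (elim \<omega>)
      show ?case
      proof
        assume *: "\<omega> \<in> (\<Inter>i\<in>{..<n}. inc d i -` {c / real n..} \<inter> space M)"
        then have "(\<Sum>i<n. c / real n) \<le> (\<Sum>i<n. inc d i \<omega>)" by (intro sum_mono) (use INT_D[OF *] in auto)
        then show "\<omega> \<in> {\<omega>\<in>space M. c \<le> L (real n * d) \<omega>}" using elim INT_D[OF *, of 0] assms by auto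
      qed
    qed
  qed measurable
  finally show ?thesis .
qed

end

section \<open>Characteristic functions of short increments and the Levy measure\<close>

locale levy_khintchine = levy M L for M :: "'a measure" and L +
  fixes nu :: "real measure" and \<gamma> \<sigma> :: real
  assumes sets_nu [measurable_cong, simp]: "sets nu = sets borel"
    and nu_finite: "(\<integral>\<^sup>+ y. ennreal (min 1 (y\<^sup>2)) \<partial>nu) < \<infinity>"
    and lk: "\<And>\<theta>::real. char (distr M borel (L 1)) \<theta> =
          exp (\<i> * complex_of_real (\<gamma> * \<theta>) - complex_of_real (\<sigma>\<^sup>2 * \<theta>\<^sup>2 / 2)
               + (CLINT y|nu. levy_kernel \<theta> y))"
begin

lemma integrable_min: "integrable nu (\<lambda>y. min 1 (y^2))"
  using nu_finite by (intro integrableI_nonneg) auto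

lemma integrable_levy_kernel: "integrable nu (levy_kernel \<theta>)"
proof (rule Bochner_Integration.integrable_bound)
  show "integrable nu (\<lambda>y. (2 + \<theta>^2) * min 1 (y^2))" using integrable_min by simp
  show "AE y in nu. cmod (levy_kernel \<theta> y) \<le> norm ((2 + \<theta>^2) * min 1 (y^2))"
    using levy_kernel_bound by (intro AE_I2) (auto intro: order_trans)
qed simp

definition psi :: "real \<Rightarrow> complex" where
  "psi \<theta> = \<i> * complex_of_real (\<gamma> * \<theta>) - complex_of_real (\<sigma>\<^sup>2 * \<theta>\<^sup>2 / 2) + (CLINT y|nu. levy_kernel \<theta> y)"

text \<open>Dominated convergence, since \<open>levy_kernel_bound\<close> is uniform over bounded
  sets of \<open>\<theta>\<close>. Continuity is what fixes the branch of the n-th root in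
  \<open>char_root\<close>.\<close>

lemma continuous_psi: "continuous_on UNIV psi"
proof -
  have "isCont (\<lambda>\<theta>. CLINT y|nu. levy_kernel \<theta> y) \<theta>" for \<theta>
    unfolding continuous_at_sequentially comp_def
  proof safe
    fix X assume X: "X \<longlonglongrightarrow> \<theta>"
    then obtain B where B: "\<And>n. \<bar>X n\<bar> \<le> B" using convergent_imp_Bseq[of X] unfolding Bseq_def convergent_def by auto
    show "(\<lambda>n. CLINT y|nu. levy_kernel (X n) y) \<longlonglongrightarrow> (CLINT y|nu. levy_kernel \<theta> y)"
    proof (rule integral_dominated_convergence[where w="\<lambda>y. (2 + B^2) * min 1 (y^2)"])
      show "integrable nu (\<lambda>y. (2 + B^2) * min 1 (y^2))" using integrable_min by simp
      show "AE y in nu. (\<lambda>n. levy_kernel (X n) y) \<longlonglongrightarrow> levy_kernel \<theta> y"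
        unfolding levy_kernel_def by (intro AE_I2 tendsto_intros X)
      fix n
      have "(X n)^2 \<le> B^2" using B[of n] by (simp add: abs_le_square_iff[symmetric])
      then have "(2 + (X n)^2) * min 1 (y^2) \<le> (2 + B^2) * min 1 (y^2)" for y :: real
        by (intro mult_right_mono) auto
      then show "AE y in nu. cmod (levy_kernel (X n) y) \<le> (2 + B^2) * min 1 (y^2)"
        using levy_kernel_bound[of "X n"] by (intro AE_I2) (meson order_trans)
    qed simp_all
  qed
  then have "continuous_on UNIV (\<lambda>\<theta>. CLINT y|nu. levy_kernel \<theta> y)"
    by (simp add: continuous_at_imp_continuous_on)
  then show ?thesis unfolding psi_def by (intro continuous_intros) auto
qed

text \<open>The n-th powers of both sides agree, so their quotient \<open>r\<close> takes values
  among the n-th roots of unity. Being continuous with finite range it is constant, and it equals 1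
  at 0.\<close>

lemma char_root:
  assumes "n > 0"
  shows "char (distr M borel (L (1 / real n))) \<theta> = exp (psi \<theta> / of_nat n)"
proof -
  interpret D: real_distribution "distr M borel (L (1 / real n))" by (intro real_distribution_distr) simp
  define r where "r \<theta> = char (distr M borel (L (1 / real n))) \<theta> * exp (- psi \<theta> / of_nat n)" for \<theta>
  have pow: "r \<theta> ^ n = 1" for \<theta>
  proof -
    have "char (distr M borel (L (1 / real n))) \<theta> ^ n = exp (psi \<theta>)"
      using char_L_power[of n "1 / real n" \<theta>] assms lk[of \<theta>] by (simp add: psi_def)
    moreover have "exp (- psi \<theta> / of_nat n) ^ n = exp (- psi \<theta>)"
      using assms by (simp flip: exp_of_nat_mult)
    ultimately show ?thesis unfolding r_def power_mult_distrib by (simp flip: exp_add)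
  qed
  have "continuous_on UNIV r" unfolding r_def
    by (intro continuous_intros continuous_psi) (use assms D.isCont_char in \<open>auto intro!: continuous_at_imp_continuous_on\<close>)
  moreover have "finite (range r)"
    by (rule finite_subset[OF _ finite_roots_unity[of n]]) (use pow assms in auto)
  ultimately have "r constant_on UNIV"
    by (intro continuous_finite_range_constant) auto
  then have "r \<theta> = r 0" unfolding constant_on_def by auto
  also have "r 0 = 1"
    unfolding r_def D.char_zero psi_def by (simp add: levy_kernel_def[abs_def])
  finally show ?thesis unfolding r_def by (simp add: exp_minus field_simps)
qed

lemma root_limit: "(\<lambda>n. of_nat (Suc n) * (exp (psi \<theta> / of_nat (Suc n)) - 1)) \<longlonglongrightarrow> psi \<theta>"
proof (cases "psi \<theta> = 0")
  case False
  have "((\<lambda>z. (exp z - 1) / z) \<longlongrightarrow> 1) (at (0::complex))"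
    using DERIV_exp[of "0::complex"] unfolding has_field_derivative_iff by simp
  moreover have "filterlim (\<lambda>n. psi \<theta> / of_nat (Suc n)) (at 0) sequentially"
    unfolding filterlim_at using False LIMSEQ_Suc[OF tendsto_divide_0[OF tendsto_const[of "psi \<theta>"] tendsto_of_nat]]
    by (auto simp del: of_nat_Suc)
  ultimately have "(\<lambda>n. (exp (psi \<theta> / of_nat (Suc n)) - 1) / (psi \<theta> / of_nat (Suc n))) \<longlonglongrightarrow> 1"
    by (rule filterlim_compose)
  then have "(\<lambda>n. psi \<theta> * ((exp (psi \<theta> / of_nat (Suc n)) - 1) / (psi \<theta> / of_nat (Suc n)))) \<longlonglongrightarrow> psi \<theta> * 1"
    by (intro tendsto_intros)
  moreover have "psi \<theta> * ((exp (psi \<theta> / of_nat (Suc n)) - 1) / (psi \<theta> / of_nat (Suc n))) =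
      of_nat (Suc n) * (exp (psi \<theta> / of_nat (Suc n)) - 1)" for n
    using False by (simp del: of_nat_Suc)
  ultimately show ?thesis by simp
qed simp

lemma integrable_cos_weight: "integrable nu (\<lambda>y. (2 - 2 * cos (h * y))^2)"
  and fourth_diff_psi: "fourth_diff h psi \<theta> = (CLINT y|nu. complex_of_real ((2 - 2 * cos (h * y))^2) * iexp (\<theta> * y))"
proof -
  note I = integrable_levy_kernel
  have int: "integrable nu (\<lambda>y. fourth_diff h (\<lambda>\<theta>. levy_kernel \<theta> y) \<theta>)" for \<theta>
    unfolding fourth_diff_def by (intro Bochner_Integration.integrable_add Bochner_Integration.integrable_diff integrable_mult_right I)
  from int[of 0] have "integrable nu (\<lambda>y. complex_of_real ((2 - 2 * cos (h * y))^2))"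
    unfolding fourth_diff_levy_kernel by simp
  then show "integrable nu (\<lambda>y. (2 - 2 * cos (h * y))^2)"
    by (simp only: complex_of_real_integrable_eq)
  have "(CLINT y|nu. complex_of_real ((2 - 2 * cos (h * y))^2) * iexp (\<theta> * y)) = (CLINT y|nu. fourth_diff h (\<lambda>\<theta>. levy_kernel \<theta> y) \<theta>)"
    unfolding fourth_diff_levy_kernel ..
  also have "\<dots> = fourth_diff h (\<lambda>\<theta>. CLINT y|nu. levy_kernel \<theta> y) \<theta>"
    unfolding fourth_diff_def using I by (simp add: Bochner_Integration.integral_add Bochner_Integration.integral_diff)
  also have "\<dots> = fourth_diff h psi \<theta>"
    unfolding fourth_diff_def psi_def by (simp add: power2_eq_square algebra_simps) (simp add: field_simps)
  finally show "fourth_diff h psi \<theta> = (CLINT y|nu. complex_of_real ((2 - 2 * cos (h * y))^2) * iexp (\<theta> * y))" ..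
qed

text \<open>Suppose \<open>L 1 < C\<close> almost surely. The laws of \<open>L (1 / n)\<close>,
  weighted by \<open>(2 - 2 * cos (h * y))^2\<close> and normalised, converge weakly to the
  similarly weighted \<open>nu\<close>. They live on \<open>y \<le> C / n\<close>, so the limit
  lives on \<open>y \<le> 0\<close>, for every \<open>h\<close>.\<close>

lemma L_unbounded_above:
  assumes pos: "emeasure nu {0<..} > 0"
  shows "prob {\<omega>\<in>space M. c \<le> L 1 \<omega>} > 0"
proof (rule ccontr)
  define C where "C = max c 1"
  assume "\<not> prob {\<omega>\<in>space M. c \<le> L 1 \<omega>} > 0"
  then have "prob {\<omega>\<in>space M. c \<le> L 1 \<omega>} = 0" by (simp add: zero_less_measure_iff)
  moreover have "prob {\<omega>\<in>space M. C \<le> L 1 \<omega>} \<le> prob {\<omega>\<in>space M. c \<le> L 1 \<omega>}"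
    by (rule finite_measure_mono) (auto simp: C_def)
  ultimately have "\<not> prob {\<omega>\<in>space M. C \<le> L 1 \<omega>} > 0" by simp
  then have small: "\<not> prob {\<omega>\<in>space M. C / real n \<le> L (1 / real n) \<omega>} > 0" if "n > 0" for n
    using prob_inc_ge_pos[of n "1 / real n" C] that by auto
  have AE_small: "AE y in distr M borel (L (1 / real n)). y < C / real n" if n: "n > 0" for n
  proof -
    have "prob {\<omega>\<in>space M. C / real n \<le> L (1 / real n) \<omega>} = 0"
      using small[OF n] by (simp add: zero_less_measure_iff)
    then have "AE \<omega> in M. \<not> C / real n \<le> L (1 / real n) \<omega>"
      by (subst (asm) prob_eq_0) (auto)
    then show ?thesis by (subst AE_distr_iff) (auto simp: not_le)
  qed
  \<comment> \<open>The weight vanishes exactly where \<open>cos (h * y) = 1\<close>, so a single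
    \<open>h\<close> says nothing about \<open>nu\<close> at those points; varying \<open>h\<close>
    removes them at the end.\<close>
  have key: "AE y in nu. cos (h * y) \<noteq> 1 \<longrightarrow> y \<le> 0" for h
  proof -
    define w where "w y = (2 - 2 * cos (h * y))^2" for y :: real
    define \<Phi> where "\<Phi> N \<theta> = (CLINT y|N. complex_of_real (w y) * iexp (\<theta> * y))" for N :: "real measure" and \<theta> :: real
    have w_nonneg: "0 \<le> w y" for y by (simp add: w_def)
    have w_int: "integrable nu w" unfolding w_def by (rule integrable_cos_weight)
    have [measurable]: "w \<in> borel_measurable borel" unfolding w_def by measurable
    have w0: "w y = 0 \<longleftrightarrow> cos (h * y) = 1" for y by (auto simp: w_def)
    define I where "I = (\<integral>y. w y \<partial>nu)"
    show ?thesis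
    proof (cases "I = 0")
      case True
      then have "AE y in nu. w y = 0"
        unfolding I_def using integral_nonneg_eq_0_iff_AE[OF w_int] w_nonneg by simp
      then show ?thesis by eventually_elim (simp add: w0)
    next
      case False
      then have I: "I > 0" unfolding I_def less_le using w_nonneg by (auto intro: integral_nonneg_AE)
      define D where "D n = distr M borel (L (1 / real (Suc n)))" for n
      have D: "real_distribution (D n)" for n unfolding D_def by (intro real_distribution_distr) simp
      interpret D: real_distribution "D n" for n by (rule D)
      have w_D: "integrable (D n) w" for n
      proof (rule D.integrable_const_bound)
        have "2 - 2 * cos (h * y) \<le> 4" for y using cos_ge_minus_one[of "h * y"] by linarith
        then have "w y \<le> 4^2" for y unfolding w_def by (intro power_mono) auto
        then show "AE y in D n. norm (w y) \<le> 4^2" using w_nonneg by (intro AE_I2) simp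
      qed simp
      define J where "J n = (\<integral>y. w y \<partial>D n)" for n
      have fd: "\<Phi> (D n) \<theta> = fourth_diff h (char (D n)) \<theta>" for n \<theta>
      proof -
        have I: "integrable (D n) (\<lambda>y. iexp (t * y))" for t
          by (intro D.integrable_iexp) auto
        have "\<Phi> (D n) \<theta> = (CLINT y|D n. fourth_diff h (\<lambda>\<theta>. iexp (\<theta> * y)) \<theta>)"
          unfolding fourth_diff_iexp \<Phi>_def w_def ..
        also have "\<dots> = fourth_diff h (char (D n)) \<theta>"
          unfolding fourth_diff_def char_def using I by (simp add: Bochner_Integration.integral_add Bochner_Integration.integral_diff del: of_real_mult)
        finally show ?thesis .
      qed
      \<comment> \<open>The fourth difference kills constants, so 1 may be subtracted from
        \<open>exp (psi \<theta> / n)\<close> before multiplying by \<open>n\<close>; the limit is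
        then the fourth difference of \<open>psi\<close>.\<close>
      have lim: "(\<lambda>n. of_nat (Suc n) * \<Phi> (D n) \<theta>)
          \<longlonglongrightarrow> \<Phi> nu \<theta>" for \<theta>
      proof -
        have "of_nat (Suc n) * \<Phi> (D n) \<theta> =
           fourth_diff h (\<lambda>\<theta>. of_nat (Suc n) * (exp (psi \<theta> / of_nat (Suc n)) - 1)) \<theta>" for n
          unfolding fd unfolding D_def fourth_diff_def char_root[OF zero_less_Suc] by (simp add: algebra_simps del: of_nat_Suc)
        moreover have "(\<lambda>n. fourth_diff h (\<lambda>\<theta>. of_nat (Suc n) * (exp (psi \<theta> / of_nat (Suc n)) - 1)) \<theta>) \<longlonglongrightarrow> fourth_diff h psi \<theta>"
          unfolding fourth_diff_def by (intro tendsto_intros root_limit)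
        ultimately show ?thesis unfolding fourth_diff_psi \<Phi>_def w_def by simp
      qed
      \<comment> \<open>The total masses are the transforms at \<open>\<theta> = 0\<close>, so their
        convergence is a special case.\<close>
      have limJ: "(\<lambda>n. real (Suc n) * J n) \<longlonglongrightarrow> I"
      proof -
        have "(\<lambda>n. complex_of_real (real (Suc n) * J n)) \<longlonglongrightarrow> complex_of_real I"
          using lim[of 0] unfolding J_def I_def \<Phi>_def by simp
        then show ?thesis by (simp only: tendsto_of_real_iff)
      qed
      then have "eventually (\<lambda>n. 0 < real (Suc n) * J n) sequentially"
        using I by (simp add: order_tendsto_iff)
      then have "eventually (\<lambda>n. 0 < J n) sequentially"
        by eventually_elim (simp add: zero_less_mult_iff)
      \<comment> \<open>Normalisation requires positive mass, which is guaranteed only from some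
        index on; the sequence \<open>P\<close> is shifted accordingly.\<close>
      then obtain n0 where n0: "\<And>n. n \<ge> n0 \<Longrightarrow> 0 < J n" unfolding eventually_sequentially by auto
      define P where "P n = density (D (n + n0)) (\<lambda>y. ennreal (w y / J (n + n0)))" for n
      define Q where "Q = density nu (\<lambda>y. ennreal (w y / I))"
      have P: "real_distribution (P n)" "char (P n) \<theta> = \<Phi> (D (n + n0)) \<theta> / complex_of_real (J (n + n0))" for n \<theta>
        using weighted_distribution[OF _ w_D w_nonneg, of "n + n0"] n0[of "n + n0"]
        unfolding P_def J_def \<Phi>_def by auto
      have Q: "real_distribution Q" "char Q \<theta> = \<Phi> nu \<theta> / complex_of_real I" for \<theta>
        using weighted_distribution[OF _ w_int w_nonneg] I
        unfolding Q_def I_def \<Phi>_def by auto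
      interpret Q: real_distribution Q by (rule Q)
      interpret P: real_distribution "P n" for n by (rule P)
      have "weak_conv_m P Q"
      proof (rule levy_continuity[OF P(1) Q(1)])
        fix \<theta>
        have "(\<lambda>n. (of_nat (Suc (n + n0)) * \<Phi> (D (n + n0)) \<theta>) / complex_of_real (real (Suc (n + n0)) * J (n + n0))) \<longlonglongrightarrow> char Q \<theta>"
          unfolding Q(2) using I lim[of \<theta>, THEN LIMSEQ_ignore_initial_segment, of n0] limJ[THEN LIMSEQ_ignore_initial_segment, of n0]
          by (intro tendsto_divide tendsto_of_real) auto
        moreover have "(of_nat (Suc (n + n0)) * \<Phi> (D (n + n0)) \<theta>) / complex_of_real (real (Suc (n + n0)) * J (n + n0)) = char (P n) \<theta>" for n
          unfolding P(2) of_real_mult of_real_of_nat_eq by (rule mult_divide_mult_cancel_left) (simp del: of_nat_Suc)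
        ultimately show "(\<lambda>n. char (P n) \<theta>) \<longlonglongrightarrow> char Q \<theta>" by simp
      qed
      then have conv: "isCont (cdf Q) y \<Longrightarrow> (\<lambda>n. cdf (P n) y) \<longlonglongrightarrow> cdf Q y" for y
        unfolding weak_conv_m_def weak_conv_def by auto
      have cdfP: "eventually (\<lambda>n. cdf (P n) y = 1) sequentially" if y: "y > 0" for y
      proof -
        obtain n1 :: nat where n1: "C / y < real n1" using reals_Archimedean2 by blast
        have "cdf (P n) y = 1" if n: "n \<ge> n1" for n
        proof -
          have "C \<le> y * real n1" using n1 y by (simp add: field_simps)
          also have "\<dots> \<le> y * real (Suc (n + n0))" using n y by (intro mult_left_mono) auto
          finally have "C / real (Suc (n + n0)) \<le> y" by (simp add: divide_le_eq del: of_nat_Suc)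
          then have "AE z in D (n + n0). z \<le> y"
            using AE_small[of "Suc (n + n0)"] unfolding D_def by (auto elim!: eventually_mono)
          then have "AE z in P n. z \<in> {..y}"
            unfolding P_def by (subst AE_density) (auto elim!: eventually_mono)
          then show ?thesis unfolding cdf_def by (subst P.prob_eq_1) auto
        qed
        then show ?thesis unfolding eventually_sequentially by blast
      qed
      have Qy: "AE z in Q. z \<le> e" if e: "e > 0" for e
      proof -
        \<comment> \<open>Weak convergence gives information only at continuity points of the limit
          distribution function. The atoms are countable, so such a point exists in
          \<open>(0, e)\<close>.\<close>
        have "uncountable ({0<..<e} - {y. measure Q {y} \<noteq> 0})"
          using e Q.countable_support by (intro uncountable_minus_countable) (auto simp: uncountable_open_interval)
        then obtain y where y: "0 < y" "y < e" "measure Q {y} = 0"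
          by (metis (mono_tags, lifting) DiffE countable_empty equals0I greaterThanLessThan_iff mem_Collect_eq)
        then have "(\<lambda>n. cdf (P n) y) \<longlonglongrightarrow> cdf Q y" by (intro conv) (simp add: Q.isCont_cdf)
        moreover have "(\<lambda>n. cdf (P n) y) \<longlonglongrightarrow> 1" using cdfP[OF y(1)] by (rule tendsto_eventually)
        ultimately have "cdf Q y = 1" by (rule LIMSEQ_unique)
        then have "AE z in Q. z \<in> {..y}" unfolding cdf_def by (subst (asm) Q.prob_eq_1) auto
        then show ?thesis using y by (auto elim!: eventually_mono)
      qed
      have "AE z in Q. \<forall>n. z \<le> 1 / real (Suc n)" by (subst AE_all_countable) (simp add: Qy)
      then have "AE z in Q. z \<le> 0"
      proof eventually_elim
        case (elim z)
        have "z \<le> e" if "e > 0" for e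
          using elim reals_Archimedean[OF that] by (metis inverse_eq_divide less_imp_le order_trans)
        then show ?case using dense_ge by blast
      qed
      then have "AE z in nu. 0 < ennreal (w z / I) \<longrightarrow> z \<le> 0" unfolding Q_def by (subst (asm) AE_density) auto
      then show ?thesis
      proof eventually_elim
        case (elim z)
        then show ?case using w0[of z] w_nonneg[of z] I by (auto simp: less_le)
      qed
    qed
  qed
  \<comment> \<open>Given \<open>y > 0\<close>, a large \<open>k\<close> brings
    \<open>y / (k + 1)\<close> into \<open>(0, 1)\<close>, where the cosine is strictly below 1;
    countably many values of \<open>h\<close> therefore suffice.\<close>
  have "AE y in nu. \<forall>k::nat. cos (1 / real (Suc k) * y) \<noteq> 1 \<longrightarrow> y \<le> 0"
    by (subst AE_all_countable) (use key in blast)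
  then have "AE y in nu. y \<le> 0"
  proof eventually_elim
    case (elim y)
    show ?case
    proof (rule ccontr)
      assume "\<not> y \<le> 0"
      moreover obtain k :: nat where k: "y < real k" using reals_Archimedean2 by blast
      ultimately have "0 < 1 / real (Suc k) * y" "1 / real (Suc k) * y < 1"
        by (auto simp: field_simps)
      then have "cos (1 / real (Suc k) * y) < cos 0" using pi_gt3 by (intro cos_monotone_0_pi) linarith+
      then show False using elim \<open>\<not> y \<le> 0\<close> by auto
    qed
  qed
  then have "emeasure nu {0<..} = 0"
    by (subst (asm) AE_iff_measurable[OF _ refl]) (auto simp: not_le greaterThan_def sets_eq_imp_space_eq[OF sets_nu])
  with pos show False by simp
qed

end

text \<open>A form of Vitali's theorem: the tails of \<open>Y n\<close> are uniformly controlled by \<open>Z n\<close>.\<close>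

lemma (in prob_space) nn_integral_tendsto_dominated_by_bounded:
  fixes Y Z :: "nat \<Rightarrow> 'a \<Rightarrow> ennreal"
  assumes [measurable]: "\<And>n. Y n \<in> borel_measurable M" "\<And>n. Z n \<in> borel_measurable M"
    and lim: "AE \<omega> in M. (\<lambda>n. Y n \<omega>) \<longlonglongrightarrow> Y' \<omega>"
    and dom: "\<And>e. e > 0 \<Longrightarrow> \<exists>C. \<forall>n. AE \<omega> in M. Y n \<omega> \<le> ennreal C + ennreal e * Z n \<omega>"
    and bd: "\<And>n. integral\<^sup>N M (Z n) \<le> ennreal B"
  shows "(\<lambda>n. integral\<^sup>N M (Y n)) \<longlonglongrightarrow> integral\<^sup>N M Y'"
proof -
  \<comment> \<open>\<open>Y'\<close> carries no measurability assumption, so the estimates are made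
    for the measurable liminf, which agrees with it almost everywhere.\<close>
  define W where "W \<omega> = liminf (\<lambda>n. Y n \<omega>)" for \<omega>
  have [measurable]: "W \<in> borel_measurable M" unfolding W_def by measurable
  have W: "AE \<omega> in M. Y' \<omega> = W \<omega>"
    using lim by eventually_elim (simp add: W_def lim_imp_Liminf)
  then have eq: "integral\<^sup>N M Y' = integral\<^sup>N M W" by (rule nn_integral_cong_AE)
  have low: "integral\<^sup>N M W \<le> liminf (\<lambda>n. integral\<^sup>N M (Y n))"
    unfolding W_def by (rule nn_integral_liminf) measurable
  have "limsup (\<lambda>n. integral\<^sup>N M (Y n)) \<le> integral\<^sup>N M W"
  proof (rule ennreal_le_epsilon)
    fix r :: real assume r: "r > 0"
    define e where "e = r / (\<bar>B\<bar> + 1)"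
    have e: "e > 0" using r by (simp add: e_def)
    have "\<bar>B\<bar> * r \<le> (\<bar>B\<bar> + 1) * r" using r by (intro mult_right_mono) auto
    then have eB: "e * \<bar>B\<bar> \<le> r" by (simp add: e_def field_simps)
    obtain C where C: "\<And>n. AE \<omega> in M. Y n \<omega> \<le> ennreal C + ennreal e * Z n \<omega>" using dom[OF e] by auto
    \<comment> \<open>Truncating \<open>Y n\<close> at \<open>C\<close> costs at most
      \<open>e * Z n\<close>, hence at most \<open>r\<close> in the mean, while the truncated part
      converges by bounded convergence on a probability space.\<close>
    have "integral\<^sup>N M (Y n) \<le> (\<integral>\<^sup>+\<omega>. min (Y n \<omega>) (ennreal C) \<partial>M) + ennreal r" for n
    proof -
      have "integral\<^sup>N M (Y n) \<le> (\<integral>\<^sup>+\<omega>. min (Y n \<omega>) (ennreal C) + ennreal e * Z n \<omega> \<partial>M)"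
      proof (rule nn_integral_mono_AE)
        show "AE \<omega> in M. Y n \<omega> \<le> min (Y n \<omega>) (ennreal C) + ennreal e * Z n \<omega>"
          using C[of n] by eventually_elim (auto simp: min_def)
      qed
      also have "\<dots> = (\<integral>\<^sup>+\<omega>. min (Y n \<omega>) (ennreal C) \<partial>M) + ennreal e * integral\<^sup>N M (Z n)"
        by (simp add: nn_integral_add nn_integral_cmult)
      also have "ennreal e * integral\<^sup>N M (Z n) \<le> ennreal e * ennreal \<bar>B\<bar>"
        by (intro mult_left_mono order_trans[OF bd]) (auto intro: ennreal_leI)
      also have "\<dots> \<le> ennreal r" using e eB by (auto simp: ennreal_mult[symmetric] intro: ennreal_leI)
      finally show ?thesis by (simp add: add_left_mono)
    qed
    moreover have "(\<lambda>n. (\<integral>\<^sup>+\<omega>. min (Y n \<omega>) (ennreal C) \<partial>M) + ennreal r) \<longlonglongrightarrow> (\<integral>\<^sup>+\<omega>. min (W \<omega>) (ennreal C) \<partial>M) + ennreal r"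
    proof (intro tendsto_intros nn_integral_dominated_convergence[where w="\<lambda>_. ennreal C"])
      show "AE \<omega> in M. (\<lambda>i. min (Y i \<omega>) (ennreal C)) \<longlonglongrightarrow> min (W \<omega>) (ennreal C)"
        using lim W by eventually_elim (auto intro!: tendsto_intros)
      show "(\<integral>\<^sup>+\<omega>. ennreal C \<partial>M) < \<infinity>" by (simp add: emeasure_space_1)
    qed auto
    ultimately have "limsup (\<lambda>n. integral\<^sup>N M (Y n)) \<le> (\<integral>\<^sup>+\<omega>. min (W \<omega>) (ennreal C) \<partial>M) + ennreal r"
      by (metis (mono_tags, lifting) Limsup_mono always_eventually lim_imp_Limsup trivial_limit_sequentially)
    also have "(\<integral>\<^sup>+\<omega>. min (W \<omega>) (ennreal C) \<partial>M) \<le> integral\<^sup>N M W" by (intro nn_integral_mono) auto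
    finally show "limsup (\<lambda>n. integral\<^sup>N M (Y n)) \<le> integral\<^sup>N M W + ennreal r" by (simp add: add_right_mono)
  qed
  then show ?thesis unfolding eq using low
    using Liminf_le_Limsup[OF trivial_limit_sequentially, of "\<lambda>n. integral\<^sup>N M (Y n)"]
    by (intro Liminf_eq_Limsup) (simp_all add: order_antisym)
qed

section \<open>Elementary sequences and limits\<close>

lemma increasing_approximation:
  fixes l r :: real
  assumes "l < r"
  obtains c :: "nat \<Rightarrow> real" where "mono c" "c \<longlonglongrightarrow> r" "\<And>m. l < c m" "\<And>m. c m < r"
proof -
  \<comment> \<open>The offset 2 keeps already the first member strictly above
    \<open>l\<close>.\<close>
  define c where "c m = r - (r - l) / real (m + 2)" for m
  show thesis
  proof (rule that[of c])
    show "mono c" unfolding c_def using assms by (intro monoI diff_left_mono divide_left_mono) auto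
    have "(\<lambda>m. r - (r - l) / real (m + 2)) \<longlonglongrightarrow> r - 0"
      by (intro tendsto_intros LIMSEQ_ignore_initial_segment[OF lim_const_over_n])
    then show "c \<longlonglongrightarrow> r" by (simp add: c_def[abs_def])
    show "l < c m" "c m < r" for m
    proof -
      have "(r - l) / real (m + 2) < (r - l) / 1" using assms by (intro divide_strict_left_mono) auto
      then show "l < c m" by (simp add: c_def)
      show "c m < r" using assms by (simp add: c_def)
    qed
  qed
qed

lemma over_power2_tendsto: "(\<lambda>n. c / 2^n) \<longlonglongrightarrow> (0::real)"
  using tendsto_mult_right_zero[OF LIMSEQ_power_zero[of "1/2 :: real"], of c] by (simp add: power_one_over)

lemma implicit_euler_factor_tendsto:
  fixes \<beta> h :: real
  shows "(\<lambda>N. (1 / (1 + \<beta> * (h / real N))) ^ N) \<longlonglongrightarrow> exp (- \<beta> * h)"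
proof -
  have "(\<lambda>N. inverse ((1 + (\<beta> * h) / real N) ^ N)) \<longlonglongrightarrow> inverse (exp (\<beta> * h))"
    by (intro tendsto_intros tendsto_exp_limit_sequentially) simp
  then show ?thesis by (simp add: exp_minus inverse_eq_divide power_one_over)
qed

subsection \<open>Paths solving the Ornstein-Uhlenbeck equation\<close>

text \<open>Bisection: a right limit and a left limit bound the function on a punctured
  neighbourhood of each point, and the value at the point is added separately.\<close>

lemma cadlag_bounded:
  fixes l :: "real \<Rightarrow> real"
  assumes rc: "\<And>t. t \<ge> 0 \<Longrightarrow> (l \<longlongrightarrow> l t) (at_right t)" and ll: "\<And>t. t > 0 \<Longrightarrow> \<exists>y. (l \<longlongrightarrow> y) (at_left t)" and "T \<ge> 0"
  shows "\<exists>B. \<forall>s\<in>{0..T}. \<bar>l s\<bar> \<le> B"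
proof -
  have bdl: "\<exists>B. eventually (\<lambda>s. \<bar>l s\<bar> \<le> B) F" if "(l \<longlongrightarrow> y) F" for y F
    using order_tendstoD(2)[OF tendsto_rabs[OF that], of "\<bar>y\<bar> + 1"] by (auto intro!: exI[of _ "\<bar>y\<bar> + 1"] elim: eventually_mono)
  define P where "P a b \<longleftrightarrow> (\<exists>B. \<forall>s\<in>{a..b} \<inter> {0..T}. \<bar>l s\<bar> \<le> B)" for a b
  have "P 0 T" using \<open>T \<ge> 0\<close>
  proof (induction rule: Bolzano)
    case (trans a b c)
    then obtain B1 B2 where "\<forall>s\<in>{a..b} \<inter> {0..T}. \<bar>l s\<bar> \<le> B1" "\<forall>s\<in>{b..c} \<inter> {0..T}. \<bar>l s\<bar> \<le> B2" unfolding P_def by auto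
    then have "\<forall>s\<in>{a..c} \<inter> {0..T}. \<bar>l s\<bar> \<le> max B1 B2" by (fastforce simp: le_max_iff_disj)
    then show ?case unfolding P_def by blast
  next
    case (local t)
    obtain B1 where "eventually (\<lambda>s. \<bar>l s\<bar> \<le> B1) (at_right t)" using rc[of t] bdl local by auto
    then obtain r where r: "r > t" "\<And>s. t < s \<Longrightarrow> s < r \<Longrightarrow> \<bar>l s\<bar> \<le> B1"
      unfolding eventually_at_right_field by auto
    obtain B2 q where q: "q < t" "\<And>s. s \<ge> 0 \<Longrightarrow> q < s \<Longrightarrow> s < t \<Longrightarrow> \<bar>l s\<bar> \<le> B2"
    proof (cases "t > 0")
      case True
      then obtain B2 where "eventually (\<lambda>s. \<bar>l s\<bar> \<le> B2) (at_left t)" using ll bdl by meson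
      then obtain q where "q < t" "\<And>s. q < s \<Longrightarrow> s < t \<Longrightarrow> \<bar>l s\<bar> \<le> B2"
        unfolding eventually_at_left_field by auto
      then show ?thesis using that by blast
    next
      case False
      \<comment> \<open>Here \<open>t = 0\<close>, and no \<open>s \<ge> 0\<close> lies to the left
        of it, so any \<open>q < t\<close> serves.\<close>
      then show ?thesis using that[of "t - 1"] by fastforce
    qed
    show ?case
    proof (intro exI[of _ "min (r - t) (t - q)"] conjI allI impI)
      show "0 < min (r - t) (t - q)" using r q by auto
      fix a b assume ab: "a \<le> t \<and> t \<le> b \<and> b - a < min (r - t) (t - q)"
      have "\<bar>l s\<bar> \<le> max (max B1 B2) \<bar>l t\<bar>" if "s \<in> {a..b} \<inter> {0..T}" for s
        using that ab r(2)[of s] q(2)[of s] by (cases s t rule: linorder_cases) (auto simp: le_max_iff_disj)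
      then show "P a b" unfolding P_def by blast
    qed
  qed
  then show ?thesis by (simp add: P_def)
qed

lemma sum_indicator_consecutive:
  fixes s :: "nat \<Rightarrow> real"
  assumes "\<And>j. s j \<le> s (Suc j)"
  shows "(\<Sum>j<n. indicator {s j<..s (Suc j)} r) = (indicator {s 0<..s n} r :: real)"
proof (induction n)
  case (Suc n)
  have "s 0 \<le> s n" using lift_Suc_mono_le[of s 0 n] assms by simp
  then show ?case using Suc assms[of n] by (auto simp: indicator_def split: if_splits)
qed simp

locale ou_path =
  fixes f l :: "real \<Rightarrow> real" and \<beta> x :: real
  assumes beta: "0 < \<beta>"
    and int: "\<And>t. t \<ge> 0 \<Longrightarrow> set_integrable lborel {0..t} f"
    and eq: "\<And>t. t \<ge> 0 \<Longrightarrow> f t = x - \<beta> * (LINT s:{0..t}|lborel. f s) + l t"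
    and l_rcont: "\<And>t. t \<ge> 0 \<Longrightarrow> (l \<longlongrightarrow> l t) (at_right t)"
    and l_left: "\<And>t. t > 0 \<Longrightarrow> \<exists>y. (l \<longlongrightarrow> y) (at_left t)"
    and l0: "l 0 = 0"
begin

lemma f0: "f 0 = x"
  using eq[of 0] l0 
    set_borel_integral_eq_integral(2)[OF int[of 0]] by simp

text \<open>The difference is the drift integral, hence continuous. This is how \<open>f\<close>
  inherits right continuity and left limits from \<open>l\<close>, and why it can jump only where
  \<open>l\<close> does.\<close>

lemma continuous_diff: "continuous_on {0..T} (\<lambda>t. f t - l t)"
proof (cases "T \<ge> 0")
  case True
  have "continuous_on {0..T} (\<lambda>t. x - \<beta> * integral {0..t} f)"
    by (intro continuous_intros indefinite_integral_continuous_1 set_borel_integral_eq_integral(1) int True)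
  then show ?thesis
  proof (rule continuous_on_eq)
    fix t assume "t \<in> {0..T}"
    then show "x - \<beta> * integral {0..t} f = f t - l t"
      using eq[of t] set_borel_integral_eq_integral(2)[OF int[of t]] by simp
  qed
qed simp

lemma diff_rcont: "t \<ge> 0 \<Longrightarrow> ((\<lambda>t. f t - l t) \<longlongrightarrow> f t - l t) (at_right t)"
  using continuous_diff[of "t + 1"] unfolding continuous_on_def
  by (metis (no_types, lifting) Icc_subset_Ici_iff at_within_Icc_at_right atLeastAtMost_iff continuous_on_Icc_at_rightD continuous_on_subset continuous_diff
      less_add_one atLeastatMost_subset_iff order.refl le_add_same_cancel1 zero_le_one)

lemma diff_lcont: "t > 0 \<Longrightarrow> ((\<lambda>t. f t - l t) \<longlongrightarrow> f t - l t) (at_left t)"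
  using continuous_on_Icc_at_leftD[OF continuous_diff[of t]] by auto

lemma f_rcont: "t \<ge> 0 \<Longrightarrow> (f \<longlongrightarrow> f t) (at_right t)"
  using tendsto_add[OF diff_rcont l_rcont, of t] by simp

lemma f_left: "t > 0 \<Longrightarrow> (l \<longlongrightarrow> y) (at_left t) \<Longrightarrow> (f \<longlongrightarrow> f t - l t + y) (at_left t)"
  using tendsto_add[OF diff_lcont, of t l y] by simp

lemma f_left_ex: "t > 0 \<Longrightarrow> \<exists>y. (f \<longlongrightarrow> y) (at_left t)"
  using f_left l_left by blast

lemma euler_step:
  assumes "0 \<le> a" "a \<le> b"
  shows "f b - f a = l b - l a - \<beta> * (LINT s:{a<..b}|lborel. f s)"
proof -
  have "{0..b} = {0..a} \<union> {a<..b}" using assms by auto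
  moreover have "set_integrable lborel {a<..b} f"
    by (rule set_integrable_subset[OF int[of b]]) (use assms in auto)
  ultimately have "(LINT s:{0..b}|lborel. f s) = (LINT s:{0..a}|lborel. f s) + (LINT s:{a<..b}|lborel. f s)"
    using assms int[of a] by (simp add: set_integral_Un Int_def)
  then show ?thesis using eq[of a] eq[of b] assms by (simp add: algebra_simps)
qed

text \<open>The implicit Euler scheme evaluates the drift at the right end of each step, so that its
  residual vanishes by right continuity alone.\<close>

lemma euler_limit:
  assumes t: "t \<ge> 0" and h: "h > 0"
  shows "(\<lambda>N. \<Sum>j<N. (1 / (1 + \<beta> * (h / real N)))^(N - j) * (l (t + real (Suc j) * (h / real N)) - l (t + real j * (h / real N))))
    \<longlonglongrightarrow> f (t + h) - exp (- \<beta> * h) * f t"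
proof -
  define d where "d N = h / real N" for N
  define s where "s N j = t + real j * d N" for N j
  define \<rho> where "\<rho> N = 1 / (1 + \<beta> * d N)" for N
  define r where "r N j = \<beta> * (LINT u:{s N j<..s N (Suc j)}|lborel. f (s N (Suc j)) - f u)" for N j
  define R where "R N j u = indicator {s N j<..s N (Suc j)} u * \<bar>f (s N (Suc j)) - f u\<bar>" for N j u
  define \<Delta> where "\<Delta> N j = l (s N (Suc j)) - l (s N j)" for N j
  have d_nonneg: "d N \<ge> 0" for N using h by (simp add: d_def)
  have s_mono: "s N j \<le> s N (Suc j)" "s N (Suc j) - s N j = d N" "s N j \<ge> 0" for N j
    using d_nonneg[of N] t by (auto simp: s_def algebra_simps)
  have s_N: "s N 0 = t" "N > 0 \<Longrightarrow> s N N = t + h" for N by (auto simp: s_def d_def)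
  have fint: "set_integrable lborel {a<..b} f" if "0 \<le> a" for a b
  proof (cases "b \<ge> 0")
    case True
    show ?thesis by (rule set_integrable_subset[OF int[OF True]]) (use that in auto)
  next
    case False
    then have "{a<..b} = {}" using that by auto
    then show ?thesis by (simp add: set_integrable_def)
  qed
  have \<rho>: "0 < \<rho> N" "\<rho> N \<le> 1" for N
    using beta d_nonneg[of N] by (auto simp: \<rho>_def field_simps add_pos_nonneg)
  \<comment> \<open>The drift over a cell is \<open>\<beta> * d N\<close> times the value at the
    right end, up to the residual \<open>r N j\<close>; solving for that value produces the factor
    \<open>\<rho> N\<close>.\<close>
  have step: "f (s N (Suc j)) = \<rho> N * (f (s N j) + \<Delta> N j + r N j)" for N j
  proof -
    have "(LINT u:{s N j<..s N (Suc j)}|lborel. f (s N (Suc j)) - f u) = d N * f (s N (Suc j)) - (LINT u:{s N j<..s N (Suc j)}|lborel. f u)"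
      using s_mono[of N j] fint[of "s N j"]
      by (subst set_integral_diff) (auto simp: set_integrable_def set_lebesgue_integral_def)
    then have "r N j = \<beta> * (d N * f (s N (Suc j))) - \<beta> * (LINT u:{s N j<..s N (Suc j)}|lborel. f u)"
      unfolding r_def by (simp only: right_diff_distrib)
    then have "f (s N (Suc j)) + \<beta> * d N * f (s N (Suc j)) = f (s N j) + \<Delta> N j + r N j"
      using euler_step[of "s N j" "s N (Suc j)"] s_mono[of N j] by (simp add: \<Delta>_def)
    then show ?thesis using beta d_nonneg[of N] by (simp add: \<rho>_def field_simps add_pos_nonneg add_nonneg_eq_0_iff)
  qed
  have unroll: "f (s N n) = \<rho> N ^ n * f t + (\<Sum>j<n. \<rho> N ^ (n - j) * (\<Delta> N j + r N j))" for N n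
  proof (induction n)
    case 0 then show ?case by (simp add: s_N)
  next
    case (Suc n)
    have "f (s N (Suc n)) = \<rho> N * (\<rho> N ^ n * f t + (\<Sum>j<n. \<rho> N ^ (n - j) * (\<Delta> N j + r N j)) + (\<Delta> N n + r N n))"
      using step[of N n] Suc by (simp add: add.assoc)
    also have "\<dots> = \<rho> N ^ Suc n * f t + ((\<Sum>j<n. \<rho> N * (\<rho> N ^ (n - j) * (\<Delta> N j + r N j))) + \<rho> N * (\<Delta> N n + r N n))"
      by (simp add: algebra_simps sum_distrib_left)
    also have "(\<Sum>j<n. \<rho> N * (\<rho> N ^ (n - j) * (\<Delta> N j + r N j))) = (\<Sum>j<n. \<rho> N ^ (Suc n - j) * (\<Delta> N j + r N j))"
      by (intro sum.cong) (auto simp: Suc_diff_le)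
    finally show ?case by simp
  qed
  \<comment> \<open>\<open>F N u\<close> measures how far \<open>f u\<close> is from the value at
    the right end of the cell containing \<open>u\<close>; its integral controls all residuals at
    once, since powers of \<open>\<rho> N\<close> are at most 1.\<close>
  define F where "F N u = (\<Sum>j<N. R N j u)" for N u
  obtain B where B: "\<And>u. u \<in> {0..t + h} \<Longrightarrow> \<bar>f u\<bar> \<le> B"
  proof -
    have "\<exists>B. \<forall>s\<in>{0..t + h}. \<bar>f s\<bar> \<le> B"
      by (rule cadlag_bounded) (use f_rcont f_left_ex t h in auto)
    then show thesis using that by blast
  qed
  have B0: "B \<ge> 0" using B[of 0] t h by auto
  have s_le: "s N (Suc j) \<le> t + h" if "j < N" for N j
  proof -
    have "real (Suc j) * d N \<le> real N * d N" using that d_nonneg by (intro mult_right_mono) auto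
    then show ?thesis using that by (simp add: s_def d_def)
  qed
  have F_bound: "F N u \<le> c * indicator {t<..t + h} u"
    if c: "c \<ge> 0" and "\<And>j. j < N \<Longrightarrow> u \<in> {s N j<..s N (Suc j)} \<Longrightarrow> \<bar>f (s N (Suc j)) - f u\<bar> \<le> c" for N u c
  proof (cases "N = 0")
    case True
    then show ?thesis using c by (simp add: F_def)
  next
    case False
    have "F N u \<le> (\<Sum>j<N. indicator {s N j<..s N (Suc j)} u * c)"
      unfolding F_def R_def using that by (intro sum_mono) (auto simp: indicator_def)
    also have "\<dots> = c * indicator {t<..t + h} u"
      using False sum_indicator_consecutive[of "s N" u N] s_mono s_N by (simp add: sum_distrib_right[symmetric])
    finally show ?thesis .
  qed
  have F_nonneg: "0 \<le> F N u" for N u unfolding F_def R_def by (intro sum_nonneg) auto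
  have F_B: "F N u \<le> 2 * B * indicator {t<..t + h} u" for N u
  proof (rule F_bound)
    show "\<bar>f (s N (Suc j)) - f u\<bar> \<le> 2 * B" if "j < N" "u \<in> {s N j<..s N (Suc j)}" for j
      using B[of u] B[of "s N (Suc j)"] s_le[OF that(1)] that s_mono(3)[of N j] by auto
  qed (use B0 in simp)
  have F_int_j: "integrable lborel (\<lambda>u. R N j u)" for N j
  proof -
    have "set_integrable lborel {s N j<..s N (Suc j)} (\<lambda>u. f (s N (Suc j)) - f u)"
      using s_mono fint[of "s N j"] by (intro set_integral_diff) (auto simp: set_integrable_def)
    then have "set_integrable lborel {s N j<..s N (Suc j)} (\<lambda>u. \<bar>f (s N (Suc j)) - f u\<bar>)"
      by (rule set_integrable_abs)
    then show ?thesis by (simp add: set_integrable_def R_def)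
  qed
  have "(\<lambda>N. LINT u|lborel. F N u) \<longlonglongrightarrow> (LINT u|(lborel :: real measure). (0::real))"
  proof (rule integral_dominated_convergence[where w="\<lambda>u. 2 * B * indicator {t<..t + h} u"])
    show "F N \<in> borel_measurable lborel" for N
      unfolding F_def[abs_def] using F_int_j by (intro borel_measurable_sum) (auto dest: borel_measurable_integrable)
    show "integrable lborel (\<lambda>u. 2 * B * indicator {t<..t + h} u)"
      using h by (intro integrable_mult_right integrable_real_indicator) auto
    show "AE u in lborel. norm (F N u) \<le> 2 * B * indicator {t<..t + h} u" for N
      using F_B[of N] F_nonneg[of N] by simp
    show "AE u in lborel. (\<lambda>N. F N u) \<longlonglongrightarrow> 0"
    proof (intro AE_I2)
      fix u
      show "(\<lambda>N. F N u) \<longlonglongrightarrow> 0"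
      proof (cases "u \<in> {t<..t + h}")
        case False
        then have "F N u = 0" for N
          using F_B[of N u] F_nonneg[of N u] by simp
        then show ?thesis by simp
      next
        case True
        show ?thesis
        proof (rule LIMSEQ_I)
          fix e :: real assume e: "e > 0"
          \<comment> \<open>The right end of the cell containing \<open>u\<close> lies between
            \<open>u\<close> and \<open>u + d N\<close>, so it is caught by a right neighbourhood of
            \<open>u\<close> once \<open>d N\<close> is small.\<close>
          have "eventually (\<lambda>v. \<bar>f v - f u\<bar> < e / 2) (at_right u)"
            using tendstoD[OF f_rcont[of u] half_gt_zero[OF e]] True t by (simp only: dist_real_def) auto
          then obtain v where v: "v > u" "\<And>w. u < w \<Longrightarrow> w < v \<Longrightarrow> \<bar>f w - f u\<bar> < e / 2"
            unfolding eventually_at_right_field by auto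
          have "(\<lambda>N. d N) \<longlonglongrightarrow> 0" unfolding d_def by (rule lim_const_over_n)
          then have "eventually (\<lambda>N. d N < v - u) sequentially"
            using v by (auto intro: order_tendstoD)
          then obtain n0 where n0: "\<And>N. N \<ge> n0 \<Longrightarrow> d N < v - u" unfolding eventually_sequentially by auto
          have "norm (F N u - 0) < e" if N: "N \<ge> n0" for N
          proof -
            have "F N u \<le> e / 2 * indicator {t<..t + h} u"
            proof (rule F_bound)
              fix j assume j: "j < N" "u \<in> {s N j<..s N (Suc j)}"
              then have "s N (Suc j) < v" using n0[OF N] s_mono(2)[of N j] by auto
              then show "\<bar>f (s N (Suc j)) - f u\<bar> \<le> e / 2"
                using v(2)[of "s N (Suc j)"] j e by (cases "s N (Suc j) = u") auto
            qed (use e in simp)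
            then show ?thesis using F_nonneg[of N u] e True by simp
          qed
          then show "\<exists>n0. \<forall>N\<ge>n0. norm (F N u - 0) < e" by blast
        qed
      qed
    qed
  qed simp
  then have F0: "(\<lambda>N. LINT u|lborel. F N u) \<longlonglongrightarrow> 0" by simp
  have res: "(\<lambda>N. \<Sum>j<N. \<rho> N ^ (N - j) * r N j) \<longlonglongrightarrow> 0"
  proof (rule tendsto_0_le[OF F0, of _ \<beta>], intro always_eventually allI)
    fix N
    have "norm (\<Sum>j<N. \<rho> N ^ (N - j) * r N j) \<le> (\<Sum>j<N. \<bar>r N j\<bar>)"
    proof (rule order_trans[OF norm_sum], rule sum_mono)
      fix j
      have "\<rho> N ^ (N - j) \<le> 1" using \<rho>[of N] by (intro power_le_one) auto
      then show "norm (\<rho> N ^ (N - j) * r N j) \<le> \<bar>r N j\<bar>"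
        using \<rho>[of N] by (simp add: abs_mult mult_left_le_one_le)
    qed
    also have "\<dots> \<le> (\<Sum>j<N. \<beta> * (LINT u|lborel. R N j u))"
    proof (rule sum_mono)
      fix j
      have "\<bar>LINT u:{s N j<..s N (Suc j)}|lborel. f (s N (Suc j)) - f u\<bar> \<le> (LINT u|lborel. R N j u)"
        unfolding set_lebesgue_integral_def using integral_abs_bound[of lborel "\<lambda>u. indicator {s N j<..s N (Suc j)} u *\<^sub>R (f (s N (Suc j)) - f u)"]
        by (simp add: abs_mult R_def)
      then show "\<bar>r N j\<bar> \<le> \<beta> * (LINT u|lborel. R N j u)"
        using beta by (simp add: r_def abs_mult)
    qed
    also have "\<dots> = (LINT u|lborel. F N u) * \<beta>"
      unfolding F_def[abs_def] Bochner_Integration.integral_sum[OF F_int_j] by (simp only: sum_distrib_left mult.commute[of _ \<beta>])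
    also have "\<dots> \<le> norm (LINT u|lborel. F N u) * \<beta>" using beta by (intro mult_right_mono) auto
    finally show "norm (\<Sum>j<N. \<rho> N ^ (N - j) * r N j) \<le> norm (LINT u|lborel. F N u) * \<beta>" .
  qed
  have pow: "(\<lambda>N. \<rho> N ^ N) \<longlonglongrightarrow> exp (- \<beta> * h)"
    unfolding \<rho>_def d_def by (rule implicit_euler_factor_tendsto)
  have "(\<lambda>N. f (t + h) - \<rho> N ^ N * f t - (\<Sum>j<N. \<rho> N ^ (N - j) * r N j)) \<longlonglongrightarrow> f (t + h) - exp (- \<beta> * h) * f t - 0"
    by (intro tendsto_intros pow res)
  \<comment> \<open>For \<open>N = 0\<close> the division yields step size 0 and the scheme stays at
    \<open>t\<close>, so the unrolled identity is claimed only for positive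
    \<open>N\<close>.\<close>
  moreover have "eventually (\<lambda>N. f (t + h) - \<rho> N ^ N * f t - (\<Sum>j<N. \<rho> N ^ (N - j) * r N j) =
      (\<Sum>j<N. \<rho> N ^ (N - j) * \<Delta> N j)) sequentially"
    using eventually_gt_at_top[of 0]
  proof eventually_elim
    case (elim N)
    then show ?case using unroll[of N N] s_N by (simp add: sum.distrib algebra_simps sum_subtractf)
  qed
  ultimately have "(\<lambda>N. \<Sum>j<N. \<rho> N ^ (N - j) * \<Delta> N j) \<longlonglongrightarrow> f (t + h) - exp (- \<beta> * h) * f t"
    by (simp add: tendsto_cong)
  then show ?thesis unfolding \<Delta>_def \<rho>_def s_def d_def .
qed

end

subsection \<open>The cumulant function and its integral\<close>

lemma exp_le_one_plus_exp:
  fixes u v y :: real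
  assumes "0 \<le> v" "v \<le> u"
  shows "exp (v * y) \<le> 1 + exp (u * y)"
proof (cases "y \<ge> 0")
  case True
  then have "v * y \<le> u * y" using assms by (intro mult_right_mono) auto
  then have "exp (v * y) \<le> exp (u * y)" by simp
  then show ?thesis by linarith
next
  case False
  then have "exp (v * y) \<le> 1" using assms by (auto simp: mult_nonneg_nonpos)
  then show ?thesis using exp_gt_zero[of "u * y"] by linarith
qed

context levy
begin

abbreviation K :: ereal where "K \<equiv> mgf_bound M L"

definition kap :: "real \<Rightarrow> real" where "kap v = ln (\<integral>\<omega>. exp (v * L 1 \<omega>) \<partial>M)"

text \<open>Approach to \<open>K\<close> from below, for finite and infinite \<open>K\<close> at
  once; it is the filter along which \<open>ou_phi\<close> is assumed to diverge.\<close>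

definition near_K :: "real filter" where
  "near_K = (if K = \<infinity> then at_top else at_left (real_of_ereal K))"

lemma exists_between_K:
  assumes "ereal u < K" obtains w where "u < w" "ereal w < K"
  using assms by (metis ereal_dense2 ereal_less_eq(3) less_ereal.simps(1))

lemma below_K: "ereal a < K \<Longrightarrow> u \<le> a \<Longrightarrow> ereal u < K"
  by (metis ereal_less_eq(3) order_le_less_trans)

text \<open>Below the supremum \<open>v\<close> there is always a larger exponent \<open>u\<close>
  with finite moment, and \<open>exp (v * y) \<le> 1 + exp (u * y)\<close>.\<close>

lemma integrable_exp:
  assumes v: "0 \<le> v" "ereal v < K"
  shows "integrable M (\<lambda>\<omega>. exp (v * L 1 \<omega>))"
proof -
  obtain u where u: "v < u" "(\<integral>\<^sup>+ \<omega>. ennreal (exp (u * L 1 \<omega>)) \<partial>M) < \<infinity>"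
    using v(2) unfolding mgf_bound_def less_Sup_iff by auto
  have i: "integrable M (\<lambda>\<omega>. exp (u * L 1 \<omega>))" using u by (intro integrableI_nonneg) auto
  show ?thesis
  proof (rule Bochner_Integration.integrable_bound)
    show "integrable M (\<lambda>\<omega>. 1 + exp (u * L 1 \<omega>))" using i by auto
    show "AE \<omega> in M. norm (exp (v * L 1 \<omega>)) \<le> norm (1 + exp (u * L 1 \<omega>))"
      using u v exp_le_one_plus_exp[of v u] by (intro AE_I2) (simp add: abs_of_nonneg add_nonneg_nonneg)
  qed simp
qed

lemma expectation_exp_pos:
  assumes "0 \<le> v" "ereal v < K" shows "0 < (\<integral>\<omega>. exp (v * L 1 \<omega>) \<partial>M)"
proof -
  have "(\<integral>\<omega>. exp (v * L 1 \<omega>) \<partial>M) \<noteq> 0"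
    using integral_nonneg_eq_0_iff_AE[OF integrable_exp[OF assms]] by simp
  moreover have "(\<integral>\<omega>. exp (v * L 1 \<omega>) \<partial>M) \<ge> 0" by simp
  ultimately show ?thesis by linarith
qed

lemma nn_integral_exp:
  assumes "0 \<le> v" "ereal v < K"
  shows "(\<integral>\<^sup>+\<omega>. ennreal (exp (v * L 1 \<omega>)) \<partial>M) = ennreal (exp (kap v))"
  using integrable_exp[OF assms] expectation_exp_pos[OF assms]
  by (simp add: kap_def nn_integral_eq_integral)

lemma continuous_kap:
  assumes "ereal u < K" shows "continuous_on {0..u} kap"
proof -
  have "continuous_on {0..u} (\<lambda>v. \<integral>\<omega>. exp (v * L 1 \<omega>) \<partial>M)"
    unfolding continuous_on_sequentially comp_def
  proof (intro allI ballI impI, elim conjE)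
    fix V v assume v: "v \<in> {0..u}" and V: "\<forall>n. V n \<in> {0..u}" "V \<longlonglongrightarrow> v"
    show "(\<lambda>n. \<integral>\<omega>. exp (V n * L 1 \<omega>) \<partial>M) \<longlonglongrightarrow> (\<integral>\<omega>. exp (v * L 1 \<omega>) \<partial>M)"
    proof (rule integral_dominated_convergence[where w="\<lambda>\<omega>. 1 + exp (u * L 1 \<omega>)"])
      show "integrable M (\<lambda>\<omega>. 1 + exp (u * L 1 \<omega>))" using v assms by (intro Bochner_Integration.integrable_add integrable_exp) auto
      show "AE \<omega> in M. (\<lambda>n. exp (V n * L 1 \<omega>)) \<longlonglongrightarrow> exp (v * L 1 \<omega>)" by (intro AE_I2 tendsto_intros V)
      show "AE \<omega> in M. norm (exp (V n * L 1 \<omega>)) \<le> 1 + exp (u * L 1 \<omega>)" for n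
        using V exp_le_one_plus_exp[of "V n" u] by (intro AE_I2) simp
    qed auto
  qed
  moreover have "(\<integral>\<omega>. exp (v * L 1 \<omega>) \<partial>M) \<noteq> 0" if "v \<in> {0..u}" for v
  proof -
    have "ereal v < K" using that by (intro below_K[OF assms]) auto
    then show ?thesis using expectation_exp_pos[of v] that by auto
  qed
  ultimately show ?thesis unfolding kap_def by (intro continuous_on_ln) auto
qed

text \<open>The exponential Chebyshev inequality on the event \<open>c \<le> L 1\<close>, followed
  by a logarithm. When \<open>K\<close> is infinite and \<open>c\<close> is arbitrary, it gives
  \<open>kap\<close> any prescribed asymptotic slope, which is the source of the superlinear growth
  of \<open>phi\<close>.\<close>

lemma kap_ge:
  assumes v: "0 \<le> v" "ereal v < K" and p: "prob {\<omega>\<in>space M. c \<le> L 1 \<omega>} > 0"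
  shows "v * c + ln (prob {\<omega>\<in>space M. c \<le> L 1 \<omega>}) \<le> kap v"
proof -
  let ?A = "{\<omega>\<in>space M. c \<le> L 1 \<omega>}"
  have "exp (v * c) * prob ?A = (\<integral>\<omega>. exp (v * c) * indicator ?A \<omega> \<partial>M)" by simp
  also have "\<dots> \<le> (\<integral>\<omega>. exp (v * L 1 \<omega>) \<partial>M)"
  proof (rule integral_mono[OF _ integrable_exp[OF v]])
    show "integrable M (\<lambda>\<omega>. exp (v * c) * indicator ?A \<omega>)" by (simp add: emeasure_eq_measure)
    show "exp (v * c) * indicator ?A \<omega> \<le> exp (v * L 1 \<omega>)" if "\<omega> \<in> space M" for \<omega>
      using v by (auto simp: indicator_def intro: mult_left_mono)
  qed
  finally have "ln (exp (v * c) * prob ?A) \<le> kap v"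
    unfolding kap_def using p by (intro ln_mono) auto
  then show ?thesis using p by (simp add: ln_mult)
qed

end

locale ou_exponent = levy M L for M :: "'a measure" and L +
  fixes \<beta> :: real
  assumes beta: "0 < \<beta>"
    and K_pos: "K > 0"
    and phi_K: "filterlim (ou_phi M L \<beta>) at_top near_K"
begin

abbreviation phi :: "real \<Rightarrow> real" where "phi \<equiv> ou_phi M L \<beta>"

lemma phi_eq: "phi u = 1 / \<beta> * (LINT v:{0<..<u}|lborel. kap v / v)"
  unfolding ou_phi_def kap_def ..

lemma near_K_gt: "ereal u < K \<Longrightarrow> eventually (\<lambda>w. u < w \<and> ereal w < K) near_K"
proof -
  assume u: "ereal u < K"
  show ?thesis
  proof (cases "K = \<infinity>")
    case True
    then show ?thesis unfolding near_K_def by (simp add: eventually_gt_at_top)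
  next
    case False
    then obtain k where k: "K = ereal k" using u by (cases K) auto
    then have "eventually (\<lambda>w. w \<in> {u<..<k}) (at_left k)" using u by (intro eventually_at_leftI[of u]) auto
    then show ?thesis unfolding near_K_def k by (simp add: conj_commute eventually_conj_iff)
  qed
qed

lemma near_K_neq_bot [simp]: "near_K \<noteq> bot"
  unfolding near_K_def by auto

text \<open>If the integrand were not integrable at 0, then \<open>ou_phi\<close> would vanish identically by the convention for the
  Bochner integral, so divergence at \<open>K\<close> already contains integrability.\<close>

lemma phi_integrable:
  assumes "ereal u < K" shows "set_integrable lborel {0<..<u} (\<lambda>v. kap v / v)"
proof -
  have "eventually (\<lambda>w. phi w \<ge> 1) near_K" using phi_K by (simp add: filterlim_at_top)
  with near_K_gt[OF assms] have "eventually (\<lambda>w. u < w \<and> phi w \<ge> 1) near_K"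
    by eventually_elim auto
  then obtain w where w: "u < w" "phi w \<ge> 1"
    using eventually_happens'[OF near_K_neq_bot] by blast
  then have "(LINT v:{0<..<w}|lborel. kap v / v) \<noteq> 0" unfolding phi_eq by auto
  then have "set_integrable lborel {0<..<w} (\<lambda>v. kap v / v)"
    unfolding set_integrable_def set_lebesgue_integral_def using not_integrable_integral_eq by blast
  then show ?thesis by (rule set_integrable_subset) (use w in auto)
qed

lemma phi_deriv:
  assumes u: "0 < u" "ereal u < K"
  shows "(phi has_real_derivative kap u / (\<beta> * u)) (at u)"
proof -
  obtain w where w: "u < w" "ereal w < K" using exists_between_K[OF u(2)] .
  \<comment> \<open>The integrand \<open>kap v / v\<close> is known to be continuous only away from
    0. Splitting at a point between 0 and \<open>u\<close> leaves a constant and an integral to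
    which the fundamental theorem applies.\<close>
  define a where "a = u / 2"
  have a: "0 < a" "a < u" using u by (auto simp: a_def)
  let ?g = "\<lambda>v. kap v / v"
  have int: "?g integrable_on {0..w}" 
    using set_borel_integral_eq_integral(1)[OF phi_integrable[OF w(2)]] by (simp add: integrable_on_open_interval_real)
  have phi_HK: "phi v = 1 / \<beta> * (integral {0..a} ?g + integral {a..v} ?g)" if "v \<in> {a..w}" for v
  proof -
    have "ereal v < K" using that by (intro below_K[OF w(2)]) auto
    then have "phi v = 1 / \<beta> * integral {0..v} ?g"
      unfolding phi_eq using set_borel_integral_eq_integral(2)[OF phi_integrable[of v]] by (simp add: integral_open_interval_real)
    also have "integral {0..v} ?g = integral {0..a} ?g + integral {a..v} ?g"
      using that a by (intro Henstock_Kurzweil_Integration.integral_combine[symmetric] integrable_on_subinterval[OF int]) auto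
    finally show ?thesis .
  qed
  have "continuous_on {a..w} ?g"
    using a by (intro continuous_intros continuous_on_subset[OF continuous_kap[OF w(2)]]) auto
  then have "((\<lambda>v. integral {a..v} ?g) has_real_derivative ?g u) (at u within {a..w})"
    using a w by (intro integral_has_real_derivative) auto
  then have "((\<lambda>v. 1 / \<beta> * (integral {0..a} ?g + integral {a..v} ?g)) has_real_derivative 1 / \<beta> * ?g u) (at u within {a..w})"
    using beta by (auto intro!: derivative_eq_intros)
  then have "(phi has_real_derivative 1 / \<beta> * ?g u) (at u within {a..w})"
    by (rule has_field_derivative_transform_within[OF _ zero_less_one]) (use a w phi_HK in auto)
  moreover have "at u within {a..w} = at u" using a w by (simp add: at_within_Icc_at)
  ultimately show ?thesis by simp
qed

text \<open>The bound is the integral of \<open>\<bar>kap v / v\<bar>\<close> over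
  \<open>(0, a)\<close>. For \<open>u \<le> 0\<close> the domain of integration is empty and
  \<open>phi u = 0\<close>, which allows all \<open>u \<le> a\<close>.\<close>

lemma phi_bounded:
  assumes "ereal a < K" obtains B where "\<And>u. u \<le> a \<Longrightarrow> \<bar>phi u\<bar> \<le> B"
proof
  fix u assume u: "u \<le> a"
  have int: "integrable lborel (\<lambda>v. indicator {0<..<a} v * \<bar>kap v / v\<bar>)"
    using set_integrable_abs[OF phi_integrable[OF assms]] by (simp add: set_integrable_def)
  have int': "integrable lborel (\<lambda>v. indicator {0<..<u} v * \<bar>kap v / v\<bar>)"
    using set_integrable_abs[OF set_integrable_subset[OF phi_integrable[OF assms], of "{0<..<u}"]] u
    by (simp add: set_integrable_def greaterThanLessThan_subseteq_greaterThanLessThan)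
  have "\<bar>LINT v:{0<..<u}|lborel. kap v / v\<bar> \<le> (LINT v|lborel. indicator {0<..<u} v * \<bar>kap v / v\<bar>)"
    unfolding set_lebesgue_integral_def using integral_abs_bound[of lborel "\<lambda>v. indicator {0<..<u} v *\<^sub>R (kap v / v)"]
    by (simp add: abs_mult)
  also have "\<dots> \<le> (LINT v|lborel. indicator {0<..<a} v * \<bar>kap v / v\<bar>)"
    using u by (intro integral_mono int int') (auto simp: indicator_def)
  finally show "\<bar>phi u\<bar> \<le> 1 / \<beta> * (LINT v|lborel. indicator {0<..<a} v * \<bar>kap v / v\<bar>)"
    unfolding phi_eq using beta by (simp add: abs_mult divide_right_mono)
qed

lemma continuous_phi: "continuous_on {u. 0 < u \<and> ereal u < K} phi"
  using phi_deriv by (auto intro!: continuous_at_imp_continuous_on DERIV_isCont)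

text \<open>The quantity is \<open>w\<close> times the integrand of the function \<open>G\<close> at
  the level \<open>b\<close>; its smallness near \<open>K\<close> is what makes the mass lost in a
  time step negligible. For finite \<open>K\<close> the factor
  \<open>w powr \<mu> * exp (w * b)\<close> is bounded. For infinite \<open>K\<close>,
  \<open>phi\<close> is eventually steeper than \<open>b + 1\<close>, leaving a factor
  \<open>exp (- w)\<close> to beat the power.\<close>

lemma weight_small:
  assumes unb: "\<And>c. prob {\<omega>\<in>space M. c \<le> L 1 \<omega>} > 0" and e: "e > 0" and mu: "\<mu> > 0"
  shows "eventually (\<lambda>w. w powr \<mu> * exp (w * b - phi w) \<le> e) near_K"
proof (cases "K = \<infinity>")
  case False
  then obtain k where k: "K = ereal k" "k > 0" using K_pos by (cases K) auto
  define C where "C = k powr \<mu> * exp (k * \<bar>b\<bar>)"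
  have C: "C > 0" using k by (simp add: C_def)
  have "eventually (\<lambda>w. phi w \<ge> ln (C / e)) near_K" using phi_K by (simp add: filterlim_at_top)
  moreover have "eventually (\<lambda>w. 0 < w \<and> ereal w < K) near_K" using K_pos by (intro near_K_gt) (simp add: zero_ereal_def)
  ultimately show ?thesis
  proof eventually_elim
    case (elim w)
    then have w: "0 < w" "w < k" using k by auto
    have "exp (ln (C / e)) \<le> exp (phi w)" using elim by simp
    then have 1: "exp (- phi w) \<le> e / C" using C e by (simp add: exp_minus field_simps)
    have "w * b \<le> w * \<bar>b\<bar>" using w by (intro mult_left_mono) auto
    also have "\<dots> \<le> k * \<bar>b\<bar>" using w by (intro mult_right_mono) auto
    finally have "w * b \<le> k * \<bar>b\<bar>" .
    then have "w powr \<mu> * exp (w * b) \<le> C" unfolding C_def using w mu by (intro mult_mono powr_mono2) auto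
    then have "(w powr \<mu> * exp (w * b)) * exp (- phi w) \<le> C * (e / C)" using 1 C by (intro mult_mono) auto
    then show ?case using C by (simp add: exp_diff exp_minus field_simps)
  qed
next
  case True
  \<comment> \<open>The part \<open>\<beta> * (b + 1)\<close> becomes slope \<open>b + 1\<close> of
    \<open>phi\<close> after division by \<open>\<beta> * v\<close>; the extra 1 absorbs
    \<open>ln ?p\<close> as soon as \<open>v \<ge> - ln ?p\<close>.\<close>
  define c where "c = \<beta> * (b + 1) + 1"
  let ?p = "prob {\<omega>\<in>space M. c \<le> L 1 \<omega>}"
  define w0 where "w0 = max 1 (- ln ?p)"
  have deriv: "b + 1 \<le> kap v / (\<beta> * v)" if "v \<ge> w0" for v
  proof -
    have v: "v \<ge> 1" "v \<ge> - ln ?p" using that by (auto simp: w0_def)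
    then have "v * c + ln ?p \<le> kap v" using True unb[of c] by (intro kap_ge) auto
    then have "v * (\<beta> * (b + 1)) \<le> kap v" using v by (simp add: c_def algebra_simps)
    then show ?thesis using v beta by (simp add: field_simps)
  qed
  have ge: "phi w \<ge> (b + 1) * w + (phi w0 - (b + 1) * w0)" if "w \<ge> w0" for w
  proof -
    have "phi w0 - (b + 1) * w0 \<le> phi w - (b + 1) * w"
    proof (rule DERIV_nonneg_imp_nondecreasing[OF that])
      fix v assume v: "w0 \<le> v" "v \<le> w"
      have "((\<lambda>w. phi w - (b + 1) * w) has_real_derivative kap v / (\<beta> * v) - (b + 1)) (at v)"
        using v True by (auto intro!: derivative_eq_intros phi_deriv simp: w0_def)
      then show "\<exists>y. ((\<lambda>w. phi w - (b + 1) * w) has_real_derivative y) (at v) \<and> 0 \<le> y"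
        using deriv[OF v(1)] by (intro exI conjI) auto
    qed
    then show ?thesis by simp
  qed
  define C where "C = exp (- (phi w0 - (b + 1) * w0))"
  define n where "n = nat \<lceil>\<mu>\<rceil>"
  have "((\<lambda>w. C * (w ^ n / exp w)) \<longlongrightarrow> C * 0) at_top" by (intro tendsto_intros tendsto_power_div_exp_0)
  then have "eventually (\<lambda>w. C * (w ^ n / exp w) < e) at_top" using e by (auto intro: order_tendstoD)
  moreover have "eventually (\<lambda>w. w \<ge> w0) at_top" by (rule eventually_ge_at_top)
  ultimately have "eventually (\<lambda>w. w powr \<mu> * exp (w * b - phi w) \<le> e) at_top"
  proof eventually_elim
    case (elim w)
    have w1: "w \<ge> 1" using elim by (simp add: w0_def)
    have "w powr \<mu> \<le> w powr real n" using w1 real_nat_ceiling_ge[of \<mu>] by (intro powr_mono) (auto simp: n_def)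
    then have 1: "w powr \<mu> \<le> w ^ n" using w1 by (simp add: powr_realpow)
    have "exp (w * b - phi w) \<le> exp (- w - (phi w0 - (b + 1) * w0))"
      using ge[of w] elim by (simp add: algebra_simps)
    also have "\<dots> = C / exp w" by (simp add: C_def exp_diff exp_minus exp_add field_simps)
    finally have "w powr \<mu> * exp (w * b - phi w) \<le> w ^ n * (C / exp w)" using 1 w1 by (intro mult_mono) auto
    also have "w ^ n * (C / exp w) = C * (w ^ n / exp w)" by simp
    finally show ?case using elim by simp
  qed
  then show ?thesis unfolding near_K_def using True by simp
qed

end

lemma exp_dominated:
  fixes u u' e :: real
  assumes "u < u'" "0 \<le> u" "e > 0"
  shows "\<exists>C\<ge>0. \<forall>s. exp (u * s) \<le> C + e * exp (u' * s)"
proof (intro exI conjI allI)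
  \<comment> \<open>The point at which \<open>exp (u * s)\<close> and
    \<open>e * exp (u' * s)\<close> cross: to its left the constant dominates, to its right the
    second term.\<close>
  define s0 where "s0 = - ln e / (u' - u)"
  show "exp (u * s0) \<ge> 0" by simp
  fix s
  show "exp (u * s) \<le> exp (u * s0) + e * exp (u' * s)"
  proof (cases "s \<le> s0")
    case True
    then have "exp (u * s) \<le> exp (u * s0)" using assms by (auto intro: mult_left_mono)
    then show ?thesis using assms by (simp add: add_increasing2)
  next
    case False
    then have "- ln e \<le> (u' - u) * s" using assms by (simp add: s0_def field_simps)
    then have "u * s \<le> ln e + u' * s" by (simp add: algebra_simps)
    then have "exp (u * s) \<le> exp (ln e + u' * s)" by simp
    also have "\<dots> = e * exp (u' * s)" using assms by (simp add: exp_add)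
    finally show ?thesis by (simp add: add_increasing)
  qed
qed

context levy
begin

subsection \<open>Past and future of the increments\<close>

definition inc_sets :: "nat \<Rightarrow> nat \<Rightarrow> 'a set set" where
  "inc_sets N i = sigma_sets (space M) {inc (1 / 2^N) i -` A \<inter> space M |A. A \<in> sets borel}"

definition inc_alg :: "(nat \<Rightarrow> nat set) \<Rightarrow> nat \<Rightarrow> 'a measure" where
  "inc_alg I N = sigma (space M) (\<Union>i\<in>I N. inc_sets N i)"

definition inc_limit_alg :: "(nat \<Rightarrow> nat set) \<Rightarrow> 'a measure" where
  "inc_limit_alg I = sigma (space M) (\<Union>N. sets (inc_alg I N))"

text \<open>With an interval both of its dyadic halves are selected at the next level. Since an
  increment is the sum of its halves, the algebras then grow with the level and their union is
  closed under intersection.\<close>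

definition refining :: "(nat \<Rightarrow> nat set) \<Rightarrow> bool" where
  "refining I \<longleftrightarrow> (\<forall>N. \<forall>i\<in>I N. 2 * i \<in> I (Suc N) \<and> Suc (2 * i) \<in> I (Suc N))"

lemma inc_sets_subset: "inc_sets N i \<subseteq> Pow (space M)"
  unfolding inc_sets_def using sigma_sets_into_sp[of "{inc (1 / 2^N) i -` A \<inter> space M |A. A \<in> sets borel}" "space M"] by auto

lemma sets_inc_alg: "sets (inc_alg I N) = sigma_sets (space M) (\<Union>i\<in>I N. inc_sets N i)"
  and space_inc_alg [simp]: "space (inc_alg I N) = space M"
  unfolding inc_alg_def using inc_sets_subset by (auto intro!: sets_measure_of space_measure_of)

lemma sets_inc_alg_subset: "sets (inc_alg I N) \<subseteq> Pow (space M)"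
  using sets.space_closed[of "inc_alg I N"] by simp

lemma sets_inc_limit_alg: "sets (inc_limit_alg I) = sigma_sets (space M) (\<Union>N. sets (inc_alg I N))"
  and space_inc_limit_alg [simp]: "space (inc_limit_alg I) = space M"
  unfolding inc_limit_alg_def using sets_inc_alg_subset by (auto intro!: sets_measure_of space_measure_of)

lemma inc_measurable_inc_alg: "i \<in> I N \<Longrightarrow> inc (1 / 2^N) i \<in> borel_measurable (inc_alg I N)"
  by (rule measurableI) (auto simp: sets_inc_alg inc_sets_def intro!: sigma_sets.Basic)

lemma inc_measurable_limit:
  assumes "i \<in> I N" shows "inc (1 / 2^N) i \<in> borel_measurable (inc_limit_alg I)"
proof (rule measurableI)
  fix A :: "real set" assume "A \<in> sets borel"
  then have "inc (1 / 2^N) i -` A \<inter> space M \<in> sets (inc_alg I N)"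
    using measurable_sets[OF inc_measurable_inc_alg[of i I N, OF assms]] by simp
  then show "inc (1 / 2^N) i -` A \<inter> space (inc_limit_alg I) \<in> sets (inc_limit_alg I)"
    unfolding sets_inc_limit_alg space_inc_limit_alg by (intro sigma_sets.Basic) blast
qed simp

lemma inc_split: "inc (1 / 2^N) i \<omega> = inc (1 / 2^Suc N) (2 * i) \<omega> + inc (1 / 2^Suc N) (Suc (2 * i)) \<omega>"
proof -
  have "real (Suc i) * (1 / 2^N) = real (Suc (Suc (2 * i))) * (1 / 2^Suc N)"
    "real i * (1 / 2^N) = real (2 * i) * (1 / 2^Suc N)" by (auto simp: field_simps)
  then show ?thesis unfolding inc_def by simp
qed

lemma inc_alg_Suc_subset:
  assumes "refining I" shows "sets (inc_alg I N) \<subseteq> sets (inc_alg I (Suc N))"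
proof -
  have "inc_sets N i \<subseteq> sets (inc_alg I (Suc N))" if "i \<in> I N" for i
  proof -
    have "2 * i \<in> I (Suc N)" "Suc (2 * i) \<in> I (Suc N)" using assms that by (auto simp: refining_def)
    then have "(\<lambda>\<omega>. inc (1 / 2^Suc N) (2 * i) \<omega> + inc (1 / 2^Suc N) (Suc (2 * i)) \<omega>) \<in> borel_measurable (inc_alg I (Suc N))"
      by (intro borel_measurable_add inc_measurable_inc_alg)
    moreover have "inc (1 / 2^N) i = (\<lambda>\<omega>. inc (1 / 2^Suc N) (2 * i) \<omega> + inc (1 / 2^Suc N) (Suc (2 * i)) \<omega>)"
      by (rule ext, rule inc_split)
    ultimately have "inc (1 / 2^N) i \<in> borel_measurable (inc_alg I (Suc N))" by (simp only:)
    then have "{inc (1 / 2^N) i -` A \<inter> space M |A. A \<in> sets borel} \<subseteq> sets (inc_alg I (Suc N))"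
      using measurable_sets[of "inc (1 / 2^N) i" "inc_alg I (Suc N)"] by auto
    then show ?thesis unfolding inc_sets_def using sets.sigma_sets_subset[of _ "inc_alg I (Suc N)"] by simp
  qed
  then have "(\<Union>i\<in>I N. inc_sets N i) \<subseteq> sets (inc_alg I (Suc N))" by blast
  then show ?thesis unfolding sets_inc_alg[of I N] using sets.sigma_sets_subset[of _ "inc_alg I (Suc N)"] by simp
qed

lemma inc_alg_mono: "refining I \<Longrightarrow> m \<le> n \<Longrightarrow> sets (inc_alg I m) \<subseteq> sets (inc_alg I n)"
  by (rule lift_Suc_mono_le) (auto dest: inc_alg_Suc_subset)

lemma Int_stable_union: "refining I \<Longrightarrow> Int_stable (\<Union>N. sets (inc_alg I N))"
proof (rule Int_stableI, safe)
  fix A B m n assume I: "refining I" and "A \<in> sets (inc_alg I m)" "B \<in> sets (inc_alg I n)"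
  then have "A \<in> sets (inc_alg I (max m n))" "B \<in> sets (inc_alg I (max m n))"
    using inc_alg_mono[OF I, of m "max m n"] inc_alg_mono[OF I, of n "max m n"] by auto
  then show "A \<inter> B \<in> (\<Union>N. sets (inc_alg I N))" by blast
qed

lemma indep_inc_alg:
  assumes "I N \<inter> J N = {}" shows "indep_set (sets (inc_alg I N)) (sets (inc_alg J N))"
proof -
  have ind: "indep_sets (inc_sets N) UNIV"
    using indep_inc[of "1 / 2^N"] unfolding indep_vars_def inc_sets_def by auto
  have "indep_sets (\<lambda>b. sigma_sets (space M) (\<Union>i\<in>case_bool (I N) (J N) b. inc_sets N i)) UNIV"
  proof (rule indep_sets_collect_sigma)
    show "indep_sets (inc_sets N) (\<Union>b. case_bool (I N) (J N) b)"
      by (rule indep_sets_mono_index[OF _ ind]) auto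
    show "Int_stable (inc_sets N i)" for i
    proof -
      interpret S: sigma_algebra "space M" "inc_sets N i"
        unfolding inc_sets_def by (rule sigma_algebra_sigma_sets) auto
      show ?thesis by (auto simp: Int_stable_def)
    qed
    show "disjoint_family_on (case_bool (I N) (J N)) UNIV"
      using assms by (auto simp: disjoint_family_on_def split: bool.splits)
  qed
  then show ?thesis unfolding indep_set_def sets_inc_alg
    by (rule indep_sets_cong[THEN iffD1, rotated -1]) (auto split: bool.split)
qed

text \<open>Any two generating events live at a common level, where disjoint sets of increments are
  independent; closure under intersection extends this to the generated sigma-algebras.\<close>

lemma indep_limit_alg:
  assumes I: "refining I" and J: "refining J" and disj: "\<And>N. I N \<inter> J N = {}"
  shows "indep_set (sets (inc_limit_alg I)) (sets (inc_limit_alg J))"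
  unfolding sets_inc_limit_alg
proof (rule indep_set_sigma_sets[OF _ Int_stable_union[OF I] Int_stable_union[OF J]])
  show "indep_set (\<Union>N. sets (inc_alg I N)) (\<Union>N. sets (inc_alg J N))"
    unfolding indep_sets2_eq
  proof (intro conjI ballI)
    show "(\<Union>N. sets (inc_alg I N)) \<subseteq> events" "(\<Union>N. sets (inc_alg J N)) \<subseteq> events"
      using indep_inc_alg[of I _ J, OF disj] unfolding indep_sets2_eq by blast+
    fix A B assume "A \<in> (\<Union>N. sets (inc_alg I N))" "B \<in> (\<Union>N. sets (inc_alg J N))"
    then obtain m n where "A \<in> sets (inc_alg I m)" "B \<in> sets (inc_alg J n)" by auto
    then have "A \<in> sets (inc_alg I (max m n))" "B \<in> sets (inc_alg J (max m n))"
      using inc_alg_mono[OF I, of m "max m n"] inc_alg_mono[OF J, of n "max m n"] by auto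
    then show "prob (A \<inter> B) = prob A * prob B"
      using indep_inc_alg[of I "max m n" J, OF disj] unfolding indep_sets2_eq by auto
  qed
qed

text \<open>The index \<open>i\<close> at level \<open>N\<close> stands for the interval from
  \<open>i / 2^N\<close> to \<open>(i + 1) / 2^N\<close>. The past collects the intervals that end
  by time \<open>t\<close>, the future those that start at \<open>t\<close> or later.\<close>

definition past :: "real \<Rightarrow> 'a measure" where
  "past t = inc_limit_alg (\<lambda>N. {i. real (Suc i) / 2^N \<le> t})"

definition future :: "real \<Rightarrow> 'a measure" where
  "future t = inc_limit_alg (\<lambda>N. {i. t \<le> real i / 2^N})"

lemma indep_past_future: "indep_set (sets (past t)) (sets (future t))"
  unfolding past_def future_def
  by (rule indep_limit_alg) (auto simp: refining_def field_simps)

lemma past_measurable_M: "U \<in> measurable (past t) N \<Longrightarrow> U \<in> measurable M N"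
  using indep_past_future[of t] unfolding indep_sets2_eq
  by (auto simp: measurable_def past_def)

lemma future_measurable_M: "U \<in> measurable (future t) N \<Longrightarrow> U \<in> measurable M N"
  using indep_past_future[of t] unfolding indep_sets2_eq
  by (auto simp: measurable_def future_def)

lemma nn_integral_past_future:
  fixes U V :: "'a \<Rightarrow> ennreal"
  assumes U: "U \<in> borel_measurable (past t)" and V: "V \<in> borel_measurable (future t)"
  shows "(\<integral>\<^sup>+\<omega>. U \<omega> * V \<omega> \<partial>M) = integral\<^sup>N M U * integral\<^sup>N M V"
proof -
  have "indep_set (sigma_sets (space M) {U -` A \<inter> space M |A. A \<in> sets borel})
      (sigma_sets (space M) {V -` A \<inter> space M |A. A \<in> sets borel})"
  proof -
    have "sigma_sets (space M) {U -` A \<inter> space M |A. A \<in> sets borel} \<subseteq> sets (past t)"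
      using measurable_sets[OF U] sets.sigma_sets_subset[of "{U -` A \<inter> space M |A. A \<in> sets borel}" "past t"] by (auto simp: past_def)
    moreover have "sigma_sets (space M) {V -` A \<inter> space M |A. A \<in> sets borel} \<subseteq> sets (future t)"
      using measurable_sets[OF V] sets.sigma_sets_subset[of "{V -` A \<inter> space M |A. A \<in> sets borel}" "future t"] by (auto simp: future_def)
    ultimately show ?thesis using indep_past_future[of t] unfolding indep_sets2_eq by blast
  qed
  then have "indep_var borel U borel V"
    unfolding indep_var_eq using past_measurable_M[OF U] future_measurable_M[OF V] by auto
  then have "indep_vars (\<lambda>_. borel) (case_bool U V) UNIV"
    unfolding indep_var_def by (rule indep_vars_cong[THEN iffD1, rotated -1]) (auto split: bool.split)
  from indep_vars_nn_integral[OF _ this] show ?thesis by (simp add: UNIV_bool mult.commute)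
qed

lemma inc_past: "real (Suc i) / 2^N \<le> t \<Longrightarrow> inc (1 / 2^N) i \<in> borel_measurable (past t)"
  unfolding past_def by (rule inc_measurable_limit) simp

lemma inc_future: "t \<le> real i / 2^N \<Longrightarrow> inc (1 / 2^N) i \<in> borel_measurable (future t)"
  unfolding future_def by (rule inc_measurable_limit) simp

lemma L_diff_future:
  "(\<lambda>\<omega>. L (real (k + j) / 2^N) \<omega> - L (real k / 2^N) \<omega>) \<in> borel_measurable (future (real k / 2^N))"
proof -
  have "(\<lambda>\<omega>. \<Sum>i<j. inc (1 / 2^N) (k + i) \<omega>) \<in> borel_measurable (future (real k / 2^N))"
    by (intro borel_measurable_sum inc_future) (auto simp: divide_right_mono)
  moreover have "(\<Sum>i<j. inc (1 / 2^N) (k + i) \<omega>) = L (real (k + j) / 2^N) \<omega> - L (real k / 2^N) \<omega>" for \<omega>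
    unfolding inc_def using sum_lessThan_telescope[of "\<lambda>i. L (real (k + i) / 2^N) \<omega>" j] by simp
  ultimately show ?thesis by simp
qed

text \<open>\<open>L 1\<close> is the sum of \<open>2^N\<close> independent increments with the same
  law, so the moment sought is the nonnegative \<open>2^N\<close>-th root of
  \<open>exp (kap v)\<close>; its finiteness is read off from that power.\<close>

lemma nn_integral_exp_inc:
  assumes v: "0 \<le> v" "ereal v < K"
  shows "(\<integral>\<^sup>+\<omega>. ennreal (exp (v * inc (1 / 2^N) i \<omega>)) \<partial>M) = ennreal (exp (1 / 2^N * kap v))"
proof -
  define R where "R = (\<integral>\<^sup>+\<omega>. ennreal (exp (v * L (1 / 2^N) \<omega>)) \<partial>M)"
  have R: "(\<integral>\<^sup>+\<omega>. ennreal (exp (v * inc (1 / 2^N) i \<omega>)) \<partial>M) = R" for i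
  proof -
    have "(\<integral>\<^sup>+y. ennreal (exp (v * y)) \<partial>distr M borel (inc (1 / 2^N) i)) = (\<integral>\<^sup>+y. ennreal (exp (v * y)) \<partial>distr M borel (L (1 / 2^N)))"
      by (simp add: distr_inc)
    then show ?thesis unfolding R_def by (simp add: nn_integral_distr)
  qed
  have "ennreal (exp (kap v)) = (\<integral>\<^sup>+\<omega>. ennreal (exp (v * L 1 \<omega>)) \<partial>M)" using nn_integral_exp[OF v] by simp
  also have "\<dots> = (\<integral>\<^sup>+\<omega>. (\<Prod>i<2^N. ennreal (exp (v * inc (1 / 2^N) i \<omega>))) \<partial>M)"
  proof (rule nn_integral_cong_AE)
    show "AE \<omega> in M. ennreal (exp (v * L 1 \<omega>)) = (\<Prod>i<2^N. ennreal (exp (v * inc (1 / 2^N) i \<omega>)))"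
      using L_sum_inc[of "2^N" "1 / 2^N"]
    proof eventually_elim
      case (elim \<omega>)
      then show ?case by (simp add: prod_ennreal exp_sum[symmetric] sum_distrib_left)
    qed
  qed
  also have "\<dots> = (\<Prod>i<(2::nat)^N. (\<integral>\<^sup>+\<omega>. ennreal (exp (v * inc (1 / 2^N) i \<omega>)) \<partial>M))"
  proof (rule indep_vars_nn_integral)
    show "indep_vars (\<lambda>_. borel) (\<lambda>i \<omega>. ennreal (exp (v * inc (1 / 2^N) i \<omega>))) {..<2^N}"
      using indep_vars_compose2[OF indep_vars_subset[OF indep_inc[of "1 / 2^N"], of "{..<2^N}"], of "\<lambda>_ y. ennreal (exp (v * y))" "\<lambda>_. borel"] by simp
  qed auto
  also have "\<dots> = R ^ (2^N)" by (simp add: R)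
  finally have pow: "R ^ (2^N) = ennreal (exp (kap v))" ..
  then have "R \<noteq> \<infinity>" by (auto simp: top_power_ennreal)
  then obtain r where r: "R = ennreal r" "r \<ge> 0" by (cases R) auto
  then have "r ^ (2^N) = exp (kap v)" using pow by (simp add: ennreal_power)
  also have "exp (kap v) = exp (1 / 2^N * kap v) ^ (2^N)" by (simp flip: exp_of_nat_mult)
  finally have "r = exp (1 / 2^N * kap v)" using r by (intro power_eq_imp_eq_base[of r "2^N"]) auto
  then show ?thesis unfolding R r by simp
qed

end

section \<open>The exponent of the Euler scheme as a Riemann sum\<close>

context ou_exponent
begin

text \<open>The arguments of \<open>kap\<close> form a geometric partition that descends from
  \<open>u\<close> to a point close to \<open>u * exp (- \<beta> * h)\<close>. A cell of it has
  length \<open>\<beta> * d\<close> times its lower end, so \<open>d * kap v\<close> is this length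
  times \<open>kap v / (\<beta> * v)\<close>, the derivative of \<open>phi\<close>.\<close>

lemma riemann_sum_phi:
  assumes u: "0 < u" "ereal u < K" and h: "h > 0"
  shows "(\<lambda>N. \<Sum>j<N. (h / real N) * kap (u * (1 / (1 + \<beta> * (h / real N)))^(N - j))) \<longlonglongrightarrow> phi u - phi (u * exp (- \<beta> * h))"
proof -
  define d where "d N = h / real N" for N
  define \<rho> where "\<rho> N = 1 / (1 + \<beta> * d N)" for N
  define q where "q v = kap v / (\<beta> * v)" for v
  define u0 where "u0 = u * exp (- \<beta> * h)"
  define v where "v N i = u * \<rho> N ^ i" for N i
  define Q where "Q N i = (v N i - v N (Suc i)) * q (v N (Suc i))" for N i
  have u0: "0 < u0" "u0 < u" using u h beta by (auto simp: u0_def)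
  have d: "d N \<ge> 0" for N using h by (simp add: d_def)
  have \<rho>: "0 < \<rho> N" "\<rho> N \<le> 1" for N
    using beta d[of N] by (auto simp: \<rho>_def field_simps add_pos_nonneg)
  have v_pos: "v N i > 0" for N i using u \<rho> by (simp add: v_def)
  have v_step: "v N i - v N (Suc i) = v N (Suc i) * (\<beta> * d N)" for N i
  proof -
    have "\<rho> N * (1 + \<beta> * d N) = 1" using beta d[of N] by (simp add: \<rho>_def add_nonneg_eq_0_iff)
    then have "v N (Suc i) * (1 + \<beta> * d N) = v N i" by (simp add: v_def)
    then show ?thesis by (simp add: algebra_simps)
  qed
  have v_le: "v N i \<le> u" for N i
    using u \<rho>[of N] by (simp add: v_def mult_left_le power_le_one)
  \<comment> \<open>Since \<open>(1 + \<beta> * h / N)^N \<le> exp (\<beta> * h)\<close>, the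
    partition never leaves the compact interval from \<open>u0\<close> to \<open>u\<close>, on which
    \<open>q\<close> is uniformly continuous.\<close>
  have v_ge: "u0 \<le> v N i" if "i \<le> N" for N i
  proof (cases "N = 0")
    case True
    then show ?thesis using that u0 by (simp add: v_def)
  next
    case False
    have "(1 + (\<beta> * h) / real N) ^ N \<le> exp (\<beta> * h)"
      using False beta h by (intro exp_ge_one_plus_x_over_n_power_n) (auto simp: order_trans[of _ 0])
    then have "exp (- \<beta> * h) \<le> \<rho> N ^ N"
      using beta h d[of N] unfolding \<rho>_def d_def
      by (simp add: exp_minus power_one_over inverse_eq_divide frac_le add_pos_nonneg)
    also have "\<dots> \<le> \<rho> N ^ i" using \<rho>[of N] that by (intro power_decreasing) auto
    finally show ?thesis using u by (simp add: u0_def v_def)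
  qed
  note v_K = below_K[OF u(2)]
  have "continuous_on {u0..u} q"
    unfolding q_def using u0 beta by (intro continuous_intros continuous_on_subset[OF continuous_kap[OF u(2)]]) auto
  then have uc: "uniformly_continuous_on {u0..u} q" by (intro compact_uniformly_continuous) auto
  have sum_eq: "(\<Sum>j<N. d N * kap (u * \<rho> N ^ (N - j))) = (\<Sum>i<N. Q N i)" for N
  proof -
    \<comment> \<open>Reversing the order of summation turns the exponent \<open>N - j\<close> into
      \<open>Suc i\<close>, the lower end of the i-th cell.\<close>
    have "(\<Sum>j<N. d N * kap (u * \<rho> N ^ (N - j))) = (\<Sum>j<N. d N * kap (v N (Suc (N - Suc j))))"
      by (intro sum.cong) (auto simp: v_def Suc_diff_Suc simp del: power_Suc)
    also have "\<dots> = (\<Sum>i<N. d N * kap (v N (Suc i)))" by (rule sum.nat_diff_reindex)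
    also have "\<dots> = (\<Sum>i<N. Q N i)"
    proof (intro sum.cong refl)
      fix i
      show "d N * kap (v N (Suc i)) = Q N i"
        unfolding Q_def v_step q_def using v_pos[of N "Suc i"] beta by (simp add: field_simps)
    qed
    finally show ?thesis .
  qed
  have diff: "(\<lambda>N. (\<Sum>i<N. Q N i) - (phi u - phi (v N N))) \<longlonglongrightarrow> 0"
  proof (rule LIMSEQ_I)
    fix e :: real assume e: "e > 0"
    \<comment> \<open>Each cell contributes an error of at most \<open>e'\<close> times its length,
      and the lengths add up to less than \<open>u\<close>; the factor 2 makes the final inequality
      strict.\<close>
    define e' where "e' = e / (2 * u)"
    have e': "e' > 0" using e u by (simp add: e'_def)
    obtain \<eta> where \<eta>: "\<eta> > 0" "\<And>a b. a \<in> {u0..u} \<Longrightarrow> b \<in> {u0..u} \<Longrightarrow> \<bar>b - a\<bar> < \<eta> \<Longrightarrow> \<bar>q b - q a\<bar> < e'"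
      using uc e' unfolding uniformly_continuous_on_def dist_real_def by meson
    have "(\<lambda>N. u * (\<beta> * d N)) \<longlonglongrightarrow> u * (\<beta> * 0)" unfolding d_def by (intro tendsto_intros lim_const_over_n)
    then have "eventually (\<lambda>N. u * (\<beta> * d N) < \<eta>) sequentially" using \<eta> by (auto intro: order_tendstoD)
    then obtain n0 where n0: "\<And>N. N \<ge> n0 \<Longrightarrow> u * (\<beta> * d N) < \<eta>" unfolding eventually_sequentially by auto
    have "norm ((\<Sum>i<N. Q N i) - (phi u - phi (v N N)) - 0) < e" if N: "N \<ge> n0" for N
    proof -
      have tel: "phi u - phi (v N N) = (\<Sum>i<N. phi (v N i) - phi (v N (Suc i)))"
        using sum_lessThan_telescope'[of "\<lambda>i. phi (v N i)" N] by (simp add: v_def)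
      have "norm ((\<Sum>i<N. Q N i) - (phi u - phi (v N N))) \<le>
          (\<Sum>i<N. norm (Q N i - (phi (v N i) - phi (v N (Suc i)))))"
        unfolding tel sum_subtractf[symmetric] by (rule norm_sum)
      also have "\<dots> \<le> (\<Sum>i<N. (v N i - v N (Suc i)) * e')"
      proof (rule sum_mono)
        fix i assume "i \<in> {..<N}"
        then have i: "i < N" by simp
        show "norm (Q N i - (phi (v N i) - phi (v N (Suc i)))) \<le> (v N i - v N (Suc i)) * e'"
        proof (cases "v N (Suc i) < v N i")
          case False
          moreover have "0 \<le> v N (Suc i) * (\<beta> * d N)" using v_pos[of N "Suc i"] beta d[of N] by simp
          ultimately have "v N (Suc i) = v N i" using v_step[of N i] by linarith
          then show ?thesis by (simp add: Q_def)
        next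
          case True
          obtain \<xi> where \<xi>: "v N (Suc i) < \<xi>" "\<xi> < v N i" "phi (v N i) - phi (v N (Suc i)) = (v N i - v N (Suc i)) * q \<xi>"
            using MVT2[OF True, of phi q] phi_deriv v_pos[of N "Suc i"] v_K v_le[of N i]
            unfolding q_def by (metis (no_types, lifting) order_less_le_trans order_trans)
          have "\<bar>\<xi> - v N (Suc i)\<bar> < \<eta>"
          proof -
            have "\<xi> - v N (Suc i) < v N (Suc i) * (\<beta> * d N)" using \<xi> v_step[of N i] by simp
            also have "\<dots> \<le> u * (\<beta> * d N)" using v_le beta d by (intro mult_right_mono) auto
            finally show ?thesis using n0[OF N] \<xi> by simp
          qed
          then have "\<bar>q \<xi> - q (v N (Suc i))\<bar> < e'"
            using \<xi> v_ge[of "Suc i" N] v_le[of N i] i by (intro \<eta>) auto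
          then have "\<bar>q (v N (Suc i)) - q \<xi>\<bar> \<le> e'" by simp
          then show ?thesis unfolding \<xi>(3) Q_def right_diff_distrib[symmetric] using True by (simp add: abs_mult mult_left_mono)
        qed
      qed
      also have "\<dots> = (u - v N N) * e'"
        using sum_lessThan_telescope'[of "v N" N] by (simp add: sum_distrib_right[symmetric] v_def)
      also have "\<dots> \<le> u * e'" using e' v_pos[of N N] by (intro mult_right_mono) auto
      also have "\<dots> < e" using e u by (simp add: e'_def)
      finally show ?thesis by simp
    qed
    then show "\<exists>n0. \<forall>N\<ge>n0. norm ((\<Sum>i<N. Q N i) - (phi u - phi (v N N)) - 0) < e" by blast
  qed
  have "(\<lambda>N. v N N) \<longlonglongrightarrow> u0"
    unfolding v_def u0_def \<rho>_def d_def by (intro tendsto_mult tendsto_const implicit_euler_factor_tendsto)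
  moreover have "isCont phi u0" using u0 v_K[of u0] by (intro DERIV_isCont[OF phi_deriv]) auto
  ultimately have "(\<lambda>N. phi (v N N)) \<longlonglongrightarrow> phi u0" by (rule isCont_tendsto_compose[rotated])
  from tendsto_add[OF diff tendsto_diff[OF tendsto_const[of "phi u"] this]]
  have "(\<lambda>N. \<Sum>j<N. d N * kap (u * \<rho> N ^ (N - j))) \<longlonglongrightarrow> phi u - phi u0" by (simp add: sum_eq)
  then show ?thesis unfolding d_def \<rho>_def u0_def .
qed

end

subsection \<open>The dyadic skeleton\<close>

lemma sum_shift: "(\<Sum>i\<in>{a..<a + b}. f (a + b - i) (i::nat)) = (\<Sum>j<b. f (b - j) (a + j) :: real)"
  by (simp add: sum.atLeastLessThan_shift_0[of _ a] atLeast0LessThan)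

locale ou_process = ou_exponent M L \<beta> for M :: "'a measure" and L and \<beta> +
  fixes X :: "real \<Rightarrow> 'a \<Rightarrow> real" and x :: real
  assumes OU: "AE \<omega> in M. \<forall>t\<ge>0. set_integrable lborel {0..t} (\<lambda>s. X s \<omega>) \<and>
               X t \<omega> = x - \<beta> * (LINT s:{0..t}|lborel. X s \<omega>) + L t \<omega>"
begin

lemma good_paths: "AE \<omega> in M. ou_path (\<lambda>t. X t \<omega>) (\<lambda>t. L t \<omega>) \<beta> x"
  using OU L_cadlag L_zero
proof eventually_elim
  case (elim \<omega>)
  then show ?case using beta by unfold_locales (auto simp: continuous_within)
qed

abbreviation decay :: "nat \<Rightarrow> real" where "decay n \<equiv> exp (- \<beta> / 2^n)"

text \<open>Level-p approximation of the integral of \<open>exp (- \<beta> * (t' - s))\<close>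
  against \<open>L\<close>, over the interval from \<open>k / 2^n\<close> to
  \<open>t' = (k + 1) / 2^n\<close>. As a finite combination of increments it has explicit
  measurability and exponential moments.\<close>

definition euler :: "nat \<Rightarrow> nat \<Rightarrow> nat \<Rightarrow> 'a \<Rightarrow> real" where
  "euler n k p \<omega> = (\<Sum>i\<in>{k * 2^p..<k * 2^p + 2^p}. (1 / (1 + \<beta> * (1 / 2^(n + p))))^(k * 2^p + 2^p - i) * inc (1 / 2^(n + p)) i \<omega>)"

text \<open>Taken as a limit of Euler sums rather than as an expression in \<open>X\<close>, so that
  it is measurable for the future of \<open>k / 2^n\<close> without adding null sets. Its link with
  \<open>X\<close> holds almost surely, by \<open>noise_eq\<close>.\<close>

definition noise :: "nat \<Rightarrow> nat \<Rightarrow> 'a \<Rightarrow> real" where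
  "noise n k \<omega> = lim (\<lambda>p. euler n k p \<omega>)"

lemma euler_tendsto:
  assumes "ou_path (\<lambda>t. X t \<omega>) (\<lambda>t. L t \<omega>) \<beta> x"
  shows "(\<lambda>p. euler n k p \<omega>) \<longlonglongrightarrow> X (real (Suc k) / 2^n) \<omega> - decay n * X (real k / 2^n) \<omega>"
proof -
  interpret P: ou_path "\<lambda>t. X t \<omega>" "\<lambda>t. L t \<omega>" \<beta> x by fact
  let ?f = "\<lambda>N. \<Sum>j<N. (1 / (1 + \<beta> * (1 / 2^n / real N)))^(N - j) *
     (L (real k / 2^n + real (Suc j) * (1 / 2^n / real N)) \<omega> - L (real k / 2^n + real j * (1 / 2^n / real N)) \<omega>)"
  have "?f \<longlonglongrightarrow> X (real k / 2^n + 1 / 2^n) \<omega> - exp (- \<beta> * (1 / 2^n)) * X (real k / 2^n) \<omega>"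
    by (rule P.euler_limit) auto
  from LIMSEQ_subseq_LIMSEQ[OF this, of "\<lambda>p. 2^p"]
  have "(\<lambda>p. ?f (2^p)) \<longlonglongrightarrow> X (real k / 2^n + 1 / 2^n) \<omega> - exp (- \<beta> * (1 / 2^n)) * X (real k / 2^n) \<omega>"
    by (simp add: comp_def strict_mono_def)
  moreover have "?f (2^p) = euler n k p \<omega>" for p
    unfolding euler_def sum_shift[of "\<lambda>e i. (1 / (1 + \<beta> * (1 / 2^(n + p))))^e * inc (1 / 2^(n + p)) i \<omega>"]
  proof (intro sum.cong refl)
    fix j
    have "real k / 2^n + real (Suc j) * (1 / 2^n / real (2^p)) = real (Suc (k * 2^p + j)) * (1 / 2^(n + p))"
      "real k / 2^n + real j * (1 / 2^n / real (2^p)) = real (k * 2^p + j) * (1 / 2^(n + p))"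
      by (auto simp: field_simps power_add)
    moreover have "1 / 2^n / real (2^p) = 1 / 2^(n + p)" by (simp add: power_add)
    ultimately show "(1 / (1 + \<beta> * (1 / 2^n / real (2^p))))^(2^p - j) *
       (L (real k / 2^n + real (Suc j) * (1 / 2^n / real (2^p))) \<omega> - L (real k / 2^n + real j * (1 / 2^n / real (2^p))) \<omega>)
       = (1 / (1 + \<beta> * (1 / 2^(n + p))))^(2^p - j) * inc (1 / 2^(n + p)) (k * 2^p + j) \<omega>"
      unfolding inc_def by simp
  qed
  moreover have "real k / 2^n + 1 / 2^n = real (Suc k) / 2^n" by (simp add: field_simps)
  ultimately show ?thesis by simp
qed

lemma noise_eq:
  "AE \<omega> in M. noise n k \<omega> = X (real (Suc k) / 2^n) \<omega> - decay n * X (real k / 2^n) \<omega>"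
  using good_paths by eventually_elim (simp add: noise_def limI[OF euler_tendsto])

lemma euler_tendsto_noise: "AE \<omega> in M. (\<lambda>p. euler n k p \<omega>) \<longlonglongrightarrow> noise n k \<omega>"
  using good_paths noise_eq[of n k]
proof eventually_elim
  case (elim \<omega>)
  then show ?case using euler_tendsto[of \<omega> n k] by (simp only:)
qed

lemma noise_future: "noise n k \<in> borel_measurable (future (real k / 2^n))"
proof -
  have "euler n k p \<in> borel_measurable (future (real k / 2^n))" for p
    unfolding euler_def[abs_def]
  proof (intro borel_measurable_sum borel_measurable_times borel_measurable_const inc_future)
    fix i assume "i \<in> {k * 2^p..<k * 2^p + 2^p}"
    then have "real (k * 2^p) \<le> real i" by (simp del: of_nat_mult of_nat_power)
    then show "real k / 2^n \<le> real i / 2^(n + p)" by (simp add: field_simps power_add)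
  qed
  then show ?thesis unfolding noise_def[abs_def] by (rule borel_measurable_lim_metric)
qed

lemma noise_past: assumes "k < m" shows "noise n k \<in> borel_measurable (past (real m / 2^n))"
proof -
  have "euler n k p \<in> borel_measurable (past (real m / 2^n))" for p
    unfolding euler_def[abs_def]
  proof (intro borel_measurable_sum borel_measurable_times borel_measurable_const inc_past)
    fix i assume "i \<in> {k * 2^p..<k * 2^p + 2^p}"
    then have "Suc i \<le> Suc k * 2^p" by simp
    also have "\<dots> \<le> m * 2^p" using assms by (intro mult_right_mono) auto
    finally have "real (Suc i) \<le> real (m * 2^p)" by (simp only: of_nat_le_iff)
    then have "real (Suc i) / 2^(n + p) \<le> real (m * 2^p) / 2^(n + p)" by (intro divide_right_mono) auto
    then show "real (Suc i) / 2^(n + p) \<le> real m / 2^n" by (simp add: power_add)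
  qed
  then show ?thesis unfolding noise_def[abs_def] by (rule borel_measurable_lim_metric)
qed

lemma nn_integral_exp_euler:
  assumes u: "0 \<le> u" "ereal u < K"
  shows "(\<integral>\<^sup>+\<omega>. ennreal (exp (u * euler n k p \<omega>)) \<partial>M) =
    ennreal (exp (\<Sum>j<2^p. (1 / 2^n / real (2^p)) * kap (u * (1 / (1 + \<beta> * (1 / 2^n / real (2^p))))^(2^p - j))))"
proof -
  define d :: real where "d = 1 / 2^(n + p)"
  define \<rho> where "\<rho> = 1 / (1 + \<beta> * d)"
  define c where "c i = u * \<rho> ^ (k * 2^p + 2^p - i)" for i
  let ?I = "{k * 2^p..<k * 2^p + (2::nat)^p}"
  have \<rho>: "0 < \<rho>" "\<rho> \<le> 1" using beta by (auto simp: \<rho>_def d_def add_pos_pos)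
  have c: "0 \<le> c i" "ereal (c i) < K" for i
  proof -
    show "0 \<le> c i" using \<rho> u by (simp add: c_def)
    have "c i \<le> u" using \<rho> u by (simp add: c_def mult_left_le power_le_one)
    then show "ereal (c i) < K" by (rule below_K[OF u(2)])
  qed
  have "(\<integral>\<^sup>+\<omega>. ennreal (exp (u * euler n k p \<omega>)) \<partial>M) = (\<integral>\<^sup>+\<omega>. (\<Prod>i\<in>?I. ennreal (exp (c i * inc (1 / 2^(n + p)) i \<omega>))) \<partial>M)"
    unfolding euler_def c_def \<rho>_def d_def by (simp add: prod_ennreal exp_sum[symmetric] sum_distrib_left mult.assoc)
  also have "\<dots> = (\<Prod>i\<in>?I. (\<integral>\<^sup>+\<omega>. ennreal (exp (c i * inc (1 / 2^(n + p)) i \<omega>)) \<partial>M))"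
  proof (rule indep_vars_nn_integral)
    show "indep_vars (\<lambda>_. borel) (\<lambda>i \<omega>. ennreal (exp (c i * inc (1 / 2^(n + p)) i \<omega>))) ?I"
      using indep_vars_compose2[OF indep_vars_subset[OF indep_inc[of "1 / 2^(n + p)"], of ?I], of "\<lambda>i y. ennreal (exp (c i * y))" "\<lambda>_. borel"] by simp
  qed auto
  also have "\<dots> = (\<Prod>i\<in>?I. ennreal (exp (d * kap (c i))))"
    using nn_integral_exp_inc[OF c] by (simp add: d_def)
  also have "\<dots> = ennreal (exp (\<Sum>i\<in>?I. d * kap (c i)))" by (simp add: prod_ennreal exp_sum)
  also have "(\<Sum>i\<in>?I. d * kap (c i)) = (\<Sum>j<2^p. d * kap (u * \<rho> ^ (2^p - j)))"
    unfolding c_def sum_shift[of "\<lambda>e i. d * kap (u * \<rho> ^ e)"] ..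
  also have "d = 1 / 2^n / real (2^p)" by (simp add: d_def power_add)
  finally show ?thesis by (simp add: \<rho>_def d_def power_add)
qed

text \<open>The exponential moments of the Euler sums converge by \<open>riemann_sum_phi\<close>;
  what remains is to carry the limit through the expectation.\<close>

lemma nn_integral_exp_noise:
  assumes u: "0 < u" "ereal u < K"
  shows "(\<integral>\<^sup>+\<omega>. ennreal (exp (u * noise n k \<omega>)) \<partial>M) = ennreal (exp (phi u - phi (u * decay n)))"
proof -
  define S where "S u p = (\<Sum>j<2^p. (1 / 2^n / real (2^p)) * kap (u * (1 / (1 + \<beta> * (1 / 2^n / real (2^p))))^(2^p - j)))" for u p
  have S: "S u \<longlonglongrightarrow> phi u - phi (u * decay n)" if "0 < u" "ereal u < K" for u
    using LIMSEQ_subseq_LIMSEQ[OF riemann_sum_phi[OF that, of "1 / 2^n"], of "\<lambda>p. 2^p"]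
    unfolding S_def by (simp add: comp_def strict_mono_def)
  \<comment> \<open>A larger admissible exponent supplies uniform integrability: its moments along
    the Euler sums converge, hence are bounded.\<close>
  obtain u' where u': "u < u'" "ereal u' < K" using exists_between_K[OF u(2)] .
  have "(\<lambda>p. exp (S u' p)) \<longlonglongrightarrow> exp (phi u' - phi (u' * decay n))"
    using u u' by (intro tendsto_intros S) auto
  then obtain B where B: "\<And>p. exp (S u' p) \<le> B"
    using convergent_imp_Bseq[of "\<lambda>p. exp (S u' p)"] unfolding Bseq_def convergent_def by auto
  have [measurable]: "euler n k p \<in> borel_measurable M" for p
    unfolding euler_def[abs_def] by measurable
  have "(\<lambda>p. \<integral>\<^sup>+\<omega>. ennreal (exp (u * euler n k p \<omega>)) \<partial>M) \<longlonglongrightarrow> (\<integral>\<^sup>+\<omega>. ennreal (exp (u * noise n k \<omega>)) \<partial>M)"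
  proof (rule nn_integral_tendsto_dominated_by_bounded[where Z="\<lambda>p \<omega>. ennreal (exp (u' * euler n k p \<omega>))"])
    show "AE \<omega> in M. (\<lambda>p. ennreal (exp (u * euler n k p \<omega>))) \<longlonglongrightarrow> ennreal (exp (u * noise n k \<omega>))"
      using euler_tendsto_noise by eventually_elim (intro tendsto_ennrealI tendsto_intros)
    show "(\<integral>\<^sup>+\<omega>. ennreal (exp (u' * euler n k p \<omega>)) \<partial>M) \<le> ennreal B" for p
      using u u' B[of p] by (subst nn_integral_exp_euler) (auto simp: S_def intro: ennreal_leI)
    fix e :: real assume e: "e > 0"
    then obtain C where C: "C \<ge> 0" "\<And>s. exp (u * s) \<le> C + e * exp (u' * s)"
      using exp_dominated[of u u' e] u u' by auto
    have "ennreal (exp (u * s)) \<le> ennreal C + ennreal e * ennreal (exp (u' * s))" for s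
      using ennreal_leI[OF C(2)[of s]] C(1) e by (simp add: ennreal_mult)
    then show "\<exists>C. \<forall>n'. AE \<omega> in M. ennreal (exp (u * euler n k n' \<omega>)) \<le> ennreal C + ennreal e * ennreal (exp (u' * euler n k n' \<omega>))"
      by blast
  qed auto
  moreover have "(\<lambda>p. \<integral>\<^sup>+\<omega>. ennreal (exp (u * euler n k p \<omega>)) \<partial>M) \<longlonglongrightarrow> ennreal (exp (phi u - phi (u * decay n)))"
  proof -
    have "(\<integral>\<^sup>+\<omega>. ennreal (exp (u * euler n k p \<omega>)) \<partial>M) = ennreal (exp (S u p))" for p
      unfolding S_def using u by (intro nn_integral_exp_euler) auto
    moreover have "(\<lambda>p. ennreal (exp (S u p))) \<longlonglongrightarrow> ennreal (exp (phi u - phi (u * decay n)))"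
      using S[OF u] by (intro tendsto_ennrealI tendsto_intros)
    ultimately show ?thesis by simp
  qed
  ultimately show ?thesis by (rule LIMSEQ_unique)
qed

text \<open>A version of the skeleton of \<open>X\<close> that is measurable with respect to the uncompleted past.\<close>

fun grid :: "nat \<Rightarrow> nat \<Rightarrow> 'a \<Rightarrow> real" where
  "grid n 0 \<omega> = x"
| "grid n (Suc k) \<omega> = decay n * grid n k \<omega> + noise n k \<omega>"

lemma X_grid: "AE \<omega> in M. \<forall>k. X (real k / 2^n) \<omega> = grid n k \<omega>"
proof -
  have "AE \<omega> in M. \<forall>k. noise n k \<omega> = X (real (Suc k) / 2^n) \<omega> - decay n * X (real k / 2^n) \<omega>"
    by (subst AE_all_countable) (use noise_eq in blast)
  with good_paths show ?thesis
  proof eventually_elim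
    case (elim \<omega>)
    interpret P: ou_path "\<lambda>t. X t \<omega>" "\<lambda>t. L t \<omega>" \<beta> x by fact
    show ?case
    proof
      fix k show "X (real k / 2^n) \<omega> = grid n k \<omega>"
        by (induction k) (use P.f0 elim in \<open>auto simp del: of_nat_Suc\<close>)
    qed
  qed
qed

lemma grid_past: "j \<le> k \<Longrightarrow> grid n j \<in> borel_measurable (past (real k / 2^n))"
proof (induction j)
  case (Suc j)
  have "grid n (Suc j) = (\<lambda>\<omega>. decay n * grid n j \<omega> + noise n j \<omega>)" by (rule ext) simp
  moreover have "(\<lambda>\<omega>. decay n * grid n j \<omega> + noise n j \<omega>) \<in> borel_measurable (past (real k / 2^n))"
    using Suc noise_past[of j k n] by (intro borel_measurable_add borel_measurable_times borel_measurable_const) auto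
  ultimately show ?case by (simp only:)
next
  case 0
  have "grid n 0 = (\<lambda>_. x)" by (rule ext) simp
  then show ?case by simp
qed

lemma grid_measurable [measurable]: "grid n k \<in> borel_measurable M"
  by (rule past_measurable_M[OF grid_past[OF order_refl]])

text \<open>\<open>grid n (Suc k)\<close> is \<open>decay n * grid n k\<close> plus a noise from the
  future, which is independent of \<open>W\<close> and \<open>grid n k\<close>. Letting
  \<open>W\<close> range over the past makes this the Markov property in integrated form.\<close>

lemma markov_exp:
  assumes u: "0 < u" "ereal u < K" and W: "W \<in> borel_measurable (past (real k / 2^n))"
  shows "(\<integral>\<^sup>+\<omega>. W \<omega> * ennreal (exp (u * grid n (Suc k) \<omega>)) \<partial>M) =
    ennreal (exp (phi u - phi (u * decay n))) * (\<integral>\<^sup>+\<omega>. W \<omega> * ennreal (exp (u * decay n * grid n k \<omega>)) \<partial>M)"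
proof -
  let ?r = "decay n"
  have "(\<integral>\<^sup>+\<omega>. W \<omega> * ennreal (exp (u * grid n (Suc k) \<omega>)) \<partial>M) =
    (\<integral>\<^sup>+\<omega>. (W \<omega> * ennreal (exp (u * ?r * grid n k \<omega>))) * ennreal (exp (u * noise n k \<omega>)) \<partial>M)"
    by (intro nn_integral_cong) (simp add: mult.assoc ennreal_mult[symmetric] exp_add[symmetric] distrib_left)
  also have "\<dots> = (\<integral>\<^sup>+\<omega>. W \<omega> * ennreal (exp (u * ?r * grid n k \<omega>)) \<partial>M) * (\<integral>\<^sup>+\<omega>. ennreal (exp (u * noise n k \<omega>)) \<partial>M)"
  proof -
    note [measurable] = grid_past[OF order_refl, of n k] noise_future[of n k] W
    show ?thesis by (intro nn_integral_past_future) measurable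
  qed
  finally show ?thesis by (simp add: nn_integral_exp_noise[OF u] mult.commute)
qed

end

subsection \<open>The function \<open>G\<close> cut off below \<open>K\<close>\<close>

locale ou_passage = ou_process M L \<beta> X x for M :: "'a measure" and L \<beta> X x +
  fixes \<mu> :: real
  assumes mu: "\<mu> > 0"
    and unb: "\<And>c. prob {\<omega>\<in>space M. c \<le> L 1 \<omega>} > 0"
begin

declare grid.simps [simp del]

definition weight :: "real \<Rightarrow> real \<Rightarrow> real" where
  "weight a u = indicator {0<..<a} u * (exp (- phi u) * u powr (\<mu> - 1))"

definition G :: "real \<Rightarrow> real \<Rightarrow> ennreal" where
  "G a z = (\<integral>\<^sup>+u. ennreal (exp (u * z) * weight a u) \<partial>lborel)"

lemma weight_nonneg [simp]: "0 \<le> weight a u" by (simp add: weight_def)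

lemma weight_pos_iff: "weight a u = 0 \<longleftrightarrow> u \<notin> {0<..<a}" by (auto simp: weight_def indicator_def)

lemma weight_measurable:
  assumes "ereal a < K" shows "weight a \<in> borel_measurable borel"
proof -
  have "continuous_on {0<..<a} (\<lambda>u. exp (- phi u) * u powr (\<mu> - 1))"
  proof (intro continuous_intros continuous_on_subset[OF continuous_phi])
    show "{0<..<a} \<subseteq> {u. 0 < u \<and> ereal u < K}" using assms by (auto intro: below_K)
  qed auto
  from borel_measurable_continuous_on_indicator[OF _ this] show ?thesis
    unfolding weight_def[abs_def] by simp
qed

lemma G_measurable:
  assumes "ereal a < K" shows "G a \<in> borel_measurable borel"
proof -
  note [measurable] = weight_measurable[OF assms]
  show ?thesis unfolding G_def[abs_def] by measurable
qed

lemma G_mono: "z \<le> z' \<Longrightarrow> G a z \<le> G a z'"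
  unfolding G_def
proof (intro nn_integral_mono ennreal_leI)
  fix u assume "z \<le> z'"
  then show "exp (u * z) * weight a u \<le> exp (u * z') * weight a u"
    by (cases "u \<in> {0<..<a}") (auto simp: weight_pos_iff[THEN iffD2] intro!: mult_right_mono mult_left_mono)
qed

text \<open>Below \<open>a < K\<close> the function \<open>phi\<close> is bounded, so the integrand
  is at most a constant times \<open>u powr (\<mu> - 1)\<close>, which is integrable at 0 because
  \<open>\<mu> > 0\<close>.\<close>

lemma G_finite:
  assumes a: "ereal a < K" shows "G a z < \<infinity>"
proof (cases "a > 0")
  case False
  then have "weight a u = 0" for u by (simp add: weight_pos_iff)
  then show ?thesis by (simp add: G_def)
next
  case True
  obtain B where B: "\<And>u. u \<le> a \<Longrightarrow> \<bar>phi u\<bar> \<le> B" using phi_bounded[OF a] by blast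
  have "G a z \<le> (\<integral>\<^sup>+u. ennreal (exp (a * \<bar>z\<bar> + B)) * (ennreal (u powr (\<mu> - 1)) * indicator {0..a} u) \<partial>lborel)"
    unfolding G_def
  proof (rule nn_integral_mono)
    fix u :: real
    show "ennreal (exp (u * z) * weight a u) \<le> ennreal (exp (a * \<bar>z\<bar> + B)) * (ennreal (u powr (\<mu> - 1)) * indicator {0..a} u)"
    proof (cases "u \<in> {0<..<a}")
      case True
      have "u * z \<le> u * \<bar>z\<bar>" using True by (intro mult_left_mono) auto
      also have "\<dots> \<le> a * \<bar>z\<bar>" using True by (intro mult_right_mono) auto
      finally have "u * z - phi u \<le> a * \<bar>z\<bar> + B" using B[of u] True by auto
      then have "exp (u * z) * exp (- phi u) \<le> exp (a * \<bar>z\<bar> + B)" by (simp flip: exp_add)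
      then have "exp (u * z) * exp (- phi u) * u powr (\<mu> - 1) \<le> exp (a * \<bar>z\<bar> + B) * u powr (\<mu> - 1)"
        by (intro mult_right_mono) auto
      then show ?thesis using True by (simp add: weight_def ennreal_mult[symmetric] mult.assoc ennreal_leI)
    next
      case False
      then have "weight a u = 0" by (simp add: weight_pos_iff)
      then show ?thesis by simp
    qed
  qed
  also have "\<dots> = ennreal (exp (a * \<bar>z\<bar> + B)) * (\<integral>\<^sup>+u. ennreal (u powr (\<mu> - 1)) * indicator {0..a} u \<partial>lborel)"
    by (rule nn_integral_cmult) measurable
  also have "(\<integral>\<^sup>+u. ennreal (u powr (\<mu> - 1)) * indicator {0..a} u \<partial>lborel) = ennreal (a powr (\<mu> - 1 + 1) / (\<mu> - 1 + 1))"
    using True mu by (intro nn_integral_has_integral_lebesgue' has_integral_powr_from_0) auto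
  also have "ennreal (exp (a * \<bar>z\<bar> + B)) * ennreal (a powr (\<mu> - 1 + 1) / (\<mu> - 1 + 1)) < \<infinity>"
    by (simp add: ennreal_mult_less_top)
  finally show ?thesis .
qed

lemma G_tendsto:
  assumes a: "ereal a < K" and z: "z \<longlonglongrightarrow> y"
  shows "(\<lambda>n. G a (z n)) \<longlonglongrightarrow> G a y"
proof -
  note [measurable] = weight_measurable[OF a]
  obtain B where B: "\<And>n. \<bar>z n\<bar> \<le> B" using convergent_imp_Bseq[of z] z unfolding Bseq_def convergent_def by auto
  show ?thesis unfolding G_def
  proof (rule nn_integral_dominated_convergence[where w="\<lambda>u. ennreal (exp (u * B) * weight a u)"])
    show "AE u in lborel. ennreal (exp (u * z n) * weight a u) \<le> ennreal (exp (u * B) * weight a u)" for n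
      using B[of n] by (intro AE_I2 ennreal_leI) (auto simp: weight_def indicator_def abs_le_iff)
    show "(\<integral>\<^sup>+u. ennreal (exp (u * B) * weight a u) \<partial>lborel) < \<infinity>"
      using G_finite[OF a, of B] by (simp add: G_def)
    show "AE u in lborel. (\<lambda>n. ennreal (exp (u * z n) * weight a u)) \<longlonglongrightarrow> ennreal (exp (u * y) * weight a u)"
      by (intro AE_I2 tendsto_ennrealI tendsto_intros z)
  qed measurable
qed

text \<open>For \<open>z \<ge> 0\<close>, \<open>G a z\<close> is at most \<open>exp (a * z)\<close>
  times \<open>G a 0\<close>, while \<open>G a' z\<close> is at least \<open>exp (s * z)\<close>
  times the mass of the weight on \<open>(s, a')\<close>, for \<open>s\<close> strictly between
  \<open>a\<close> and \<open>a'\<close>. For \<open>z < 0\<close> the constant \<open>G a 0\<close>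
  is enough.\<close>

lemma G_dominated:
  assumes a: "0 \<le> a" "a < a'" "ereal a' < K" and e: "e > 0"
  shows "\<exists>C. \<forall>z. G a z \<le> ennreal C + ennreal e * G a' z"
proof -
  have aK: "ereal a < K" using a by (intro below_K[OF a(3)]) simp
  note [measurable] = weight_measurable[OF aK] weight_measurable[OF a(3)]
  define s where "s = (a + a') / 2"
  have s: "a < s" "s < a'" using a by (auto simp: s_def)
  define I where "I = (\<integral>\<^sup>+u. ennreal (weight a' u) * indicator {s<..<a'} u \<partial>lborel)"
  have "I \<noteq> 0"
  proof
    assume "I = 0"
    then have "AE u in lborel. ennreal (weight a' u) * indicator {s<..<a'} u = 0"
      unfolding I_def by (subst (asm) nn_integral_0_iff_AE) auto
    then have "AE u in lborel. u \<notin> {s<..<a'}"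
      by eventually_elim (use s a in \<open>auto simp: ennreal_eq_0_iff weight_pos_iff split: split_indicator_asm dest!: antisym[OF _ weight_nonneg]\<close>)
    then have "emeasure lborel {s<..<a'} = 0"
      by (subst (asm) AE_iff_measurable[of "{s<..<a'}"]) auto
    then show False using s by simp
  qed
  moreover have "I \<le> G a' 0"
    unfolding I_def G_def by (intro nn_integral_mono) (auto split: split_indicator)
  then have "I < \<infinity>" using G_finite[OF a(3), of 0] by auto
  ultimately obtain i where i: "I = ennreal i" "i > 0"
    by (cases I) (auto simp: ennreal_eq_0_iff)
  obtain g where g: "G a 0 = ennreal g" "g \<ge> 0" using G_finite[OF aK, of 0] by (cases "G a 0") auto
  \<comment> \<open>Chosen so that \<open>g * e' \<le> e * i\<close>; the added 1 covers
    \<open>g = 0\<close>, which occurs for \<open>a = 0\<close>.\<close>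
  define e' where "e' = e * i / (g + 1)"
  have e': "e' > 0" using e i g by (simp add: e'_def)
  have "g * (e * i) \<le> (g + 1) * (e * i)" using e i by (intro mult_right_mono) auto
  then have ge': "g * e' \<le> e * i" using g by (simp add: e'_def field_simps)
  obtain C where C: "C \<ge> 0" "\<And>z. exp (a * z) \<le> C + e' * exp (s * z)"
    using exp_dominated[OF s(1) a(1) e'] by auto
  have low: "ennreal (exp (s * z) * i) \<le> G a' z" if "z \<ge> 0" for z
  proof -
    have "ennreal (exp (s * z) * i) = (\<integral>\<^sup>+u. ennreal (exp (s * z)) * (ennreal (weight a' u) * indicator {s<..<a'} u) \<partial>lborel)"
      using i by (simp add: ennreal_mult nn_integral_cmult flip: I_def)
    also have "\<dots> \<le> G a' z" unfolding G_def
    proof (rule nn_integral_mono)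
      fix u
      show "ennreal (exp (s * z)) * (ennreal (weight a' u) * indicator {s<..<a'} u) \<le> ennreal (exp (u * z) * weight a' u)"
        using that by (auto simp: ennreal_mult[symmetric] split: split_indicator intro!: ennreal_leI mult_right_mono)
    qed
    finally show ?thesis .
  qed
  have up: "G a z \<le> ennreal (exp (a * z) * g)" if "z \<ge> 0" for z
  proof -
    have "G a z \<le> (\<integral>\<^sup>+u. ennreal (exp (a * z)) * ennreal (exp (u * 0) * weight a u) \<partial>lborel)"
      unfolding G_def
    proof (rule nn_integral_mono)
      fix u
      show "ennreal (exp (u * z) * weight a u) \<le> ennreal (exp (a * z)) * ennreal (exp (u * 0) * weight a u)"
        using that by (cases "u \<in> {0<..<a}")
          (auto simp: ennreal_mult[symmetric] weight_pos_iff[THEN iffD2] intro!: ennreal_leI mult_right_mono)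
    qed
    also have "\<dots> = ennreal (exp (a * z)) * G a 0" unfolding G_def by (rule nn_integral_cmult) measurable
    finally show ?thesis using g by (simp add: ennreal_mult)
  qed
  have "G a z \<le> ennreal (g * C + g) + ennreal e * G a' z" for z
  proof (cases "z \<ge> 0")
    case False
    then have "G a z \<le> G a 0" by (intro G_mono) auto
    also have "\<dots> \<le> ennreal (g * C + g)" using g C by (auto intro: ennreal_leI)
    finally show ?thesis by (simp add: add_increasing2)
  next
    case True
    have "exp (a * z) * g \<le> (C + e' * exp (s * z)) * g" using C(2) g by (intro mult_right_mono) auto
    also have "\<dots> = g * C + (g * e') * exp (s * z)" by (simp add: algebra_simps)
    also have "\<dots> \<le> (g * C + g) + (e * i) * exp (s * z)" using ge' g by (intro add_mono mult_right_mono) auto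
    finally have "G a z \<le> ennreal ((g * C + g) + e * (exp (s * z) * i))"
      using up[OF True] by (auto intro!: order_trans[OF up[OF True]] ennreal_leI simp: algebra_simps)
    also have "\<dots> = ennreal (g * C + g) + ennreal e * ennreal (exp (s * z) * i)"
      using g C e i by (simp add: ennreal_mult)
    also have "\<dots> \<le> ennreal (g * C + g) + ennreal e * G a' z"
      using low[OF True] by (intro add_left_mono mult_left_mono) auto
    finally show ?thesis .
  qed
  then show ?thesis by blast
qed

section \<open>The one-step balance for the cut-off function\<close>

definition tail :: "real \<Rightarrow> real \<Rightarrow> real \<Rightarrow> ennreal" where
  "tail a r z = (\<integral>\<^sup>+u. ennreal (exp (u * z) * weight a u) * indicator {a * r..} u \<partial>lborel)"

lemma tail_measurable:
  assumes "ereal a < K" shows "tail a r \<in> borel_measurable borel"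
proof -
  note [measurable] = weight_measurable[OF assms]
  show ?thesis unfolding tail_def[abs_def] by measurable
qed

lemma G_split:
  assumes "ereal a < K" "0 < a" "0 < r" "r \<le> 1"
  shows "G a z = G (a * r) z + tail a r z"
proof -
  note [measurable] = weight_measurable[OF assms(1)]
  have "a * r \<le> a" using assms by simp
  then have "G (a * r) z = (\<integral>\<^sup>+u. ennreal (exp (u * z) * weight a u) * indicator {..<a * r} u \<partial>lborel)"
    unfolding G_def by (intro nn_integral_cong) (auto simp: weight_def split: split_indicator)
  then have "G (a * r) z + tail a r z = (\<integral>\<^sup>+u. ennreal (exp (u * z) * weight a u) * indicator {..<a * r} u + ennreal (exp (u * z) * weight a u) * indicator {a * r..} u \<partial>lborel)"
    unfolding tail_def by (simp add: nn_integral_add)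
  also have "\<dots> = G a z" unfolding G_def by (intro nn_integral_cong) (auto split: split_indicator)
  finally show ?thesis ..
qed

text \<open>On the interval from \<open>a * r\<close> to \<open>a\<close> the integrand is at most
  \<open>e / (a * r)\<close>, and the interval has length \<open>a - a * r\<close>. For
  \<open>r = decay n\<close> the factor \<open>1 / r - 1\<close> is of order
  \<open>\<beta> / 2^n\<close>, so the loss is proportional to the time step.\<close>

lemma tail_le:
  assumes small: "\<And>w. a * r \<le> w \<Longrightarrow> w < a \<Longrightarrow> w powr \<mu> * exp (w * c - phi w) \<le> e"
    and a: "0 < a" and r: "0 < r" "r \<le> 1" and z: "z \<le> c" and e: "0 \<le> e"
  shows "tail a r z \<le> ennreal (e * (1 / r - 1))"
proof -
  have "tail a r z \<le> (\<integral>\<^sup>+u. ennreal (e / (a * r)) * indicator {a * r..a} u \<partial>lborel)"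
    unfolding tail_def
  proof (rule nn_integral_mono)
    fix u
    show "ennreal (exp (u * z) * weight a u) * indicator {a * r..} u \<le> ennreal (e / (a * r)) * indicator {a * r..a} u"
    proof (cases "a * r \<le> u \<and> u < a")
      case True
      have ar: "0 < a * r" using a r by simp
      then have u: "0 < u" using True by linarith
      have "exp (u * z) * weight a u = exp (u * z - phi u) * (u powr \<mu> / u)"
        using True u by (simp add: weight_def exp_diff exp_minus powr_diff field_simps)
      also have "\<dots> \<le> exp (u * c - phi u) * (u powr \<mu> / u)" using z u by (intro mult_right_mono) auto
      also have "\<dots> = (u powr \<mu> * exp (u * c - phi u)) / u" by simp
      also have "\<dots> \<le> e / u" using small[of u] True u by (intro divide_right_mono) auto
      also have "\<dots> \<le> e / (a * r)" using True ar e by (intro divide_left_mono) auto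
      finally show ?thesis using True by (simp add: ennreal_leI)
    next
      case False
      then show ?thesis by (auto simp: weight_def split: split_indicator)
    qed
  qed
  also have "\<dots> = ennreal (e / (a * r)) * ennreal (a - a * r)"
    using a r by (simp add: nn_integral_cmult)
  also have "\<dots> = ennreal (e * (1 / r - 1))"
  proof -
    have "e / (a * r) * (a - a * r) = e * (1 / r - 1)"
      using a r by (simp add: divide_simps) (simp add: algebra_simps)
    then show ?thesis using a r e by (simp add: ennreal_mult[symmetric])
  qed
  finally show ?thesis .
qed

lemma shifted_weight_measurable:
  assumes a: "ereal a < K" and r: "0 < r" "r \<le> 1"
  shows "(\<lambda>u. weight a u * exp (phi u - phi (u * r))) \<in> borel_measurable borel"
proof -
  have sub: "{0<..<a} \<subseteq> {u. 0 < u \<and> ereal u < K}" using below_K[OF a] by auto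
  have "continuous_on {0<..<a} (\<lambda>u. exp (- phi u) * u powr (\<mu> - 1) * exp (phi u - phi (u * r)))"
  proof (intro continuous_intros continuous_on_subset[OF continuous_phi] continuous_on_compose2[OF continuous_phi, of _ "\<lambda>u. u * r"])
    have "ereal (u * r) < K" if "0 < u" "u < a" for u
    proof -
      have "u * r \<le> a * 1" using that r by (intro mult_mono) auto
      then show ?thesis by (intro below_K[OF a]) simp
    qed
    then show "(\<lambda>u. u * r) ` {0<..<a} \<subseteq> {u. 0 < u \<and> ereal u < K}" using r by auto
  qed (use sub in auto)
  from borel_measurable_continuous_on_indicator[OF _ this] show ?thesis
    by (simp add: weight_def[abs_def] mult.assoc)
qed

text \<open>Substituting \<open>r * u\<close> yields a factor \<open>r\<close> from the measure and
  \<open>r powr (\<mu> - 1)\<close> from the power. The factor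
  \<open>exp (phi u - phi (u * r))\<close> is split off because it is exactly the one that
  \<open>markov_exp\<close> produces.\<close>

lemma G_scale:
  assumes a: "ereal a < K" "0 < a" and r: "0 < r" "r \<le> 1"
  shows "G (a * r) z = ennreal (r powr \<mu>) *
    (\<integral>\<^sup>+u. ennreal (weight a u * exp (phi u - phi (u * r))) * ennreal (exp (u * r * z)) \<partial>lborel)"
proof -
  have "a * r \<le> a" using a r by simp
  then have arK: "ereal (a * r) < K" by (rule below_K[OF a(1)])
  note [measurable] = weight_measurable[OF a(1)] weight_measurable[OF arK]
  have "G (a * r) z = ennreal \<bar>r\<bar> * (\<integral>\<^sup>+u. ennreal (exp ((0 + r * u) * z) * weight (a * r) (0 + r * u)) \<partial>lborel)"
    unfolding G_def using r by (intro nn_integral_real_affine) auto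
  also have "\<dots> = (\<integral>\<^sup>+u. ennreal r * ennreal (exp ((0 + r * u) * z) * weight (a * r) (0 + r * u)) \<partial>lborel)"
    using r by (simp add: nn_integral_cmult)
  also have "\<dots> = (\<integral>\<^sup>+u. ennreal (r powr \<mu>) * (ennreal (weight a u * exp (phi u - phi (u * r))) * ennreal (exp (u * r * z))) \<partial>lborel)"
  proof (rule nn_integral_cong)
    fix u :: real
    have ur: "0 + r * u = u * r" by simp
    have iff: "u * r \<in> {0<..<a * r} \<longleftrightarrow> u \<in> {0<..<a}" using r by (auto simp: zero_less_mult_iff)
    show "ennreal r * ennreal (exp ((0 + r * u) * z) * weight (a * r) (0 + r * u)) = ennreal (r powr \<mu>) * (ennreal (weight a u * exp (phi u - phi (u * r))) * ennreal (exp (u * r * z)))"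
      unfolding ur
    proof (cases "u \<in> {0<..<a}")
      case True
      have key: "r * (u * r) powr (\<mu> - 1) = r powr \<mu> * u powr (\<mu> - 1)"
        using r True by (simp add: powr_mult powr_diff)
      have 1: "weight (a * r) (u * r) = exp (- phi (u * r)) * (u * r) powr (\<mu> - 1)"
        using True iff by (simp add: weight_def)
      have 2: "weight a u * exp (phi u - phi (u * r)) = exp (- phi (u * r)) * u powr (\<mu> - 1)"
        using True by (simp add: weight_def flip: exp_add)
      have "r * (exp (u * r * z) * weight (a * r) (u * r)) = exp (u * r * z) * exp (- phi (u * r)) * (r * (u * r) powr (\<mu> - 1))"
        unfolding 1 by simp
      also have "\<dots> = r powr \<mu> * (weight a u * exp (phi u - phi (u * r)) * exp (u * r * z))"
        unfolding key 2 by simp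
      finally show "ennreal r * ennreal (exp (u * r * z) * weight (a * r) (u * r)) = ennreal (r powr \<mu>) * (ennreal (weight a u * exp (phi u - phi (u * r))) * ennreal (exp (u * r * z)))"
        using r by (simp add: ennreal_mult[symmetric])
    next
      case False
      then have "weight (a * r) (u * r) = 0" "weight a u = 0"
        using iff weight_pos_iff[of "a * r" "u * r"] weight_pos_iff[of a u] by auto
      then show "ennreal r * ennreal (exp (u * r * z) * weight (a * r) (u * r)) = ennreal (r powr \<mu>) * (ennreal (weight a u * exp (phi u - phi (u * r))) * ennreal (exp (u * r * z)))" by simp
    qed
  qed
  also have "\<dots> = ennreal (r powr \<mu>) * (\<integral>\<^sup>+u. ennreal (weight a u * exp (phi u - phi (u * r))) * ennreal (exp (u * r * z)) \<partial>lborel)"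
  proof (rule nn_integral_cmult)
    show "(\<lambda>u. ennreal (weight a u * exp (phi u - phi (u * r))) * ennreal (exp (u * r * z))) \<in> borel_measurable lborel"
      using shifted_weight_measurable[OF a(1) r] by measurable
  qed
  finally show ?thesis .
qed

text \<open>After exchanging the integral over \<open>u\<close> with the expectation,
  \<open>markov_exp\<close> integrates out the noise and \<open>G_scale\<close> recognises the
  result as \<open>G (a * r)\<close> at the present position; \<open>G_split\<close> then supplies
  the missing mass.\<close>

lemma G_step:
  fixes W :: "'a \<Rightarrow> ennreal" and n :: nat
  defines "r \<equiv> decay n"
  assumes a: "ereal a < K" "0 < a" and W: "W \<in> borel_measurable (past (real k / 2^n))"
  shows "(\<integral>\<^sup>+\<omega>. W \<omega> * G a (grid n k \<omega>) \<partial>M) =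
    ennreal (r powr \<mu>) * (\<integral>\<^sup>+\<omega>. W \<omega> * G a (grid n (Suc k) \<omega>) \<partial>M) + (\<integral>\<^sup>+\<omega>. W \<omega> * tail a r (grid n k \<omega>) \<partial>M)"
proof -
  have r: "0 < r" "r \<le> 1" using beta by (auto simp: r_def)
  have "a * r \<le> a" using a r by simp
  then have arK: "ereal (a * r) < K" by (rule below_K[OF a(1)])
  note [measurable] = weight_measurable[OF a(1)] G_measurable[OF a(1)] G_measurable[OF arK] tail_measurable[OF a(1)] past_measurable_M[OF W]
  define v where "v u = weight a u * exp (phi u - phi (u * r))" for u
  have v_meas [measurable]: "v \<in> borel_measurable borel"
    unfolding v_def by (rule shifted_weight_measurable[OF a(1) r])
  interpret P: pair_sigma_finite M lborel ..
  have "(\<integral>\<^sup>+\<omega>. W \<omega> * G a (grid n (Suc k) \<omega>) \<partial>M) = (\<integral>\<^sup>+\<omega>. (\<integral>\<^sup>+u. W \<omega> * ennreal (exp (u * grid n (Suc k) \<omega>) * weight a u) \<partial>lborel) \<partial>M)"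
    unfolding G_def by (intro nn_integral_cong nn_integral_cmult[symmetric]) measurable
  also have "\<dots> = (\<integral>\<^sup>+u. (\<integral>\<^sup>+\<omega>. W \<omega> * ennreal (exp (u * grid n (Suc k) \<omega>) * weight a u) \<partial>M) \<partial>lborel)"
    by (rule P.Fubini'[symmetric]) (simp add: split_beta', measurable)
  also have "\<dots> = (\<integral>\<^sup>+u. ennreal (weight a u) * (\<integral>\<^sup>+\<omega>. W \<omega> * ennreal (exp (u * grid n (Suc k) \<omega>)) \<partial>M) \<partial>lborel)"
  proof (rule nn_integral_cong)
    fix u
    have "(\<integral>\<^sup>+\<omega>. W \<omega> * ennreal (exp (u * grid n (Suc k) \<omega>) * weight a u) \<partial>M) = (\<integral>\<^sup>+\<omega>. ennreal (weight a u) * (W \<omega> * ennreal (exp (u * grid n (Suc k) \<omega>))) \<partial>M)"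
      by (intro nn_integral_cong) (simp add: ennreal_mult ac_simps)
    then show "(\<integral>\<^sup>+\<omega>. W \<omega> * ennreal (exp (u * grid n (Suc k) \<omega>) * weight a u) \<partial>M) = ennreal (weight a u) * (\<integral>\<^sup>+\<omega>. W \<omega> * ennreal (exp (u * grid n (Suc k) \<omega>)) \<partial>M)"
      by (simp add: nn_integral_cmult)
  qed
  also have "\<dots> = (\<integral>\<^sup>+u. ennreal (v u) * (\<integral>\<^sup>+\<omega>. W \<omega> * ennreal (exp (u * r * grid n k \<omega>)) \<partial>M) \<partial>lborel)"
  proof (rule nn_integral_cong)
    fix u
    show "ennreal (weight a u) * (\<integral>\<^sup>+\<omega>. W \<omega> * ennreal (exp (u * grid n (Suc k) \<omega>)) \<partial>M) = ennreal (v u) * (\<integral>\<^sup>+\<omega>. W \<omega> * ennreal (exp (u * r * grid n k \<omega>)) \<partial>M)"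
    proof (cases "u \<in> {0<..<a}")
      case True
      then have u: "0 < u" "ereal u < K" using a by (auto intro: below_K)
      show ?thesis unfolding markov_exp[OF u W] v_def r_def by (simp add: ennreal_mult mult.assoc)
    next
      case False
      then have "weight a u = 0" by (simp add: weight_pos_iff)
      then show ?thesis by (simp add: v_def)
    qed
  qed
  also have "\<dots> = (\<integral>\<^sup>+u. (\<integral>\<^sup>+\<omega>. W \<omega> * (ennreal (v u) * ennreal (exp (u * r * grid n k \<omega>))) \<partial>M) \<partial>lborel)"
    by (intro nn_integral_cong) (simp add: nn_integral_cmult[symmetric] ac_simps)
  also have "\<dots> = (\<integral>\<^sup>+\<omega>. (\<integral>\<^sup>+u. W \<omega> * (ennreal (v u) * ennreal (exp (u * r * grid n k \<omega>))) \<partial>lborel) \<partial>M)"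
    by (rule P.Fubini') (simp add: split_beta', measurable)
  also have "\<dots> = (\<integral>\<^sup>+\<omega>. W \<omega> * (\<integral>\<^sup>+u. ennreal (v u) * ennreal (exp (u * r * grid n k \<omega>)) \<partial>lborel) \<partial>M)"
    by (intro nn_integral_cong nn_integral_cmult) measurable
  finally have "ennreal (r powr \<mu>) * (\<integral>\<^sup>+\<omega>. W \<omega> * G a (grid n (Suc k) \<omega>) \<partial>M) =
      (\<integral>\<^sup>+\<omega>. ennreal (r powr \<mu>) * (W \<omega> * (\<integral>\<^sup>+u. ennreal (v u) * ennreal (exp (u * r * grid n k \<omega>)) \<partial>lborel)) \<partial>M)"
    by (simp add: nn_integral_cmult)
  also have "\<dots> = (\<integral>\<^sup>+\<omega>. W \<omega> * G (a * r) (grid n k \<omega>) \<partial>M)"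
    unfolding G_scale[OF a r] v_def by (intro nn_integral_cong) (simp add: ac_simps)
  finally have "ennreal (r powr \<mu>) * (\<integral>\<^sup>+\<omega>. W \<omega> * G a (grid n (Suc k) \<omega>) \<partial>M) + (\<integral>\<^sup>+\<omega>. W \<omega> * tail a r (grid n k \<omega>) \<partial>M) =
     (\<integral>\<^sup>+\<omega>. W \<omega> * G (a * r) (grid n k \<omega>) + W \<omega> * tail a r (grid n k \<omega>) \<partial>M)"
    by (simp add: nn_integral_add)
  also have "\<dots> = (\<integral>\<^sup>+\<omega>. W \<omega> * G a (grid n k \<omega>) \<partial>M)"
    unfolding G_split[OF a r] by (simp add: distrib_left)
  finally show ?thesis ..
qed


subsection \<open>Stopping on the grid\<close>

definition disc :: "nat \<Rightarrow> real" where "disc n = exp (- \<mu> * \<beta> / 2^n)"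

lemma disc: "0 < disc n" "disc n < 1" "decay n powr \<mu> = disc n" "disc n ^ k = exp (- \<mu> * \<beta> * (real k / 2^n))"
  using mu beta by (auto simp: disc_def powr_def exp_of_nat_mult[symmetric] mult.commute)

text \<open>Indices start at 1, because passage is sought at positive times; thus
  \<open>alive c n 0\<close> is the whole space.\<close>

definition alive :: "real \<Rightarrow> nat \<Rightarrow> nat \<Rightarrow> 'a set" where
  "alive c n k = {\<omega>\<in>space M. \<forall>j\<in>{1..k}. grid n j \<omega> < c}"

text \<open>The index is shifted: \<open>hits c n k\<close> is first passage at grid time
  \<open>(k + 1) / 2^n\<close>, and the part \<open>alive c n k\<close> of its description belongs
  to the past of \<open>k / 2^n\<close>.\<close>

definition hits :: "real \<Rightarrow> nat \<Rightarrow> nat \<Rightarrow> 'a set" where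
  "hits c n k = {\<omega>\<in>alive c n k. c \<le> grid n (Suc k) \<omega>}"

lemma alive_past:
  assumes "k \<le> m" shows "alive c n k \<in> sets (past (real m / 2^n))"
proof -
  have "alive c n k = {\<omega>\<in>space (past (real m / 2^n)). \<forall>j\<in>{1..k}. grid n j \<omega> < c}"
    by (simp add: alive_def past_def)
  also have "\<dots> \<in> sets (past (real m / 2^n))"
  proof (rule sets.sets_Collect_finite_All)
    fix j assume "j \<in> {1..k}"
    then have [measurable]: "grid n j \<in> borel_measurable (past (real m / 2^n))" using assms by (intro grid_past) auto
    show "{\<omega>\<in>space (past (real m / 2^n)). grid n j \<omega> < c} \<in> sets (past (real m / 2^n))" by measurable
  qed simp
  finally show ?thesis .
qed

lemma alive_measurable [measurable]: "alive c n k \<in> sets M"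
  unfolding alive_def by measurable

lemma hits_measurable [measurable]: "hits c n k \<in> sets M"
  unfolding hits_def by measurable

lemma hits_past: "hits c n k \<in> sets (past (real (Suc k) / 2^n))"
proof -
  have *: "hits c n k = alive c n k \<inter> {\<omega>\<in>space (past (real (Suc k) / 2^n)). c \<le> grid n (Suc k) \<omega>}"
    by (auto simp: hits_def past_def alive_def)
  have [measurable]: "grid n (Suc k) \<in> borel_measurable (past (real (Suc k) / 2^n))" by (intro grid_past) auto
  have 2: "{\<omega>\<in>space (past (real (Suc k) / 2^n)). c \<le> grid n (Suc k) \<omega>} \<in> sets (past (real (Suc k) / 2^n))"
    by measurable
  show ?thesis unfolding * by (rule sets.Int[OF alive_past 2]) simp
qed

text \<open>An account of the initial value after \<open>N\<close> steps: \<open>m\<close> is what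
  is still running, \<open>g\<close> what was collected at a passage, \<open>t\<close> what the
  cut-off lost. The induction step is \<open>G_step\<close> with \<open>W\<close> the indicator of
  still being below \<open>c\<close>.\<close>

lemma stopped_balance:
  assumes a: "ereal a < K" "0 < a"
  defines "m \<equiv> \<lambda>n c k. ennreal (disc n ^ k) * (\<integral>\<^sup>+\<omega>. indicator (alive c n k) \<omega> * G a (grid n k \<omega>) \<partial>M)"
  defines "g \<equiv> \<lambda>n c k. ennreal (disc n ^ Suc k) * (\<integral>\<^sup>+\<omega>. indicator (hits c n k) \<omega> * G a (grid n (Suc k) \<omega>) \<partial>M)"
  defines "t \<equiv> \<lambda>n c k. ennreal (disc n ^ k) * (\<integral>\<^sup>+\<omega>. indicator (alive c n k) \<omega> * tail a (decay n) (grid n k \<omega>) \<partial>M)"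
  shows "G a x = m n c N + (\<Sum>k<N. g n c k) + (\<Sum>k<N. t n c k)"
proof (induction N)
  case 0
  have "m n c 0 = (\<integral>\<^sup>+\<omega>. G a x \<partial>M)"
    unfolding m_def by (simp add: alive_def grid.simps(1) indicator_def cong: nn_integral_cong)
  also have "\<dots> = G a x" by (simp add: emeasure_space_1)
  finally show ?case by simp
next
  case (Suc N)
  note [measurable] = G_measurable[OF a(1)] tail_measurable[OF a(1)]
  have ind: "indicator (alive c n N) \<omega> * G a (grid n (Suc N) \<omega>) =
      indicator (alive c n (Suc N)) \<omega> * G a (grid n (Suc N) \<omega>) + indicator (hits c n N) \<omega> * G a (grid n (Suc N) \<omega>)" for \<omega>
  proof -
    have "\<omega> \<in> alive c n (Suc N) \<longleftrightarrow> \<omega> \<in> alive c n N \<and> \<not> c \<le> grid n (Suc N) \<omega>"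
      by (auto simp: alive_def atLeastAtMostSuc_conv not_le)
    moreover have "\<omega> \<in> hits c n N \<longleftrightarrow> \<omega> \<in> alive c n N \<and> c \<le> grid n (Suc N) \<omega>" by (auto simp: hits_def)
    ultimately show ?thesis by (auto simp: indicator_def)
  qed
  have "(\<integral>\<^sup>+\<omega>. indicator (alive c n N) \<omega> * G a (grid n N \<omega>) \<partial>M) =
    ennreal (disc n) * (\<integral>\<^sup>+\<omega>. indicator (alive c n N) \<omega> * G a (grid n (Suc N) \<omega>) \<partial>M)
    + (\<integral>\<^sup>+\<omega>. indicator (alive c n N) \<omega> * tail a (decay n) (grid n N \<omega>) \<partial>M)"
    unfolding disc(3)[symmetric] by (rule G_step[OF a borel_measurable_indicator[OF alive_past[OF order_refl]]])
  also have "(\<integral>\<^sup>+\<omega>. indicator (alive c n N) \<omega> * G a (grid n (Suc N) \<omega>) \<partial>M) =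
     (\<integral>\<^sup>+\<omega>. indicator (alive c n (Suc N)) \<omega> * G a (grid n (Suc N) \<omega>) \<partial>M) + (\<integral>\<^sup>+\<omega>. indicator (hits c n N) \<omega> * G a (grid n (Suc N) \<omega>) \<partial>M)"
    unfolding ind by (rule nn_integral_add) measurable
  finally have "m n c N = m n c (Suc N) + g n c N + t n c N"
    unfolding m_def g_def t_def using disc(1)[of n] by (simp add: distrib_left ennreal_mult mult.assoc mult.left_commute)
  then show ?case using Suc by (simp add: ac_simps)
qed

text \<open>The events \<open>hits c n k\<close> are disjoint in \<open>k\<close>, so this is
  \<open>F\<close> at the first grid passage, and 0 without passage. \<open>F\<close> is a parameter
  because both discounted values and increments after the passage are evaluated this way.\<close>

definition stopped :: "(nat \<Rightarrow> nat \<Rightarrow> 'a \<Rightarrow> ennreal) \<Rightarrow> real \<Rightarrow> nat \<Rightarrow> 'a \<Rightarrow> ennreal" where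
  "stopped F c n \<omega> = (\<Sum>k. indicator (hits c n k) \<omega> * F n (Suc k) \<omega>)"

definition val :: "real \<Rightarrow> nat \<Rightarrow> nat \<Rightarrow> 'a \<Rightarrow> ennreal" where
  "val a n k \<omega> = ennreal (disc n ^ k) * G a (grid n k \<omega>)"

lemma val_measurable: "ereal a < K \<Longrightarrow> val a n k \<in> borel_measurable M"
  unfolding val_def[abs_def] using G_measurable[of a] by measurable

lemma stopped_measurable: "(\<And>k. F n k \<in> borel_measurable M) \<Longrightarrow> stopped F c n \<in> borel_measurable M"
  unfolding stopped_def[abs_def] by measurable

lemma nn_integral_stopped:
  assumes "\<And>k. F n k \<in> borel_measurable M"
  shows "integral\<^sup>N M (stopped F c n) = (\<Sum>k. \<integral>\<^sup>+\<omega>. indicator (hits c n k) \<omega> * F n (Suc k) \<omega> \<partial>M)"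
  unfolding stopped_def using assms by (intro nn_integral_suminf) measurable

lemma nn_integral_stopped_val:
  assumes "ereal a < K"
  shows "integral\<^sup>N M (stopped (val a) c n) = (\<Sum>k. ennreal (disc n ^ Suc k) * (\<integral>\<^sup>+\<omega>. indicator (hits c n k) \<omega> * G a (grid n (Suc k) \<omega>) \<partial>M))"
proof -
  note [measurable] = G_measurable[OF assms] val_measurable[OF assms]
  have "(\<integral>\<^sup>+\<omega>. indicator (hits c n k) \<omega> * val a n (Suc k) \<omega> \<partial>M) = ennreal (disc n ^ Suc k) * (\<integral>\<^sup>+\<omega>. indicator (hits c n k) \<omega> * G a (grid n (Suc k) \<omega>) \<partial>M)" for k
    unfolding val_def by (subst nn_integral_cmult[symmetric]) (auto intro!: nn_integral_cong simp: ac_simps)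
  then show ?thesis by (subst nn_integral_stopped) auto
qed

lemma stopped_le:
  assumes a: "ereal a < K" "0 < a"
  shows "integral\<^sup>N M (stopped (val a) c n) \<le> G a x"
  unfolding nn_integral_stopped_val[OF a(1)]
proof (rule suminf_le_const)
  fix N
  show "(\<Sum>k<N. ennreal (disc n ^ Suc k) * (\<integral>\<^sup>+\<omega>. indicator (hits c n k) \<omega> * G a (grid n (Suc k) \<omega>) \<partial>M)) \<le> G a x"
    unfolding stopped_balance[OF a, where n=n and c=c and N=N] by (simp add: add.assoc add.left_commute add_increasing2 add_increasing)
qed (rule summableI)

text \<open>The running part is at most \<open>disc n ^ N * G a c\<close> and dies out as
  \<open>N\<close> grows; the losses form a geometric series with ratio
  \<open>disc n\<close>.\<close>

lemma stopped_ge: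
  assumes a: "ereal a < K" "0 < a" and c: "x < c" and e: "0 \<le> e"
    and small: "\<And>w. a * decay n \<le> w \<Longrightarrow> w < a \<Longrightarrow> w powr \<mu> * exp (w * c - phi w) \<le> e"
  shows "G a x \<le> integral\<^sup>N M (stopped (val a) c n) + ennreal (e * (exp (\<beta> / 2^n) - 1) / (1 - disc n))"
proof -
  let ?r = "decay n"
  define \<delta> where "\<delta> = e * (exp (\<beta> / 2^n) - 1)"
  define S where "S = integral\<^sup>N M (stopped (val a) c n)"
  note [measurable] = G_measurable[OF a(1)] tail_measurable[OF a(1)]
  have \<delta>: "\<delta> \<ge> 0" using e beta by (simp add: \<delta>_def)
  \<comment> \<open>For \<open>k = 0\<close> the event \<open>alive\<close> imposes nothing, and the
    bound comes from \<open>x < c\<close>.\<close>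
  have lt: "grid n k \<omega> < c" if "\<omega> \<in> alive c n k" for k \<omega>
    using that c by (cases k) (auto simp: alive_def grid.simps(1))
  have m_le: "(\<integral>\<^sup>+\<omega>. indicator (alive c n k) \<omega> * G a (grid n k \<omega>) \<partial>M) \<le> G a c" for k
  proof -
    have "(\<integral>\<^sup>+\<omega>. indicator (alive c n k) \<omega> * G a (grid n k \<omega>) \<partial>M) \<le> (\<integral>\<^sup>+\<omega>. G a c \<partial>M)"
      using lt by (intro nn_integral_mono) (auto simp: indicator_def intro!: G_mono[OF less_imp_le])
    then show ?thesis by (simp add: emeasure_space_1)
  qed
  have t_le: "(\<integral>\<^sup>+\<omega>. indicator (alive c n k) \<omega> * tail a ?r (grid n k \<omega>) \<partial>M) \<le> ennreal \<delta>" for k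
  proof -
    have "tail a ?r z \<le> ennreal \<delta>" if "z < c" for z
    proof -
      have "tail a ?r z \<le> ennreal (e * (1 / ?r - 1))"
        by (rule tail_le[where c=c]) (use small a that e beta in auto)
      then show ?thesis by (simp add: \<delta>_def exp_minus inverse_eq_divide)
    qed
    then have "(\<integral>\<^sup>+\<omega>. indicator (alive c n k) \<omega> * tail a ?r (grid n k \<omega>) \<partial>M) \<le> (\<integral>\<^sup>+\<omega>. ennreal \<delta> \<partial>M)"
      using lt by (intro nn_integral_mono) (auto simp: indicator_def)
    then show ?thesis by (simp add: emeasure_space_1)
  qed
  have "G a x \<le> ennreal (disc n ^ N) * G a c + S + ennreal (\<delta> / (1 - disc n))" for N
  proof -
    have "(\<Sum>k<N. ennreal (disc n ^ k) * (\<integral>\<^sup>+\<omega>. indicator (alive c n k) \<omega> * tail a ?r (grid n k \<omega>) \<partial>M)) \<le> (\<Sum>k<N. ennreal (disc n ^ k) * ennreal \<delta>)"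
      by (intro sum_mono mult_left_mono t_le) auto
    also have "\<dots> = ennreal ((\<Sum>k<N. disc n ^ k) * \<delta>)"
      using disc[of n] \<delta> by (simp add: sum_distrib_right[symmetric] ennreal_mult sum_nonneg)
    also have "\<dots> \<le> ennreal (\<delta> / (1 - disc n))"
    proof (rule ennreal_leI)
      have "(\<Sum>k<N. disc n ^ k) \<le> 1 / (1 - disc n)"
        using disc[of n] by (subst sum_gp_strict) (auto simp: divide_right_mono)
      then have "(\<Sum>k<N. disc n ^ k) * \<delta> \<le> 1 / (1 - disc n) * \<delta>" using \<delta> by (rule mult_right_mono)
      then show "(\<Sum>k<N. disc n ^ k) * \<delta> \<le> \<delta> / (1 - disc n)" by simp
    qed
    finally have 1: "(\<Sum>k<N. ennreal (disc n ^ k) * (\<integral>\<^sup>+\<omega>. indicator (alive c n k) \<omega> * tail a ?r (grid n k \<omega>) \<partial>M)) \<le> ennreal (\<delta> / (1 - disc n))" .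
    have 2: "(\<Sum>k<N. ennreal (disc n ^ Suc k) * (\<integral>\<^sup>+\<omega>. indicator (hits c n k) \<omega> * G a (grid n (Suc k) \<omega>) \<partial>M)) \<le> S"
      unfolding S_def nn_integral_stopped_val[OF a(1)] by (rule sum_le_suminf) (auto intro: summableI)
    show ?thesis
      by (subst stopped_balance[OF a, where n=n and c=c and N=N]) (intro add_mono 1 2 mult_left_mono m_le, simp)
  qed
  moreover have "(\<lambda>N. ennreal (disc n ^ N) * G a c + S + ennreal (\<delta> / (1 - disc n))) \<longlonglongrightarrow> 0 * G a c + S + ennreal (\<delta> / (1 - disc n))"
  proof -
    have "(\<lambda>N. ennreal (disc n ^ N)) \<longlonglongrightarrow> ennreal 0"
      using disc[of n] by (intro tendsto_ennrealI LIMSEQ_power_zero) auto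
    moreover have "G a c \<noteq> \<infinity>" using G_finite[OF a(1), of c] by simp
    ultimately have "(\<lambda>N. G a c * ennreal (disc n ^ N)) \<longlonglongrightarrow> G a c * ennreal 0"
      by (intro ennreal_tendsto_cmult) (auto simp: less_top)
    then show ?thesis by (intro tendsto_add tendsto_const) (simp add: mult.commute)
  qed
  ultimately have "G a x \<le> 0 * G a c + S + ennreal (\<delta> / (1 - disc n))"
    by (intro LIMSEQ_le_const) auto
  then show ?thesis by (simp add: S_def \<delta>_def)
qed

end

subsection \<open>Hitting times along the dyadic grid\<close>

text \<open>Restricted to dyadic times, where \<open>X\<close> agrees almost surely with the
  measurable \<open>grid\<close>.\<close>

definition dyadic_hits :: "(real \<Rightarrow> real) \<Rightarrow> real \<Rightarrow> real set" where
  "dyadic_hits f c = {t. t > 0 \<and> (\<exists>n k. t = real k / 2^n) \<and> c \<le> f t}"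

text \<open>The real infimum of an empty set carries no information, so the facts about this time
  come with \<open>dyadic_hits f c \<noteq> {}\<close>.\<close>

definition dyadic_time :: "(real \<Rightarrow> real) \<Rightarrow> real \<Rightarrow> real" where
  "dyadic_time f c = Inf (dyadic_hits f c)"

lemma dyadic_hits_bdd: "bdd_below (dyadic_hits f c)"
  by (rule bdd_belowI[of _ 0]) (auto simp: dyadic_hits_def)

lemma dyadic_time_nonneg: "dyadic_hits f c \<noteq> {} \<Longrightarrow> 0 \<le> dyadic_time f c"
  unfolding dyadic_time_def by (rule cInf_greatest) (auto simp: dyadic_hits_def)

lemma dyadic_refine: "m \<le> n \<Longrightarrow> real k / 2^m = real (k * 2^(n - m)) / 2^n"
  by (auto simp: le_iff_add power_add)

lemma dyadic_between:
  fixes s t :: real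
  assumes "0 \<le> s" "s < t" obtains n k where "s < real k / 2^n" "real k / 2^n < t"
proof -
  obtain n where n: "(1/2)^n < t - s" using real_arch_pow_inv[of "t - s" "1/2"] assms by auto
  define k where "k = nat \<lfloor>s * 2^n\<rfloor> + 1"
  have k: "real k = of_int \<lfloor>s * 2^n\<rfloor> + 1" using assms by (simp add: k_def)
  have "s * 2^n < real k" "real k \<le> s * 2^n + 1" unfolding k by linarith+
  then have "s < real k / 2^n" "real k / 2^n \<le> s + (1/2)^n" by (auto simp: field_simps power_one_over)
  then show thesis using n that[of k n] by linarith
qed

lemma tendsto_right_seq:
  fixes f :: "real \<Rightarrow> real"
  assumes "(f \<longlongrightarrow> f t) (at_right t)" "s \<longlonglongrightarrow> t" "\<And>n. t \<le> s n"
  shows "(\<lambda>n. f (s n)) \<longlonglongrightarrow> f t"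
proof -
  have "continuous (at t within {t..}) f" using assms(1) by (simp add: continuous_within at_within_Ici_at_right)
  then show ?thesis using assms(2,3) unfolding continuous_within_sequentially comp_def by auto
qed

lemma tendsto_left_seq:
  fixes f :: "real \<Rightarrow> real"
  assumes "(f \<longlongrightarrow> y) (at_left t)" "s \<longlonglongrightarrow> t" "\<And>n. s n < t"
  shows "(\<lambda>n. f (s n)) \<longlonglongrightarrow> y"
  by (rule filterlim_compose[OF assms(1)]) (use assms(2,3) in \<open>auto simp: filterlim_at less_imp_neq\<close>)

text \<open>The infimum need not be dyadic itself, but hitting times approach it from the right, and
  right continuity carries the level to the limit.\<close>

lemma value_at_dyadic_time:
  assumes rc: "(f \<longlongrightarrow> f (dyadic_time f c)) (at_right (dyadic_time f c))" and ne: "dyadic_hits f c \<noteq> {}"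
  shows "c \<le> f (dyadic_time f c)"
proof -
  let ?T = "dyadic_time f c"
  have "\<exists>q\<in>dyadic_hits f c. q < ?T + 1 / real (Suc n)" for n
    using cInf_lessD[OF ne, of "?T + 1 / real (Suc n)"] unfolding dyadic_time_def by auto
  then obtain q where q: "\<And>n. q n \<in> dyadic_hits f c" "\<And>n. q n < ?T + 1 / real (Suc n)" by metis
  have le: "?T \<le> q n" for n unfolding dyadic_time_def by (rule cInf_lower[OF q(1) dyadic_hits_bdd])
  have "q \<longlonglongrightarrow> ?T"
  proof (rule tendsto_sandwich[of "\<lambda>_. ?T" _ _ "\<lambda>n. ?T + 1 / real (Suc n)"])
    show "(\<lambda>n. ?T + 1 / real (Suc n)) \<longlonglongrightarrow> ?T"
      using tendsto_add[OF tendsto_const[of ?T] LIMSEQ_inverse_real_of_nat] by (simp add: inverse_eq_divide)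
  qed (use le q(2) in \<open>auto intro!: always_eventually less_imp_le simp del: of_nat_Suc\<close>)
  from tendsto_right_seq[OF rc this le] show ?thesis
    by (rule LIMSEQ_le_const) (use q(1) in \<open>auto simp: dyadic_hits_def\<close>)
qed

context ou_passage
begin

lemma hits_unique: "\<omega> \<in> hits c n k \<Longrightarrow> \<omega> \<in> hits c n k' \<Longrightarrow> k = k'"
proof (induction k k' rule: linorder_wlog)
  case (le k k')
  show ?case
  proof (rule ccontr)
    assume "k \<noteq> k'"
    then have "Suc k \<in> {1..k'}" using le by auto
    then have "grid n (Suc k) \<omega> < c" using le(3) by (auto simp: hits_def alive_def)
    then show False using le(2) by (auto simp: hits_def)
  qed
qed auto

lemma stopped_hit:
  assumes "\<omega> \<in> hits c n k" shows "stopped F c n \<omega> = F n (Suc k) \<omega>"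
proof -
  have "stopped F c n \<omega> = (\<Sum>j\<in>{k}. indicator (hits c n j) \<omega> * F n (Suc j) \<omega>)"
    unfolding stopped_def using hits_unique[OF assms] by (intro suminf_finite) (auto simp: indicator_def)
  then show ?thesis using assms by simp
qed

lemma stopped_no_hit: "(\<And>k. \<omega> \<notin> hits c n k) \<Longrightarrow> stopped F c n \<omega> = 0"
  unfolding stopped_def by simp

lemma exists_hit:
  assumes "\<omega> \<in> space M" "c \<le> grid n (Suc j) \<omega>"
  obtains k where "\<omega> \<in> hits c n k" "k \<le> j"
proof -
  define k where "k = (LEAST k. c \<le> grid n (Suc k) \<omega>)"
  have 1: "c \<le> grid n (Suc k) \<omega>" unfolding k_def using assms(2) by (rule LeastI)
  have "grid n i \<omega> < c" if "i \<in> {1..k}" for i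
    using not_less_Least[of "i - 1" "\<lambda>k. c \<le> grid n (Suc k) \<omega>"] that by (auto simp: k_def not_le)
  with 1 have "\<omega> \<in> hits c n k" using assms by (auto simp: hits_def alive_def)
  moreover have "k \<le> j" unfolding k_def using assms(2) by (rule Least_le)
  ultimately show thesis using that by blast
qed

abbreviation path :: "'a \<Rightarrow> real \<Rightarrow> real" where "path \<omega> \<equiv> \<lambda>t. X t \<omega>"

text \<open>Gathers the almost sure properties of a path, so that the limits below are statements
  about a single \<open>\<omega>\<close>.\<close>

definition good :: "'a \<Rightarrow> bool" where
  "good \<omega> \<longleftrightarrow> \<omega> \<in> space M \<and> ou_path (\<lambda>t. X t \<omega>) (\<lambda>t. L t \<omega>) \<beta> x \<and> (\<forall>n k. X (real k / 2^n) \<omega> = grid n k \<omega>)"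

lemma AE_good: "AE \<omega> in M. good \<omega>"
proof -
  have "AE \<omega> in M. \<forall>n k. X (real k / 2^n) \<omega> = grid n k \<omega>"
    by (subst AE_all_countable) (use X_grid in blast)
  with good_paths AE_space show ?thesis by eventually_elim (auto simp: good_def)
qed

text \<open>A dyadic hitting time belongs to every sufficiently fine grid, so the passage times of
  fine grids do not exceed it; nor do they fall below the infimum. They thus converge to the infimum
  from the right, and right continuity of \<open>\<Phi>\<close> along sequences is enough.\<close>

lemma stopped_tendsto:
  assumes g: "good \<omega>"
    and F: "\<And>n k. n \<ge> p \<Longrightarrow> F n k \<omega> = \<Phi> (real k / 2^n)"
    and \<Phi>: "\<And>t s. t \<ge> 0 \<Longrightarrow> s \<longlonglongrightarrow> t \<Longrightarrow> (\<And>n. t \<le> s n) \<Longrightarrow> (\<lambda>n. \<Phi> (s n)) \<longlonglongrightarrow> \<Phi> t"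
  shows "(\<lambda>n. stopped F c n \<omega>) \<longlonglongrightarrow> (if dyadic_hits (path \<omega>) c = {} then 0 else \<Phi> (dyadic_time (path \<omega>) c))"
proof (cases "dyadic_hits (path \<omega>) c = {}")
  case True
  have "\<omega> \<notin> hits c n k" for n k
  proof
    assume "\<omega> \<in> hits c n k"
    then have "real (Suc k) / 2^n \<in> dyadic_hits (path \<omega>) c"
      using g unfolding dyadic_hits_def good_def hits_def by (simp del: of_nat_Suc) blast
    then show False using True by simp
  qed
  then have "stopped F c n \<omega> = 0" for n by (rule stopped_no_hit)
  then show ?thesis using True by simp
next
  case False
  let ?H = "dyadic_hits (path \<omega>) c" and ?T = "dyadic_time (path \<omega>) c"
  have lev: "\<exists>m. \<forall>n\<ge>m. \<exists>k. \<omega> \<in> hits c n k \<and> real (Suc k) / 2^n \<le> q" if q: "q \<in> ?H" for q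
  proof -
    obtain m j where mj: "q = real j / 2^m" "q > 0" "c \<le> X q \<omega>" using q unfolding dyadic_hits_def by auto
    have "\<exists>k. \<omega> \<in> hits c n k \<and> real (Suc k) / 2^n \<le> q" if n: "n \<ge> m" for n
    proof -
      define i where "i = j * 2^(n - m)"
      have qi: "q = real i / 2^n" using dyadic_refine[OF n, of j] mj by (simp add: i_def)
      then have "i > 0" using mj by (cases i) auto
      then obtain i' where i': "i = Suc i'" by (cases i) auto
      have "c \<le> grid n (Suc i') \<omega>" using g mj(3) unfolding qi i' good_def by metis
      then obtain k where k: "\<omega> \<in> hits c n k" "k \<le> i'"
        using exists_hit[of \<omega> c n i'] g unfolding good_def by blast
      then have "real (Suc k) / 2^n \<le> q" unfolding qi i' by (intro divide_right_mono) auto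
      then show ?thesis using k by blast
    qed
    then show ?thesis by blast
  qed
  obtain q0 where q0: "q0 \<in> ?H" using False by blast
  obtain m0 where m0: "\<And>n. n \<ge> m0 \<Longrightarrow> \<exists>k. \<omega> \<in> hits c n k" using lev[OF q0] by blast
  define m1 where "m1 = max m0 p"
  define k where "k n = (SOME k. \<omega> \<in> hits c (n + m1) k)" for n
  have k: "\<omega> \<in> hits c (n + m1) (k n)" for n
  proof -
    have "m0 \<le> n + m1" by (simp add: m1_def)
    from m0[OF this] show ?thesis unfolding k_def by (rule someI_ex)
  qed
  define s where "s n = real (Suc (k n)) / 2^(n + m1)" for n
  have sH: "s n \<in> ?H" for n
    using k[of n] g unfolding dyadic_hits_def good_def hits_def s_def by (simp del: of_nat_Suc) blast
  have s_ge: "?T \<le> s n" for n unfolding dyadic_time_def by (rule cInf_lower[OF sH dyadic_hits_bdd])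
  have "s \<longlonglongrightarrow> ?T"
  proof (rule LIMSEQ_I)
    fix e :: real assume e: "e > 0"
    then obtain q where q: "q \<in> ?H" "q < ?T + e" using cInf_lessD[OF False, of "?T + e"] unfolding dyadic_time_def by auto
    obtain m where m: "\<And>n. n \<ge> m \<Longrightarrow> \<exists>k. \<omega> \<in> hits c n k \<and> real (Suc k) / 2^n \<le> q" using lev[OF q(1)] by blast
    have "norm (s n - ?T) < e" if "n \<ge> m" for n
    proof -
      obtain k' where "\<omega> \<in> hits c (n + m1) k'" "real (Suc k') / 2^(n + m1) \<le> q" using m[of "n + m1"] \<open>n \<ge> m\<close> by auto
      then have "s n \<le> q" using hits_unique[OF k[of n]] by (auto simp: s_def)
      then show ?thesis using s_ge[of n] q by auto
    qed
    then show "\<exists>m. \<forall>n\<ge>m. norm (s n - ?T) < e" by blast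
  qed
  then have "(\<lambda>n. \<Phi> (s n)) \<longlonglongrightarrow> \<Phi> ?T" using s_ge dyadic_time_nonneg[OF False] by (intro \<Phi>)
  moreover have "stopped F c (n + m1) \<omega> = \<Phi> (s n)" for n
    using stopped_hit[OF k[of n]] F[of "n + m1" "Suc (k n)"] by (simp add: s_def m1_def del: of_nat_Suc)
  ultimately have "(\<lambda>n. stopped F c (n + m1) \<omega>) \<longlonglongrightarrow> \<Phi> ?T" by simp
  then show ?thesis using False by (simp add: LIMSEQ_offset)
qed

lemma stopped_const_le: "stopped (\<lambda>n k \<omega>. C) c n \<omega> \<le> C"
proof (cases "\<exists>k. \<omega> \<in> hits c n k")
  case True
  then obtain k where "\<omega> \<in> hits c n k" by blast
  then show ?thesis by (simp add: stopped_hit)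
next
  case False
  then show ?thesis by (simp add: stopped_no_hit)
qed

subsection \<open>Quasi-left-continuity\<close>

text \<open>The increment over the window of length \<open>1 / 2^p\<close> after a grid time,
  truncated at 1 so that no moment is required.\<close>

definition jump :: "nat \<Rightarrow> nat \<Rightarrow> nat \<Rightarrow> 'a \<Rightarrow> ennreal" where
  "jump p n k \<omega> = ennreal (min 1 \<bar>L (real k / 2^n + 1 / 2^p) \<omega> - L (real k / 2^n) \<omega>\<bar>)"

lemma jump_measurable [measurable]: "jump p n k \<in> borel_measurable M"
  unfolding jump_def[abs_def] by measurable

text \<open>The strong Markov property on a grid: each \<open>hits c n k\<close> is a past event,
  the following increment is independent of it with the law of \<open>L (1 / 2^p)\<close>, and the
  probabilities of the disjoint passages add up to at most 1.\<close>

lemma nn_integral_stopped_jump: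
  assumes "n \<ge> p"
  shows "integral\<^sup>N M (stopped (jump p) c n) \<le> (\<integral>\<^sup>+\<omega>. ennreal (min 1 \<bar>L (1 / 2^p) \<omega>\<bar>) \<partial>M)"
proof -
  define E where "E = (\<integral>\<^sup>+\<omega>. ennreal (min 1 \<bar>L (1 / 2^p) \<omega>\<bar>) \<partial>M)"
  have "(\<integral>\<^sup>+\<omega>. indicator (hits c n k) \<omega> * jump p n (Suc k) \<omega> \<partial>M) = integral\<^sup>N M (indicator (hits c n k)) * E" for k
  proof -
    \<comment> \<open>Because \<open>n \<ge> p\<close>, the window consists of
      \<open>2^(n - p)\<close> whole grid cells.\<close>
    have t: "real (Suc k) / 2^n + 1 / 2^p = real (Suc k + 2^(n - p)) / 2^n"
      using dyadic_refine[OF assms, of 1] by (simp add: add_divide_distrib)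
    note [measurable] = L_diff_future[of "Suc k" "2^(n - p)" n]
    have "jump p n (Suc k) \<in> borel_measurable (future (real (Suc k) / 2^n))"
      unfolding jump_def[abs_def] t by measurable
    then have "(\<integral>\<^sup>+\<omega>. indicator (hits c n k) \<omega> * jump p n (Suc k) \<omega> \<partial>M) = integral\<^sup>N M (indicator (hits c n k)) * integral\<^sup>N M (jump p n (Suc k))"
      using hits_past[of c n k] by (intro nn_integral_past_future[of _ "real (Suc k) / 2^n"]) (auto intro!: borel_measurable_indicator)
    also have "integral\<^sup>N M (jump p n (Suc k)) = (\<integral>\<^sup>+y. ennreal (min 1 \<bar>y\<bar>) \<partial>distr M borel (\<lambda>\<omega>. L (real (Suc k) / 2^n + 1 / 2^p) \<omega> - L (real (Suc k) / 2^n) \<omega>))"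
      unfolding jump_def by (subst nn_integral_distr) auto
    also have "\<dots> = (\<integral>\<^sup>+y. ennreal (min 1 \<bar>y\<bar>) \<partial>distr M borel (L (1 / 2^p)))"
      using L_stationary[of "real (Suc k) / 2^n" "real (Suc k) / 2^n + 1 / 2^p"] by simp
    also have "\<dots> = E" unfolding E_def by (subst nn_integral_distr) auto
    finally show ?thesis .
  qed
  then have "integral\<^sup>N M (stopped (jump p) c n) = (\<Sum>k. integral\<^sup>N M (indicator (hits c n k))) * E"
    by (subst nn_integral_stopped) auto
  also have "(\<Sum>k. integral\<^sup>N M (indicator (hits c n k))) = (\<integral>\<^sup>+\<omega>. stopped (\<lambda>n k \<omega>. 1) c n \<omega> \<partial>M)"
    by (subst nn_integral_stopped) auto
  also have "\<dots> \<le> (\<integral>\<^sup>+\<omega>. 1 \<partial>M)" by (intro nn_integral_mono stopped_const_le)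
  also have "\<dots> = 1" by (simp add: emeasure_space_1)
  finally show ?thesis by (simp add: E_def mult_right_mono)
qed

lemma small_jumps_tendsto: "(\<lambda>p. \<integral>\<^sup>+\<omega>. ennreal (min 1 \<bar>L (1 / 2^p) \<omega>\<bar>) \<partial>M) \<longlonglongrightarrow> 0"
proof -
  have "(\<lambda>p. \<integral>\<^sup>+\<omega>. ennreal (min 1 \<bar>L (1 / 2^p) \<omega>\<bar>) \<partial>M) \<longlonglongrightarrow> (\<integral>\<^sup>+\<omega>. 0 \<partial>M)"
  proof (rule nn_integral_dominated_convergence[where w="\<lambda>_. 1"])
    show "AE \<omega> in M. (\<lambda>p. ennreal (min 1 \<bar>L (1 / 2^p) \<omega>\<bar>)) \<longlonglongrightarrow> 0"
      using good_paths
    proof eventually_elim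
      case (elim \<omega>)
      interpret P: ou_path "\<lambda>t. X t \<omega>" "\<lambda>t. L t \<omega>" \<beta> x by fact
      have "(\<lambda>p. L (1 / 2^p) \<omega>) \<longlonglongrightarrow> L 0 \<omega>" using P.l_rcont[of 0] over_power2_tendsto[of 1] by (intro tendsto_right_seq[of "\<lambda>t. L t \<omega>" 0 "\<lambda>p. 1 / 2^p"]) auto
      then have "(\<lambda>p. min 1 \<bar>L (1 / 2^p) \<omega>\<bar>) \<longlonglongrightarrow> min 1 \<bar>0\<bar>" using P.l0 by (intro tendsto_intros) auto
      then show ?case using tendsto_ennrealI by fastforce
    qed
    show "(\<integral>\<^sup>+\<omega>. 1 \<partial>M) < \<infinity>" by (simp add: emeasure_space_1)
  qed (auto simp: ennreal_le_1)
  then show ?thesis by simp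
qed

text \<open>Fatou's lemma three times; the bound for a window of size \<open>1 / 2^p\<close> does
  not depend on the level, nor on the grid once it is fine enough. The nesting has the grid refined
  innermost, then the level raised, then the window shrunk.\<close>

lemma AE_jump_zero:
  "AE \<omega> in M. liminf (\<lambda>p. liminf (\<lambda>m. liminf (\<lambda>n. stopped (jump p) (c m) n \<omega>))) = 0"
proof -
  define J where "J p m \<omega> = liminf (\<lambda>n. stopped (jump p) (c m) n \<omega>)" for p m \<omega>
  define e where "e p = (\<integral>\<^sup>+\<omega>. ennreal (min 1 \<bar>L (1 / 2^p) \<omega>\<bar>) \<partial>M)" for p
  have [measurable]: "stopped (jump p) c n \<in> borel_measurable M" for p c n
    by (rule stopped_measurable) simp
  have [measurable]: "J p m \<in> borel_measurable M" for p m unfolding J_def by measurable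
  have "(\<integral>\<^sup>+\<omega>. liminf (\<lambda>p. liminf (\<lambda>m. J p m \<omega>)) \<partial>M)
      \<le> liminf (\<lambda>p. \<integral>\<^sup>+\<omega>. liminf (\<lambda>m. J p m \<omega>) \<partial>M)"
    by (rule nn_integral_liminf) measurable
  also have "\<dots> \<le> liminf e"
  proof (intro Liminf_mono always_eventually allI)
    fix p
    have 1: "integral\<^sup>N M (J p m) \<le> e p" for m
    proof -
      have "integral\<^sup>N M (J p m) \<le> liminf (\<lambda>n. integral\<^sup>N M (stopped (jump p) (c m) n))"
        unfolding J_def by (rule nn_integral_liminf) measurable
      also have "\<dots> \<le> liminf (\<lambda>n. e p)"
        using nn_integral_stopped_jump unfolding e_def by (intro Liminf_mono eventually_sequentiallyI[of p]) auto
      finally show ?thesis by (simp add: Liminf_const)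
    qed
    have "(\<integral>\<^sup>+\<omega>. liminf (\<lambda>m. J p m \<omega>) \<partial>M) \<le> liminf (\<lambda>m. \<integral>\<^sup>+\<omega>. J p m \<omega> \<partial>M)"
      by (rule nn_integral_liminf) measurable
    also have "\<dots> \<le> liminf (\<lambda>m. e p)" by (intro Liminf_mono always_eventually allI 1)
    finally show "(\<integral>\<^sup>+\<omega>. liminf (\<lambda>m. J p m \<omega>) \<partial>M) \<le> e p" by (simp add: Liminf_const)
  qed
  also have "liminf e = 0"
    using lim_imp_Liminf[OF trivial_limit_sequentially small_jumps_tendsto] by (simp add: e_def[abs_def])
  finally show ?thesis unfolding J_def[symmetric] by (subst (asm) le_zero_eq, subst (asm) nn_integral_0_iff_AE) auto
qed

text \<open>As the passage times increase strictly to \<open>s\<close>, \<open>L\<close> at these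
  times tends to its left limit \<open>y\<close>, and \<open>L\<close> at the ends of the windows
  tends to its left limit at \<open>s + 1 / 2^p\<close>. The latter tends to \<open>L s\<close> as
  the window shrinks, so the nested liminf equals
  \<open>min 1 \<bar>L s \<omega> - y\<bar>\<close>.\<close>

lemma quasi_left_continuous:
  assumes g: "good \<omega>"
    and zero: "liminf (\<lambda>p. liminf (\<lambda>m. liminf (\<lambda>n. stopped (jump p) (c m) n \<omega>))) = 0"
    and ne: "\<And>m. dyadic_hits (path \<omega>) (c m) \<noteq> {}"
    and lim: "(\<lambda>m. dyadic_time (path \<omega>) (c m)) \<longlonglongrightarrow> s" "\<And>m. dyadic_time (path \<omega>) (c m) < s"
    and l: "((\<lambda>t. L t \<omega>) \<longlongrightarrow> y) (at_left s)"
  shows "L s \<omega> = y"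
proof -
  interpret P: ou_path "\<lambda>t. X t \<omega>" "\<lambda>t. L t \<omega>" \<beta> x using g by (simp add: good_def)
  let ?T = "\<lambda>m. dyadic_time (path \<omega>) (c m)"
  have s: "s > 0" using dyadic_time_nonneg[OF ne[of 0]] lim(2)[of 0] by linarith
  define J where "J p t = ennreal (min 1 \<bar>L (t + 1 / 2^p) \<omega> - L t \<omega>\<bar>)" for p t
  have 1: "liminf (\<lambda>n. stopped (jump p) (c m) n \<omega>) = J p (?T m)" for p m
  proof -
    have "(\<lambda>n. stopped (jump p) (c m) n \<omega>) \<longlonglongrightarrow> (if dyadic_hits (path \<omega>) (c m) = {} then 0 else J p (?T m))"
    proof (rule stopped_tendsto[OF g, where p=0])
      show "jump p n k \<omega> = J p (real k / 2^n)" for n k by (simp add: jump_def J_def)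
      fix t :: real and s :: "nat \<Rightarrow> real" assume t: "t \<ge> 0" "s \<longlonglongrightarrow> t" "\<And>n. t \<le> s n"
      have "(\<lambda>n. L (s n) \<omega>) \<longlonglongrightarrow> L t \<omega>" using t P.l_rcont[of t] by (intro tendsto_right_seq[of "\<lambda>t. L t \<omega>" t s]) auto
      moreover have "(\<lambda>n. L (s n + 1 / 2^p) \<omega>) \<longlonglongrightarrow> L (t + 1 / 2^p) \<omega>"
        using t P.l_rcont[of "t + 1 / 2^p"]
        by (intro tendsto_right_seq[of "\<lambda>t. L t \<omega>" "t + 1 / 2^p" "\<lambda>n. s n + 1 / 2^p"] tendsto_intros) auto
      ultimately show "(\<lambda>n. J p (s n)) \<longlonglongrightarrow> J p t" unfolding J_def by (intro tendsto_ennrealI tendsto_intros)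
    qed
    then show ?thesis using ne by (simp add: lim_imp_Liminf)
  qed
  have "\<forall>p. \<exists>z. ((\<lambda>t. L t \<omega>) \<longlongrightarrow> z) (at_left (s + 1 / 2^p))" using P.l_left s by (simp add: add_pos_pos)
  then obtain z where z: "\<And>p. ((\<lambda>t. L t \<omega>) \<longlongrightarrow> z p) (at_left (s + 1 / 2^p))" by metis
  have 2: "liminf (\<lambda>m. J p (?T m)) = ennreal (min 1 \<bar>z p - y\<bar>)" for p
  proof -
    have "(\<lambda>m. L (?T m) \<omega>) \<longlonglongrightarrow> y" by (rule tendsto_left_seq[OF l lim])
    moreover have "(\<lambda>m. L (?T m + 1 / 2^p) \<omega>) \<longlonglongrightarrow> z p"
      using lim by (intro tendsto_left_seq[OF z, of "\<lambda>m. ?T m + 1 / 2^p"] tendsto_intros) auto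
    ultimately have "(\<lambda>m. J p (?T m)) \<longlonglongrightarrow> ennreal (min 1 \<bar>z p - y\<bar>)" unfolding J_def by (intro tendsto_ennrealI tendsto_intros)
    then show ?thesis by (simp add: lim_imp_Liminf)
  qed
  have zlim: "z \<longlonglongrightarrow> L s \<omega>"
  proof (rule LIMSEQ_I)
    fix e :: real assume e: "e > 0"
    have "eventually (\<lambda>t. dist (L t \<omega>) (L s \<omega>) < e / 2) (at_right s)"
      using tendstoD[OF P.l_rcont[of s] half_gt_zero[OF e]] s by simp
    then obtain v where v: "v > s" "\<And>t. s < t \<Longrightarrow> t < v \<Longrightarrow> \<bar>L t \<omega> - L s \<omega>\<bar> < e / 2"
      unfolding eventually_at_right_field dist_real_def by auto
    have "(\<lambda>p. s + 1 / 2^p) \<longlonglongrightarrow> s + 0"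
      by (intro tendsto_add tendsto_const over_power2_tendsto)
    then have "eventually (\<lambda>p. s + 1 / 2^p < v) sequentially" using v by (auto intro: order_tendstoD)
    then obtain p0 where p0: "\<And>p. p \<ge> p0 \<Longrightarrow> s + 1 / 2^p < v" unfolding eventually_sequentially by auto
    have "norm (z p - L s \<omega>) < e" if "p \<ge> p0" for p
    proof -
      have "eventually (\<lambda>t. \<bar>L t \<omega> - L s \<omega>\<bar> \<le> e / 2) (at_left (s + 1 / 2^p))"
        by (rule eventually_at_leftI[of s]) (use v(2) p0[OF that] in \<open>force intro: less_imp_le\<close>)+
      moreover have "((\<lambda>t. \<bar>L t \<omega> - L s \<omega>\<bar>) \<longlongrightarrow> \<bar>z p - L s \<omega>\<bar>) (at_left (s + 1 / 2^p))"
        by (intro tendsto_intros z)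
      ultimately have "\<bar>z p - L s \<omega>\<bar> \<le> e / 2"
        by (intro tendsto_upperbound[of "\<lambda>t. \<bar>L t \<omega> - L s \<omega>\<bar>" _ "at_left (s + 1 / 2^p)"]) auto
      then show ?thesis using e by simp
    qed
    then show "\<exists>p0. \<forall>p\<ge>p0. norm (z p - L s \<omega>) < e" by blast
  qed
  then have "(\<lambda>p. ennreal (min 1 \<bar>z p - y\<bar>)) \<longlonglongrightarrow> ennreal (min 1 \<bar>L s \<omega> - y\<bar>)"
    by (intro tendsto_ennrealI tendsto_intros)
  then have "liminf (\<lambda>p. ennreal (min 1 \<bar>z p - y\<bar>)) = ennreal (min 1 \<bar>L s \<omega> - y\<bar>)" by (simp add: lim_imp_Liminf)
  with zero have "ennreal (min 1 \<bar>L s \<omega> - y\<bar>) = 0" unfolding 1 2 by simp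
  then show ?thesis by (simp add: ennreal_eq_0_iff min_le_iff_disj)
qed


subsection \<open>Passage to the limit\<close>

definition payoff :: "real \<Rightarrow> 'a \<Rightarrow> real \<Rightarrow> ennreal" where
  "payoff a \<omega> t = ennreal (exp (- \<mu> * \<beta> * t)) * G a (X t \<omega>)"

text \<open>A liminf is measurable however the paths behave on a null set; on good paths it is a
  limit, identified by \<open>grid_payoff_eq\<close>.\<close>

definition grid_payoff :: "real \<Rightarrow> real \<Rightarrow> 'a \<Rightarrow> ennreal" where
  "grid_payoff a c \<omega> = liminf (\<lambda>n. stopped (val a) c n \<omega>)"

lemma payoff_tendsto:
  assumes a: "ereal a < K" and s: "s \<longlonglongrightarrow> t" and X: "(\<lambda>n. X (s n) \<omega>) \<longlonglongrightarrow> X t \<omega>"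
  shows "(\<lambda>n. payoff a \<omega> (s n)) \<longlonglongrightarrow> payoff a \<omega> t"
proof -
  have fin: "G a z = ennreal (enn2real (G a z))" for z using G_finite[OF a, of z] by simp
  have lim: "(\<lambda>n. enn2real (G a (X (s n) \<omega>))) \<longlonglongrightarrow> enn2real (G a (X t \<omega>))"
  proof (rule tendsto_enn2real)
    show "(\<lambda>n. G a (X (s n) \<omega>)) \<longlonglongrightarrow> ennreal (enn2real (G a (X t \<omega>)))"
      using G_tendsto[OF a X] fin by simp
  qed simp
  have "(\<lambda>n. ennreal (exp (- \<mu> * \<beta> * s n) * enn2real (G a (X (s n) \<omega>)))) \<longlonglongrightarrow> ennreal (exp (- \<mu> * \<beta> * t) * enn2real (G a (X t \<omega>)))"
    by (intro tendsto_ennrealI tendsto_mult[OF _ lim] tendsto_exp tendsto_mult[OF tendsto_const s])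
  then show ?thesis unfolding payoff_def by (subst (1 2) fin) (simp add: ennreal_mult)
qed

lemma stopped_val_tendsto:
  assumes g: "good \<omega>" and a: "ereal a < K"
  shows "(\<lambda>n. stopped (val a) c n \<omega>) \<longlonglongrightarrow>
    (if dyadic_hits (path \<omega>) c = {} then 0 else payoff a \<omega> (dyadic_time (path \<omega>) c))"
proof (rule stopped_tendsto[OF g, where p=0])
  interpret P: ou_path "\<lambda>t. X t \<omega>" "\<lambda>t. L t \<omega>" \<beta> x using g by (simp add: good_def)
  show "val a n k \<omega> = payoff a \<omega> (real k / 2^n)" for n k
    using g by (simp add: val_def payoff_def good_def disc(4))
  fix t :: real and s :: "nat \<Rightarrow> real" assume t: "t \<ge> 0" "s \<longlonglongrightarrow> t" "\<And>n. t \<le> s n"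
  then show "(\<lambda>n. payoff a \<omega> (s n)) \<longlonglongrightarrow> payoff a \<omega> t"
    using P.f_rcont[of t] by (intro payoff_tendsto[OF a] tendsto_right_seq[of "\<lambda>t. X t \<omega>" t s]) auto
qed

lemma grid_payoff_eq:
  "good \<omega> \<Longrightarrow> ereal a < K \<Longrightarrow> grid_payoff a c \<omega> =
    (if dyadic_hits (path \<omega>) c = {} then 0 else payoff a \<omega> (dyadic_time (path \<omega>) c))"
  unfolding grid_payoff_def by (intro lim_imp_Liminf stopped_val_tendsto) auto

lemma stopped_val_measurable: "ereal a < K \<Longrightarrow> stopped (val a) c n \<in> borel_measurable M"
  by (intro stopped_measurable val_measurable)

lemma grid_payoff_measurable: "ereal a < K \<Longrightarrow> grid_payoff a c \<in> borel_measurable M"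
  unfolding grid_payoff_def[abs_def] using stopped_val_measurable by measurable

lemma discounted_dominated:
  assumes G: "G a z \<le> ennreal C + ennreal e * G a' z" and d: "0 \<le> d" "d \<le> 1"
  shows "ennreal d * G a z \<le> ennreal C + ennreal e * (ennreal d * G a' z)"
proof -
  have "ennreal d * G a z \<le> ennreal d * (ennreal C + ennreal e * G a' z)" by (intro mult_left_mono G) simp
  also have "\<dots> = ennreal d * ennreal C + ennreal e * (ennreal d * G a' z)" by (simp add: distrib_left ac_simps)
  also have "ennreal d * ennreal C \<le> 1 * ennreal C" using d by (intro mult_right_mono) auto
  finally show ?thesis by (simp add: add_right_mono)
qed

lemma stopped_integral_tendsto:
  assumes a: "0 < a" "ereal a < K"
  shows "(\<lambda>n. integral\<^sup>N M (stopped (val a) c n)) \<longlonglongrightarrow> integral\<^sup>N M (grid_payoff a c)"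
proof -
  obtain a' where a': "a < a'" "ereal a' < K" using exists_between_K[OF a(2)] .
  obtain B where B: "G a' x = ennreal B" using G_finite[OF a'(2), of x] by (cases "G a' x") auto
  show ?thesis
  proof (rule nn_integral_tendsto_dominated_by_bounded[where Z="\<lambda>n. stopped (val a') c n"])
    show "AE \<omega> in M. (\<lambda>n. stopped (val a) c n \<omega>) \<longlonglongrightarrow> grid_payoff a c \<omega>"
      using AE_good by eventually_elim (simp add: stopped_val_tendsto grid_payoff_eq a)
    show "integral\<^sup>N M (stopped (val a') c n) \<le> ennreal B" for n
      using stopped_le[OF a'(2), of c n] a a' B by simp
    fix e :: real assume "e > 0"
    then obtain C where C: "\<And>z. G a z \<le> ennreal C + ennreal e * G a' z"
      using G_dominated[of a a' e] a a' by auto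
    have "stopped (val a) c n \<omega> \<le> ennreal C + ennreal e * stopped (val a') c n \<omega>" for n \<omega>
    proof (cases "\<exists>k. \<omega> \<in> hits c n k")
      case True
      then obtain k where k: "\<omega> \<in> hits c n k" by blast
      show ?thesis unfolding stopped_hit[OF k] val_def
        using disc(1,2)[of n] by (intro discounted_dominated C power_le_one) auto
    next
      case False
      then show ?thesis by (simp add: stopped_no_hit)
    qed
    then show "\<exists>C. \<forall>n. AE \<omega> in M. stopped (val a) c n \<omega> \<le> ennreal C + ennreal e * stopped (val a') c n \<omega>" by blast
  qed (use a a' in \<open>auto intro: stopped_val_measurable\<close>)
qed

lemma grid_payoff_le: "0 < a \<Longrightarrow> ereal a < K \<Longrightarrow> integral\<^sup>N M (grid_payoff a c) \<le> G a x"
  by (rule LIMSEQ_le_const2[OF stopped_integral_tendsto]) (auto intro: stopped_le)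

text \<open>Divided by \<open>\<beta> / 2^n\<close>, numerator and denominator tend to the
  derivatives 1 and \<open>\<mu>\<close>. The losses summed over all steps thus stay bounded as the
  grid is refined, which is where the bound \<open>e / \<mu>\<close> comes from.\<close>

lemma discount_ratio_tendsto:
  "(\<lambda>n. (exp (\<beta> / 2^n) - 1) / (1 - disc n)) \<longlonglongrightarrow> 1 / \<mu>"
proof -
  have y: "filterlim (\<lambda>n. \<beta> / 2^n) (at 0) sequentially"
    using over_power2_tendsto[of \<beta>] beta unfolding filterlim_at by auto
  have "((\<lambda>h::real. (exp (0 + h) - exp 0) / h) \<longlongrightarrow> exp 0) (at 0)"
    using DERIV_exp[of "0::real"] unfolding DERIV_def .
  from filterlim_compose[OF this y] have 1: "(\<lambda>n. (exp (\<beta> / 2^n) - 1) / (\<beta> / 2^n)) \<longlonglongrightarrow> 1" by simp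
  have "((\<lambda>h. 1 - exp (- \<mu> * h)) has_real_derivative \<mu>) (at 0)"
    by (auto intro!: derivative_eq_intros)
  from filterlim_compose[OF this[unfolded DERIV_def] y]
  have 2: "(\<lambda>n. (1 - disc n) / (\<beta> / 2^n)) \<longlonglongrightarrow> \<mu>" by (simp add: disc_def)
  have "(\<lambda>n. ((exp (\<beta> / 2^n) - 1) / (\<beta> / 2^n)) / ((1 - disc n) / (\<beta> / 2^n))) \<longlonglongrightarrow> 1 / \<mu>"
    using mu by (intro tendsto_divide 1 2) auto
  then show ?thesis using beta by simp
qed

lemma grid_payoff_ge:
  assumes a: "0 < a" "ereal a < K" "a0 < a" and c: "x < c" "c \<le> b" and e: "0 < e"
    and small: "\<And>w. a0 < w \<Longrightarrow> ereal w < K \<Longrightarrow> w powr \<mu> * exp (w * b - phi w) \<le> e"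
  shows "G a x \<le> integral\<^sup>N M (grid_payoff a c) + ennreal (e / \<mu>)"
proof -
  \<comment> \<open>On a fine grid the interval of lost mass lies entirely above \<open>a0\<close>,
    where the weight is known to be small.\<close>
  have "(\<lambda>n. a * decay n) \<longlonglongrightarrow> a * exp 0"
    by (intro tendsto_mult tendsto_const tendsto_exp over_power2_tendsto)
  then have "eventually (\<lambda>n. a0 < a * decay n) sequentially" using a by (intro order_tendstoD) auto
  then have ev: "eventually (\<lambda>n. G a x \<le> integral\<^sup>N M (stopped (val a) c n) + ennreal (e * ((exp (\<beta> / 2^n) - 1) / (1 - disc n)))) sequentially"
  proof eventually_elim
    case (elim n)
    have "G a x \<le> integral\<^sup>N M (stopped (val a) c n) + ennreal (e * (exp (\<beta> / 2^n) - 1) / (1 - disc n))"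
    proof (rule stopped_ge[OF a(2,1) c(1)])
      fix w assume w: "a * decay n \<le> w" "w < a"
      have "0 < a * decay n" using a by simp
      then have w0: "0 < w" using w by linarith
      have "w powr \<mu> * exp (w * c - phi w) \<le> w powr \<mu> * exp (w * b - phi w)"
        using c w0 by (intro mult_left_mono) auto
      also have "\<dots> \<le> e" using elim w below_K[OF a(2), of w] by (intro small) auto
      finally show "w powr \<mu> * exp (w * c - phi w) \<le> e" .
    qed (use e in simp)
    then show ?case by simp
  qed
  have "(\<lambda>n. integral\<^sup>N M (stopped (val a) c n) + ennreal (e * ((exp (\<beta> / 2^n) - 1) / (1 - disc n)))) \<longlonglongrightarrow>
      integral\<^sup>N M (grid_payoff a c) + ennreal (e * (1 / \<mu>))"
    by (intro tendsto_add tendsto_ennrealI tendsto_mult tendsto_const discount_ratio_tendsto stopped_integral_tendsto a)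
  then have "G a x \<le> integral\<^sup>N M (grid_payoff a c) + ennreal (e * (1 / \<mu>))"
    by (rule tendsto_lowerbound[OF _ ev]) simp
  then show ?thesis by simp
qed

section \<open>From levels below \<open>b\<close> to \<open>b\<close> itself\<close>

definition hit_payoff :: "real \<Rightarrow> real \<Rightarrow> 'a \<Rightarrow> ennreal" where
  "hit_payoff a b \<omega> = (if hitting_time X b \<omega> = \<infinity> then 0 else payoff a \<omega> (real_of_ereal (hitting_time X b \<omega>)))"

lemma hit_payoff_eq_zero: "{t. t > 0 \<and> b \<le> X t \<omega>} = {} \<Longrightarrow> hit_payoff a b \<omega> = 0"
proof -
  assume "{t. t > 0 \<and> b \<le> X t \<omega>} = {}"
  then have "{ereal t |t. t > 0 \<and> b \<le> X t \<omega>} = {}" by auto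
  then have "hitting_time X b \<omega> = \<infinity>" unfolding hitting_time_def by (simp only: Inf_empty top_ereal_def)
  then show ?thesis by (simp add: hit_payoff_def)
qed

lemma hit_payoff_eq:
  assumes "s > 0" "b \<le> X s \<omega>" "\<And>t. t > 0 \<Longrightarrow> b \<le> X t \<omega> \<Longrightarrow> s \<le> t"
  shows "hit_payoff a b \<omega> = payoff a \<omega> s"
proof -
  have "hitting_time X b \<omega> = ereal s"
    unfolding hitting_time_def using assms by (intro antisym Inf_lower Inf_greatest) auto
  then show ?thesis by (simp add: hit_payoff_def)
qed

text \<open>Either some level below \<open>b\<close> is missed by all dyadic times, or the passage
  times tend to infinity and the discount kills the value, or they increase to a finite
  \<open>s\<close>. In the last case the path is at least \<open>b\<close> at \<open>s\<close>, and
  every time at or above \<open>b\<close> is at least \<open>s\<close>.\<close>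

lemma hit_payoff_tendsto:
  assumes g: "good \<omega>" and a: "ereal a < K"
    and c: "mono c" "c \<longlonglongrightarrow> b" "\<And>m. x < c m" "\<And>m. c m < b"
    and zero: "liminf (\<lambda>p. liminf (\<lambda>m. liminf (\<lambda>n. stopped (jump p) (c m) n \<omega>))) = 0"
  shows "(\<lambda>m. grid_payoff a (c m) \<omega>) \<longlonglongrightarrow> hit_payoff a b \<omega>"
proof -
  interpret P: ou_path "\<lambda>t. X t \<omega>" "\<lambda>t. L t \<omega>" \<beta> x using g by (simp add: good_def)
  let ?f = "\<lambda>t. X t \<omega>"
  define H where "H m = dyadic_hits ?f (c m)" for m
  define T where "T m = dyadic_time ?f (c m)" for m
  have V: "grid_payoff a (c m) \<omega> = (if H m = {} then 0 else payoff a \<omega> (T m))" for m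
    unfolding H_def T_def by (rule grid_payoff_eq[OF g a])
  have H_anti: "H n \<subseteq> H m" if "m \<le> n" for m n
    using monoD[OF c(1) that] unfolding H_def dyadic_hits_def by auto
  \<comment> \<open>At a time when the path is at least \<open>b\<close>, it exceeds
    \<open>c m\<close> strictly, hence also on an interval to the right, which contains dyadic times
    arbitrarily close to \<open>t\<close>.\<close>
  have below: "H m \<noteq> {} \<and> T m \<le> t" if t: "t > 0" "b \<le> ?f t" for m t
  proof -
    have "eventually (\<lambda>s. c m < ?f s) (at_right t)"
    proof (rule order_tendstoD(1))
      show "(?f \<longlongrightarrow> ?f t) (at_right t)" using t by (intro P.f_rcont) simp
      show "c m < ?f t" using t c(4)[of m] by linarith
    qed
    then obtain v where v: "v > t" "\<And>s. t < s \<Longrightarrow> s < v \<Longrightarrow> c m < ?f s" unfolding eventually_at_right_field by auto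
    have ex: "\<exists>q\<in>H m. q < v'" if "v' > t" for v'
    proof -
      have "t < min v v'" using v that by simp
      then obtain n k where nk: "t < real k / 2^n" "real k / 2^n < min v v'"
        using dyadic_between[of t "min v v'"] t by (metis less_imp_le)
      then have "real k / 2^n \<in> H m"
        using v(2)[of "real k / 2^n"] t unfolding H_def dyadic_hits_def by (auto intro: less_imp_le)
      then show ?thesis using nk by auto
    qed
    have "T m \<le> v'" if v': "v' > t" for v'
    proof -
      obtain q where q: "q \<in> H m" "q < v'" using ex[OF v'] by blast
      have "T m \<le> q" using q(1) unfolding T_def H_def dyadic_time_def by (intro cInf_lower dyadic_hits_bdd)
      then show ?thesis using q by linarith
    qed
    then show ?thesis using ex[of "t + 1"] dense_ge[of t "T m"] by auto
  qed
  show ?thesis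
  proof (cases "\<exists>m. H m = {}")
    case True
    then obtain m0 where m0: "H m0 = {}" by blast
    then have "{t. t > 0 \<and> b \<le> ?f t} = {}" using below by blast
    then have "hit_payoff a b \<omega> = 0" by (rule hit_payoff_eq_zero)
    moreover have "eventually (\<lambda>m. grid_payoff a (c m) \<omega> = 0) sequentially"
      using H_anti m0 by (intro eventually_sequentiallyI[of m0]) (auto simp: V)
    ultimately show ?thesis by (simp add: tendsto_eventually)
  next
    case False
    then have ne: "H m \<noteq> {}" for m by blast
    have T_nonneg: "T m \<ge> 0" for m using ne unfolding T_def H_def by (rule dyadic_time_nonneg)
    have T_val: "c m \<le> ?f (T m)" for m
      using value_at_dyadic_time[of ?f "c m"] P.f_rcont[OF T_nonneg[of m]] ne[of m] unfolding T_def H_def by blast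
    have T_pos: "T m > 0" for m
    proof -
      have "T m \<noteq> 0" using T_val[of m] P.f0 c(3)[of m] by auto
      then show ?thesis using T_nonneg[of m] by simp
    qed
    have T_mono: "mono T"
      unfolding T_def dyadic_time_def using H_anti ne by (intro monoI cInf_superset_mono dyadic_hits_bdd) (auto simp: H_def)
    have V': "grid_payoff a (c m) \<omega> = payoff a \<omega> (T m)" for m using ne V by simp
    show ?thesis
    proof (cases "bdd_above (range T)")
      case False
      have no: "{t. t > 0 \<and> b \<le> ?f t} = {}"
        using below False by (auto simp: bdd_above_def) (meson)
      then have hp: "hit_payoff a b \<omega> = 0" by (rule hit_payoff_eq_zero)
      have T_top: "filterlim T at_top sequentially"
        unfolding filterlim_at_top
      proof
        fix Z
        obtain m where "T m > Z" using False by (auto simp: bdd_above_def not_le)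
        then show "eventually (\<lambda>n. Z \<le> T n) sequentially"
          using T_mono by (intro eventually_sequentiallyI[of m]) (meson less_imp_le monoD order_trans)
      qed
      have "(\<lambda>m. ennreal (exp (- \<mu> * \<beta> * T m))) \<longlonglongrightarrow> ennreal 0"
      proof (intro tendsto_ennrealI filterlim_compose[OF exp_at_bot])
        have "filterlim (\<lambda>m. (\<mu> * \<beta>) * T m) at_top sequentially"
          using mu beta by (intro filterlim_tendsto_pos_mult_at_top[OF tendsto_const _ T_top]) auto
        then show "filterlim (\<lambda>m. - \<mu> * \<beta> * T m) at_bot sequentially"
          by (simp add: filterlim_uminus_at_bot)
      qed
      then have "(\<lambda>m. G a b * ennreal (exp (- \<mu> * \<beta> * T m))) \<longlonglongrightarrow> G a b * ennreal 0"
        using G_finite[OF a, of b] by (intro ennreal_tendsto_cmult) auto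
      then have "(\<lambda>m. G a b * ennreal (exp (- \<mu> * \<beta> * T m))) \<longlonglongrightarrow> 0" by simp
      \<comment> \<open>The level \<open>b\<close> is never reached, so monotonicity bounds the
        undiscounted value by \<open>G a b\<close>.\<close>
      moreover have "payoff a \<omega> (T m) \<le> G a b * ennreal (exp (- \<mu> * \<beta> * T m))" for m
      proof -
        have "?f (T m) \<le> b" using no T_pos[of m] by (auto simp: not_le intro: less_imp_le)
        then show ?thesis unfolding payoff_def by (subst mult.commute) (intro mult_right_mono G_mono, auto)
      qed
      ultimately have "(\<lambda>m. payoff a \<omega> (T m)) \<longlonglongrightarrow> 0"
        by (intro tendsto_sandwich[of "\<lambda>_. 0" "\<lambda>m. payoff a \<omega> (T m)" sequentially "\<lambda>m. G a b * ennreal (exp (- \<mu> * \<beta> * T m))"]) auto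
      then show ?thesis by (simp add: V' hp)
    next
      case True
      define s where "s = (SUP m. T m)"
      have Ts: "T \<longlonglongrightarrow> s" unfolding s_def using True T_mono by (intro LIMSEQ_incseq_SUP) auto
      have T_le: "T m \<le> s" for m unfolding s_def using True by (intro cSUP_upper) auto
      have s: "s > 0" using T_pos[of 0] T_le[of 0] by linarith
      have min: "s \<le> t" if "t > 0" "b \<le> ?f t" for t
        unfolding s_def using below[OF that] by (intro cSUP_least) auto
      \<comment> \<open>If the passage times become constant there is nothing to show; if they stay
        strictly below \<open>s\<close>, the path might jump there, and this is what
        quasi-left-continuity rules out.\<close>
      have lim: "b \<le> ?f s \<and> (\<lambda>m. ?f (T m)) \<longlonglongrightarrow> ?f s"
      proof (cases "\<exists>m. T m = s")
        case True
        then obtain m0 where m0: "T m0 = s" by blast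
        have eq: "T m = s" if "m \<ge> m0" for m
          using monoD[OF T_mono that] T_le[of m] m0 by simp
        have "(\<lambda>m. ?f (T m)) \<longlonglongrightarrow> ?f s"
          by (rule tendsto_eventually) (auto intro!: eventually_sequentiallyI[of m0] simp: eq)
        moreover from this have "b \<le> ?f s" using T_val by (intro LIMSEQ_le[OF c(2)]) auto
        ultimately show ?thesis by blast
      next
        case False
        then have lt: "T m < s" for m using T_le[of m] by (auto simp: less_le)
        obtain y where y: "((\<lambda>t. L t \<omega>) \<longlongrightarrow> y) (at_left s)" using P.l_left[OF s] by blast
        have "L s \<omega> = y"
          using ne lt Ts y unfolding T_def H_def by (intro quasi_left_continuous[OF g zero])
        then have "(?f \<longlongrightarrow> ?f s) (at_left s)" using P.f_left[OF s y] by simp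
        then have "(\<lambda>m. ?f (T m)) \<longlonglongrightarrow> ?f s" using tendsto_left_seq[OF _ Ts lt] by blast
        moreover from this have "b \<le> ?f s" using T_val by (intro LIMSEQ_le[OF c(2)]) auto
        ultimately show ?thesis by blast
      qed
      then have "hit_payoff a b \<omega> = payoff a \<omega> s" using s min by (intro hit_payoff_eq) auto
      moreover have "(\<lambda>m. payoff a \<omega> (T m)) \<longlonglongrightarrow> payoff a \<omega> s" using lim by (intro payoff_tendsto[OF a Ts]) auto
      ultimately show ?thesis by (simp add: V')
    qed
  qed
qed

text \<open>The hitting time ranges over uncountably many times, so measurability of
  \<open>hit_payoff\<close> is obtained only up to a null set, from the liminf of grid values. The
  lower bound keeps the error \<open>e / \<mu>\<close> of the cut-off.\<close>

lemma hit_payoff_integral: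
  assumes b: "x < b" and a: "0 < a" "ereal a < K"
  shows "\<exists>R. R \<in> borel_measurable M \<and> (AE \<omega> in M. hit_payoff a b \<omega> = R \<omega>)"
    and "integral\<^sup>N M (hit_payoff a b) \<le> G a x"
    and "a0 < a \<Longrightarrow> 0 < e \<Longrightarrow> (\<And>w. a0 < w \<Longrightarrow> ereal w < K \<Longrightarrow> w powr \<mu> * exp (w * b - phi w) \<le> e) \<Longrightarrow>
      G a x \<le> integral\<^sup>N M (hit_payoff a b) + ennreal (e / \<mu>)"
proof -
  obtain c :: "nat \<Rightarrow> real" where c: "mono c" "c \<longlonglongrightarrow> b" "\<And>m. x < c m" "\<And>m. c m < b" by (rule increasing_approximation[OF b]) blast
  have lim: "AE \<omega> in M. (\<lambda>m. grid_payoff a (c m) \<omega>) \<longlonglongrightarrow> hit_payoff a b \<omega>"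
    using AE_good AE_jump_zero[of c] by eventually_elim (rule hit_payoff_tendsto[OF _ a(2) c])
  have "(\<lambda>\<omega>. liminf (\<lambda>m. grid_payoff a (c m) \<omega>)) \<in> borel_measurable M"
    using grid_payoff_measurable[OF a(2)] by measurable
  moreover have "AE \<omega> in M. hit_payoff a b \<omega> = liminf (\<lambda>m. grid_payoff a (c m) \<omega>)"
    using lim by eventually_elim (simp add: lim_imp_Liminf)
  ultimately show "\<exists>R. R \<in> borel_measurable M \<and> (AE \<omega> in M. hit_payoff a b \<omega> = R \<omega>)" by blast
  obtain a' where a': "a < a'" "ereal a' < K" using exists_between_K[OF a(2)] .
  obtain B where B: "G a' x = ennreal B" using G_finite[OF a'(2), of x] by (cases "G a' x") auto
  have conv: "(\<lambda>m. integral\<^sup>N M (grid_payoff a (c m))) \<longlonglongrightarrow> integral\<^sup>N M (hit_payoff a b)"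
  proof (rule nn_integral_tendsto_dominated_by_bounded[where Z="\<lambda>m. grid_payoff a' (c m)", OF _ _ lim])
    show "integral\<^sup>N M (grid_payoff a' (c m)) \<le> ennreal B" for m
      using grid_payoff_le[of a' "c m"] a a' B by simp
    fix e :: real assume "e > 0"
    then obtain C where C: "\<And>z. G a z \<le> ennreal C + ennreal e * G a' z"
      using G_dominated[of a a' e] a a' by auto
    have "AE \<omega> in M. grid_payoff a (c m) \<omega> \<le> ennreal C + ennreal e * grid_payoff a' (c m) \<omega>" for m
      using AE_good
    proof eventually_elim
      case (elim \<omega>)
      show ?case
      proof (cases "dyadic_hits (path \<omega>) (c m) = {}")
        case True
        then show ?thesis using elim a a' by (simp add: grid_payoff_eq)
      next
        case False
        have "payoff a \<omega> t \<le> ennreal C + ennreal e * payoff a' \<omega> t" if "t \<ge> 0" for t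
          unfolding payoff_def using that mu beta by (intro discounted_dominated C) auto
        then show ?thesis using False elim a a' dyadic_time_nonneg[OF False] by (simp add: grid_payoff_eq)
      qed
    qed
    then show "\<exists>C. \<forall>n. AE \<omega> in M. grid_payoff a (c n) \<omega> \<le> ennreal C + ennreal e * grid_payoff a' (c n) \<omega>" by blast
  qed (use a a' in \<open>auto intro: grid_payoff_measurable\<close>)
  show "integral\<^sup>N M (hit_payoff a b) \<le> G a x"
    by (rule LIMSEQ_le_const2[OF conv]) (use a grid_payoff_le in auto)
  assume a0: "a0 < a" and e: "0 < e" and small: "\<And>w. a0 < w \<Longrightarrow> ereal w < K \<Longrightarrow> w powr \<mu> * exp (w * b - phi w) \<le> e"
  have "(\<lambda>m. integral\<^sup>N M (grid_payoff a (c m)) + ennreal (e / \<mu>)) \<longlonglongrightarrow> integral\<^sup>N M (hit_payoff a b) + ennreal (e / \<mu>)"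
    by (intro tendsto_intros conv)
  moreover have "G a x \<le> integral\<^sup>N M (grid_payoff a (c m)) + ennreal (e / \<mu>)" for m
    by (rule grid_payoff_ge[OF a a0 c(3) less_imp_le[OF c(4)] e small])
  ultimately show "G a x \<le> integral\<^sup>N M (hit_payoff a b) + ennreal (e / \<mu>)"
    by (intro LIMSEQ_le_const) auto
qed

section \<open>Removing the cut-off\<close>

lemma exhausting_sequence:
  obtains A :: "nat \<Rightarrow> real" where "mono A" "\<And>i. 0 < A i" "\<And>i. ereal (A i) < K" "\<And>w. ereal w < K \<Longrightarrow> \<exists>i. w < A i"
proof (cases "K = \<infinity>")
  case True
  show thesis
  proof (rule that[of "\<lambda>i. real (Suc i)"])
    show "\<exists>i. w < real (Suc i)" for w using reals_Archimedean2[of w] by (metis less_trans of_nat_less_iff lessI)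
  qed (auto simp: True mono_def)
next
  case False
  then obtain k where k: "K = ereal k" "k > 0" using K_pos by (cases K) auto
  obtain A :: "nat \<Rightarrow> real" where A: "mono A" "A \<longlonglongrightarrow> k" "\<And>i. 0 < A i" "\<And>i. A i < k"
    by (rule increasing_approximation[OF k(2)]) blast
  show thesis
  proof (rule that[OF A(1,3)])
    show "ereal (A i) < K" for i using A(4) k by simp
    fix w assume "ereal w < K"
    then have "eventually (\<lambda>i. w < A i) sequentially" using k by (intro order_tendstoD(1)[OF A(2)]) simp
    then show "\<exists>i. w < A i" unfolding eventually_sequentially by blast
  qed
qed

lemma G_mono_upper: "a \<le> a' \<Longrightarrow> G a z \<le> G a' z"
  unfolding G_def by (intro nn_integral_mono ennreal_leI) (auto simp: weight_def indicator_def)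

lemma ou_G_eq_SUP:
  fixes A :: "nat \<Rightarrow> real"
  assumes A: "mono A" "\<And>i. 0 < A i" "\<And>i. ereal (A i) < K" "\<And>w. ereal w < K \<Longrightarrow> \<exists>i. w < A i"
  shows "ou_G M L \<beta> z \<mu> = (SUP i. G (A i) z)"
proof -
  have "ou_G M L \<beta> z \<mu> = (\<integral>\<^sup>+u. (SUP i. ennreal (exp (u * z) * weight (A i) u)) \<partial>lborel)"
    unfolding ou_G_def
  proof (rule nn_integral_cong)
    fix u :: real
    let ?g = "ennreal (exp (u * z - phi u) * u powr (\<mu> - 1))"
    have w: "ennreal (exp (u * z) * weight (A i) u) = ?g * indicator {0<..<A i} u" for i
      by (auto simp: weight_def exp_diff exp_minus field_simps split: split_indicator)
    show "?g * indicator {u. 0 < u \<and> ereal u < K} u = (SUP i. ennreal (exp (u * z) * weight (A i) u))"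
      unfolding w
    proof (cases "0 < u \<and> ereal u < K")
      case True
      then obtain i where i: "u < A i" using A(4) by blast
      show "?g * indicator {u. 0 < u \<and> ereal u < K} u = (SUP i. ?g * indicator {0<..<A i} u)"
      proof (rule antisym)
        show "?g * indicator {u. 0 < u \<and> ereal u < K} u \<le> (SUP i. ?g * indicator {0<..<A i} u)"
          using True i by (intro SUP_upper2[of i]) auto
        show "(SUP i. ?g * indicator {0<..<A i} u) \<le> ?g * indicator {u. 0 < u \<and> ereal u < K} u"
          using True by (intro SUP_least) (auto split: split_indicator)
      qed
    next
      case False
      then have "indicator {0<..<A i} u = (0::ennreal)" for i
        using below_K[OF A(3)[of i], of u] by (auto simp: indicator_def)
      then show "?g * indicator {u. 0 < u \<and> ereal u < K} u = (SUP i. ?g * indicator {0<..<A i} u)"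
        using False by simp
    qed
  qed
  also have "\<dots> = (SUP i. G (A i) z)"
    unfolding G_def
  proof (rule nn_integral_monotone_convergence_SUP)
    show "incseq (\<lambda>i u. ennreal (exp (u * z) * weight (A i) u))"
      using monoD[OF A(1)] by (intro monoI le_funI ennreal_leI) (fastforce simp: weight_def indicator_def)
    show "(\<lambda>u. ennreal (exp (u * z) * weight (A i) u)) \<in> borel_measurable lborel" for i
      using weight_measurable[OF A(3)] by measurable
  qed
  finally show ?thesis .
qed

lemma eventually_near_K_obtain:
  assumes "eventually P near_K" obtains a0 where "ereal a0 < K" "\<And>w. a0 < w \<Longrightarrow> ereal w < K \<Longrightarrow> P w"
proof (cases "K = \<infinity>")
  case True
  then obtain a0 where "\<And>w. a0 \<le> w \<Longrightarrow> P w" using assms by (auto simp: near_K_def eventually_at_top_linorder)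
  then show thesis using that[of a0] True by auto
next
  case False
  then obtain k where k: "K = ereal k" using K_pos by (cases K) auto
  then obtain a0 where "a0 < k" "\<And>w. a0 < w \<Longrightarrow> w < k \<Longrightarrow> P w"
    using assms by (auto simp: near_K_def eventually_at_left_field)
  then show thesis using that[of a0] k by auto
qed

lemma passage_identity:
  assumes b: "x < b"
  shows "(\<integral>\<^sup>+\<omega>. (if hitting_time X b \<omega> = \<infinity> then 0
                 else ennreal (exp (- \<mu> * \<beta> * real_of_ereal (hitting_time X b \<omega>)))
                      * ou_G M L \<beta> (X (real_of_ereal (hitting_time X b \<omega>)) \<omega>) \<mu>) \<partial>M)
         = ou_G M L \<beta> x \<mu>"
proof -
  obtain A :: "nat \<Rightarrow> real" where A: "mono A" "\<And>i. 0 < A i" "\<And>i. ereal (A i) < K" "\<And>w. ereal w < K \<Longrightarrow> \<exists>i. w < A i"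
    by (rule exhausting_sequence) blast
  have ouG: "ou_G M L \<beta> z \<mu> = (SUP i. G (A i) z)" for z by (rule ou_G_eq_SUP[OF A])
  define E where "E i = integral\<^sup>N M (hit_payoff (A i) b)" for i
  have payoff_mono: "hit_payoff (A i) b \<omega> \<le> hit_payoff (A j) b \<omega>" if "i \<le> j" for i j \<omega>
    unfolding hit_payoff_def payoff_def using G_mono_upper[OF monoD[OF A(1) that]] by (auto intro: mult_left_mono)
  \<comment> \<open>Monotone convergence needs measurable functions, so \<open>hit_payoff\<close> is
    exchanged for measurable versions simultaneously for all cut-offs.\<close>
  have "\<forall>i. \<exists>R. R \<in> borel_measurable M \<and> (AE \<omega> in M. hit_payoff (A i) b \<omega> = R \<omega>)"
    using hit_payoff_integral(1)[OF b A(2) A(3)] by blast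
  then obtain R where R [measurable]: "\<And>i. R i \<in> borel_measurable M" and hR: "\<And>i. AE \<omega> in M. hit_payoff (A i) b \<omega> = R i \<omega>" by metis
  have "AE \<omega> in M. \<forall>i. hit_payoff (A i) b \<omega> = R i \<omega>" using hR by (subst AE_all_countable) blast
  then have SUP_eq: "(\<integral>\<^sup>+\<omega>. (SUP i. hit_payoff (A i) b \<omega>) \<partial>M) = (\<integral>\<^sup>+\<omega>. (SUP i. R i \<omega>) \<partial>M)"
    by (intro nn_integral_cong_AE) (auto elim!: eventually_mono)
  also have "\<dots> = (SUP i. integral\<^sup>N M (R i))"
  proof (rule nn_integral_monotone_convergence_SUP_AE)
    show "AE \<omega> in M. R i \<omega> \<le> R (Suc i) \<omega>" for i
      using hR[of i] hR[of "Suc i"]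
    proof eventually_elim
      case (elim \<omega>)
      then show ?case using payoff_mono[of i "Suc i" \<omega>] by simp
    qed
  qed simp
  also have "\<dots> = (SUP i. E i)"
    using nn_integral_cong_AE[OF hR] by (simp add: E_def)
  finally have conv: "(\<integral>\<^sup>+\<omega>. (SUP i. hit_payoff (A i) b \<omega>) \<partial>M) = (SUP i. E i)" .
  have "(SUP i. E i) = (SUP i. G (A i) x)"
  proof (rule antisym)
    show "(SUP i. E i) \<le> (SUP i. G (A i) x)"
      using hit_payoff_integral(2)[OF b A(2) A(3)] unfolding E_def by (intro SUP_mono) blast
    show "(SUP i. G (A i) x) \<le> (SUP i. E i)"
    proof (rule SUP_least, rule ennreal_le_epsilon)
      fix i and r :: real assume r: "r > 0"
      \<comment> \<open>Chosen so that the error \<open>e / \<mu>\<close> equals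
        \<open>r\<close>.\<close>
      define e where "e = r * \<mu>"
      have e: "e > 0" using r mu by (simp add: e_def)
      obtain a0 where a0: "ereal a0 < K" "\<And>w. a0 < w \<Longrightarrow> ereal w < K \<Longrightarrow> w powr \<mu> * exp (w * b - phi w) \<le> e"
        using eventually_near_K_obtain[OF weight_small[OF unb e mu]] by blast
      obtain j' where j': "a0 < A j'" using A(4)[OF a0(1)] by blast
      \<comment> \<open>The cut-off must lie beyond \<open>a0\<close>, where the loss is small, and
        must not be smaller than the given \<open>A i\<close>.\<close>
      define j where "j = max i j'"
      have j: "i \<le> j" "a0 < A j" using j' monoD[OF A(1), of j' j] by (auto simp: j_def)
      have "G (A i) x \<le> G (A j) x" by (rule G_mono_upper[OF monoD[OF A(1) j(1)]])
      also have "\<dots> \<le> E j + ennreal (e / \<mu>)"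
        unfolding E_def by (rule hit_payoff_integral(3)[OF b A(2) A(3) j(2) e a0(2)])
      also have "E j \<le> (SUP i. E i)"
        by (rule SUP_upper) simp
      also have "e / \<mu> = r" using mu by (simp add: e_def)
      finally show "G (A i) x \<le> (SUP i. E i) + ennreal r" by (simp add: add_right_mono)
    qed
  qed
  moreover have "(if hitting_time X b \<omega> = \<infinity> then 0
                 else ennreal (exp (- \<mu> * \<beta> * real_of_ereal (hitting_time X b \<omega>)))
                      * ou_G M L \<beta> (X (real_of_ereal (hitting_time X b \<omega>)) \<omega>) \<mu>) = (SUP i. hit_payoff (A i) b \<omega>)" for \<omega>
    by (simp add: hit_payoff_def payoff_def ouG SUP_mult_left_ennreal)
  ultimately show ?thesis using conv by (simp add: ouG)
qed

end

theorem theorem1: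
  fixes M :: "'a measure" and L X :: "real \<Rightarrow> 'a \<Rightarrow> real" and nu :: "real measure"
    and \<beta> x b \<mu> :: real
  assumes levy: "levy_process M L"
    and nu: "levy_measure M L nu" and nu_pos: "emeasure nu {0<..} > 0"
    and log_moment: "integrable M (\<lambda>\<omega>. ln (1 + \<bar>L 1 \<omega>\<bar>))"
    and beta: "\<beta> > 0"
    and X_meas: "\<And>t. t \<ge> 0 \<Longrightarrow> X t \<in> borel_measurable M"
    and OU: "AE \<omega> in M. \<forall>t\<ge>0. set_integrable lborel {0..t} (\<lambda>s. X s \<omega>) \<and>
               X t \<omega> = x - \<beta> * (LINT s:{0..t}|lborel. X s \<omega>) + L t \<omega>"
    and b: "b > x"
    and K_pos: "mgf_bound M L > 0"
    and phi_K: "filterlim (ou_phi M L \<beta>) at_top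
                  (if mgf_bound M L = \<infinity> then at_top else at_left (real_of_ereal (mgf_bound M L)))"
    and mu: "\<mu> > 0"
  shows "(\<integral>\<^sup>+ \<omega>. (if hitting_time X b \<omega> = \<infinity> then 0
                 else ennreal (exp (- \<mu> * \<beta> * real_of_ereal (hitting_time X b \<omega>)))
                      * ou_G M L \<beta> (X (real_of_ereal (hitting_time X b \<omega>)) \<omega>) \<mu>) \<partial>M)
         = ou_G M L \<beta> x \<mu>"
proof -
  interpret prob_space M using levy by (simp add: levy_process_def)
  interpret levy M L by unfold_locales (rule levy)
  obtain \<gamma> \<sigma> where "levy_khintchine M L nu \<gamma> \<sigma>"
  proof -
    obtain \<gamma> \<sigma> where "\<forall>\<theta>::real. char (distr M borel (L 1)) \<theta> =
          exp (\<i> * complex_of_real (\<gamma> * \<theta>) - complex_of_real (\<sigma>\<^sup>2 * \<theta>\<^sup>2 / 2)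
               + (CLINT y|nu. levy_kernel \<theta> y))"
      using nu unfolding levy_measure_def levy_kernel_def by blast
    then have "levy_khintchine M L nu \<gamma> \<sigma>"
      using nu unfolding levy_measure_def by unfold_locales auto
    then show thesis using that by blast
  qed
  then interpret levy_khintchine M L nu \<gamma> \<sigma> .
  have "ou_passage M L \<beta> X x \<mu>"
    using beta K_pos phi_K OU mu L_unbounded_above[OF nu_pos]
    by unfold_locales (auto simp: near_K_def)
  then show ?thesis by (rule ou_passage.passage_identity) (use b in simp)
qed

end
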